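(* Fix $s\ge2$, $\kappa>0$, $\gamma>0$, $0\le\overline\mu<1$, and let $\rho=\gamma/\kappa$. Let $\mathfrak X_{s,\kappa}(\gamma,\overline\mu)$, $\overline C_2$, $A_\star$, $\eta_\star$ and the localization modulus $\mathfrak R_{\mathfrak X}$ be as defined in the context, and assume $\overline C_2<\frac23$ and $A_\star>0$. Put $$c_\eta:=\frac23-\overline C_2-\left(\frac2{\sqrt5}+\frac23\right)\eta .$$ Then every nonempty $\mathfrak X\subset\mathfrak X_{s,\kappa}(\gamma,\overline\mu)$ satisfies $$\mathfrak R_{\mathfrak X}(\eta)\le\frac{2}{\sqrt3\,c_\eta}\frac{\eta}{\kappa},\qquad 0\le\eta<\eta_\star .$$ Suppose, in addition, that there exist $X_0=\{x_1,\dots,x_s\}\in\mathfrak X$, a unit vector $v\in\mathbb R^3$ and $t_0>0$ such that $$X_t:=\{x_1+tv,x_2,\dots,x_s\}\in\mathfrak X\quad(0\le t\le t_0),\qquad t_0\le\frac{\delta_{X_0}}4 .$$ Then $$\frac{\sqrt{3(1-\overline\mu)}}{2}\frac{\eta}{\kappa}\le\mathfrak R_{\mathfrak X}(\eta)\le\frac{2}{\sqrt3\,c_\eta}\frac{\eta}{\kappa}$$ whenever $0<\eta<\eta_\star$ and $\eta\le\frac{\kappa t_0}{\sqrt{3(1-\overline\mu)}}$. Consequently, on every such class $\mathfrak X$ containing such a one-point displacement path, $\mathfrak R_{\mathfrak X}(\eta)\asymp\frac{\eta}{\kappa}$ as $\eta\downarrow0$, with implied constants depending only on $\overline\mu$,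 $s$ (and the dimensionless parameter $\gamma$).
   Context: $B_r(x)$ is the open Euclidean ball in $\mathbb R^3$. $\mathcal H=L^2(\mathbb S^2,\frac{d\omega}{4\pi})$ (complex), with norm and operator norm $\|\cdot\|_2$; $\varphi_z(\omega)=e^{i\kappa\omega\cdot z}$; for a set $X$ of $s$ distinct points, $\mathcal U_X=\operatorname{span}\{\varphi_x:x\in X\}$, $\delta_X$ is the minimum distance between distinct points of $X$, and $\mu_X=\frac92\frac{s^{2/3}}{\kappa\delta_X}$. $P_{\mathcal V}$ is the orthogonal projector onto $\mathcal V$, and $\operatorname{Gr}_s(\mathcal H)$ is the set of $s$-dimensional subspaces of $\mathcal H$. $\mathcal X_s(B_1)$ is the set of unordered $s$-point subsets of $B_1(0)$, with the bottleneck matching distance $d_{\rm match}(X,Y)=\min_{\pi\in S_s}\max_{1\le j\le s}|x_j-y_{\pi(j)}|$. The uniform class is $$\mathfrak X_{s,\kappa}(\gamma,\overline\mu)=\Bigl\{X\in\mathcal X_s(B_1):\ \bigcup_{x\in X}\overline{B_\rho(x)}\subset B_1(0),\ \rho\le\tfrac{\delta_X}2,\ \mu_X\le\overline\mu\Bigr\}.$$ Constants: $c_\nu=\sup_{t>0}|t\cos t-\sin t|/t$, $b_\gamma=1-\sup_{t\ge\gamma}(\sin t/t)^2$, $$\overline\nu=\frac{64c_\nu^2}{27}\frac{\overline\mu^2}{s},\qquad \overline C_1=\frac{\gamma^2}9+\overline\nu+\sqrt{1+\overline\nu}\sqrt{\left(\tfrac13+\tfrac{\gamma^2}{10}\right)^2+4\overline\nu},\qquad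 \overline C_2=\frac{8\gamma^2}{15}+6\overline\nu+\frac{2\overline\mu}{1-\overline\mu}\overline C_1,$$ $$A_\star=\frac{b_\gamma-\overline\mu-\overline\nu}{1-\overline\mu},\quad \eta_{\rm loc}=\frac{\frac{\sqrt3}2\gamma\left(\frac23-\overline C_2\right)}{1+\frac{\sqrt3}2\gamma\left(\frac2{\sqrt5}+\frac23\right)},\quad \eta_{\rm gap}=\sin\left(\tfrac12\arcsin\sqrt{A_\star}\right),\quad \eta_\star=\min\{\eta_{\rm loc},\eta_{\rm gap}\}.$$ The localization modulus of a nonempty class $\mathfrak X$ is $$\mathfrak R_{\mathfrak X}(\eta)=\inf_{\widehat X}\ \sup_{X\in\mathfrak X}\ \sup_{\substack{\widetilde{\mathcal U}\in\operatorname{Gr}_s(\mathcal H)\\ \|P_{\widetilde{\mathcal U}}-P_{\mathcal U_X}\|_2\le\eta}}d_{\rm match}\bigl(\widehat X(\widetilde{\mathcal U}),X\bigr),$$ where the infimum is over all maps $\widehat X:\operatorname{Gr}_s(\mathcal H)\to\mathcal X_s(B_1)$. *)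

theory Defs
  imports "HOL-Analysis.Analysis"
begin

section \<open>The Hilbert space of square-integrable functions on the sphere\<close>

text \<open>
  The normalised surface measure $d\omega/4\pi$ on the unit sphere, as the image of the uniform
  distribution on the unit ball under $x \mapsto x/|x|$.  It is carried by all of
  \<^typ>\<open>real^3\<close> and concentrated on the sphere (lemma \<open>AE_sphere_measure\<close>).
\<close>

definition sphere_measure :: "(real^3) measure" where
  "sphere_measure = distr (uniform_measure lborel (ball 0 1)) borel (\<lambda>x. x /\<^sub>R norm x)"

lemma sets_sphere_measure [simp, measurable_cong]: "sets sphere_measure = sets borel"
  by (simp add: sphere_measure_def)

lemma space_sphere_measure [simp]: "space sphere_measure = UNIV"
  by (simp add: sphere_measure_def)

lemma emeasure_unit_ball_pos_finite:
  "emeasure lborel (ball (0::real^3) 1) \<noteq> 0" "emeasure lborel (ball (0::real^3) 1) \<noteq> \<infinity>"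
proof -
  have "measure lborel (ball (0::real^3) 1) > 0"
    using content_ball_pos[of 1 "0::real^3"] by simp
  then show "emeasure lborel (ball (0::real^3) 1) \<noteq> 0"
    by (metis less_numeral_extra(3) measure_eq_emeasure_eq_ennreal ennreal_0 measure_def
        enn2real_0)
  show "emeasure lborel (ball (0::real^3) 1) \<noteq> \<infinity>"
    using emeasure_lborel_ball_finite[of "0::real^3" 1] by auto
qed

lemma emeasure_sphere_measure_UNIV: "emeasure sphere_measure UNIV = 1"
proof -
  have "emeasure sphere_measure UNIV
      = emeasure (uniform_measure lborel (ball (0::real^3) 1)) UNIV"
    unfolding sphere_measure_def by (subst emeasure_distr) auto
  also have "\<dots> = 1"
    using emeasure_unit_ball_pos_finite
    by (subst emeasure_uniform_measure) (auto intro!: ennreal_divide_self simp: less_top)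
  finally show ?thesis .
qed

lemma finite_measure_sphere_measure: "finite_measure sphere_measure"
  by (rule finite_measureI) (simp add: emeasure_sphere_measure_UNIV)

lemma AE_sphere_measure: "AE \<omega> in sphere_measure. \<omega> \<in> sphere 0 1"
proof -
  have "AE x in lborel. x \<noteq> (0::real^3)"
    by (rule AE_lborel_singleton)
  then have "AE x in uniform_measure lborel (ball (0::real^3) 1). x /\<^sub>R norm x \<in> sphere 0 1"
    using emeasure_unit_ball_pos_finite
    by (subst AE_uniform_measure) (auto simp: less_top elim!: eventually_mono)
  then show ?thesis
    unfolding sphere_measure_def by (subst AE_distr_iff) auto
qed

definition square_integrable :: "(real^3 \<Rightarrow> complex) \<Rightarrow> bool" where
  "square_integrable f \<longleftrightarrow>
     f \<in> borel_measurable sphere_measure \<and> integrable sphere_measure (\<lambda>\<omega>. (norm (f \<omega>))\<^sup>2)"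

definition L2_rel :: "(real^3 \<Rightarrow> complex) \<Rightarrow> (real^3 \<Rightarrow> complex) \<Rightarrow> bool" where
  "L2_rel f g \<longleftrightarrow>
     square_integrable f \<and> square_integrable g \<and> (AE \<omega> in sphere_measure. f \<omega> = g \<omega>)"

lemma square_integrable_zero: "square_integrable (\<lambda>_. 0)"
  by (simp add: square_integrable_def)

lemma square_integrable_add:
  assumes "square_integrable f" "square_integrable g"
  shows "square_integrable (\<lambda>\<omega>. f \<omega> + g \<omega>)"
proof -
  have [measurable]: "f \<in> borel_measurable sphere_measure" "g \<in> borel_measurable sphere_measure"
    using assms by (auto simp: square_integrable_def)
  have le: "(norm (f \<omega> + g \<omega>))\<^sup>2 \<le> 2 * (norm (f \<omega>))\<^sup>2 + 2 * (norm (g \<omega>))\<^sup>2" for \<omega>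
  proof -
    have "(norm (f \<omega> + g \<omega>))\<^sup>2 \<le> (norm (f \<omega>) + norm (g \<omega>))\<^sup>2"
      by (intro power_mono norm_triangle_ineq) auto
    also have "\<dots> \<le> 2 * (norm (f \<omega>))\<^sup>2 + 2 * (norm (g \<omega>))\<^sup>2"
      using sum_squares_bound[of "norm (f \<omega>)" "norm (g \<omega>)"] by (simp add: power2_sum)
    finally show ?thesis .
  qed
  have "integrable sphere_measure (\<lambda>\<omega>. 2 * (norm (f \<omega>))\<^sup>2 + 2 * (norm (g \<omega>))\<^sup>2)"
    using assms by (auto simp: square_integrable_def)
  then have "integrable sphere_measure (\<lambda>\<omega>. (norm (f \<omega> + g \<omega>))\<^sup>2)"
    by (rule Bochner_Integration.integrable_bound) (use le in auto)
  then show ?thesis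
    by (simp add: square_integrable_def)
qed

lemma square_integrable_scale:
  assumes "square_integrable f"
  shows "square_integrable (\<lambda>\<omega>. c * f \<omega>)"
  using assms by (auto simp: square_integrable_def norm_mult power_mult_distrib)

lemma square_integrable_bounded:
  assumes "f \<in> borel_measurable borel" "\<And>\<omega>. norm (f \<omega>) \<le> B"
  shows "square_integrable f"
proof -
  interpret finite_measure sphere_measure by (rule finite_measure_sphere_measure)
  have [measurable]: "f \<in> borel_measurable sphere_measure"
    using assms(1) by simp
  have "integrable sphere_measure (\<lambda>\<omega>. (norm (f \<omega>))\<^sup>2)"
    by (rule integrable_const_bound[where B = "B\<^sup>2"]) (auto intro!: power_mono assms)
  then show ?thesis
    by (simp add: square_integrable_def)
qed

lemma integrable_mult_cnj:
  assumes "square_integrable f" "square_integrable g"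
  shows "integrable sphere_measure (\<lambda>\<omega>. f \<omega> * cnj (g \<omega>))"
proof -
  have [measurable]: "f \<in> borel_measurable sphere_measure" "g \<in> borel_measurable sphere_measure"
    using assms by (auto simp: square_integrable_def)
  have le: "norm (f \<omega> * cnj (g \<omega>)) \<le> (norm (f \<omega>))\<^sup>2 + (norm (g \<omega>))\<^sup>2" for \<omega>
  proof -
    have "norm (f \<omega>) * norm (g \<omega>) \<le> 2 * (norm (f \<omega>) * norm (g \<omega>))"
      by simp
    also have "\<dots> \<le> (norm (f \<omega>))\<^sup>2 + (norm (g \<omega>))\<^sup>2"
      using sum_squares_bound[of "norm (f \<omega>)" "norm (g \<omega>)"] by simp
    finally show ?thesis
      by (simp add: norm_mult)
  qed
  have "integrable sphere_measure (\<lambda>\<omega>. (norm (f \<omega>))\<^sup>2 + (norm (g \<omega>))\<^sup>2)"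
    using assms by (auto simp: square_integrable_def)
  moreover have "(\<lambda>\<omega>. f \<omega> * cnj (g \<omega>)) \<in> borel_measurable sphere_measure"
    by (intro borel_measurable_times borel_measurable_continuous_on[where f = cnj])
       (auto intro: continuous_intros)
  ultimately show ?thesis
    by (rule Bochner_Integration.integrable_bound) (use le in auto)
qed

quotient_type sphere_L2 = "real^3 \<Rightarrow> complex" / partial: L2_rel
proof (rule part_equivpI)
  show "\<exists>f. L2_rel f f"
    using square_integrable_zero by (auto simp: L2_rel_def)
  show "symp L2_rel"
    by (rule sympI) (auto simp: L2_rel_def elim: eventually_mono)
  show "transp L2_rel"
    by (rule transpI) (auto simp: L2_rel_def elim: eventually_elim2)
qed

lift_definition scaleC :: "complex \<Rightarrow> sphere_L2 \<Rightarrow> sphere_L2" is "\<lambda>c f \<omega>. c * f \<omega>"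
  by (auto simp: L2_rel_def intro: square_integrable_scale elim: eventually_mono)

lift_definition cinner :: "sphere_L2 \<Rightarrow> sphere_L2 \<Rightarrow> complex" is
  "\<lambda>f g. \<integral>\<omega>. f \<omega> * cnj (g \<omega>) \<partial>sphere_measure"
proof -
  fix f f' g g'
  assume "L2_rel f f'" and "L2_rel g g'"
  then have sq: "square_integrable f" "square_integrable f'" "square_integrable g" "square_integrable g'"
    and ae: "AE \<omega> in sphere_measure. f \<omega> = f' \<omega>" "AE \<omega> in sphere_measure. g \<omega> = g' \<omega>"
    by (auto simp: L2_rel_def)
  show "(\<integral>\<omega>. f \<omega> * cnj (g \<omega>) \<partial>sphere_measure) = (\<integral>\<omega>. f' \<omega> * cnj (g' \<omega>) \<partial>sphere_measure)"
    by (rule integral_cong_AE)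
       (use integrable_mult_cnj[OF sq(1,3)] integrable_mult_cnj[OF sq(2,4)] ae in
         \<open>auto elim: eventually_elim2\<close>)
qed

instantiation sphere_L2 :: real_inner
begin

lift_definition zero_sphere_L2 :: sphere_L2 is "\<lambda>_. 0"
  by (simp add: L2_rel_def square_integrable_zero)

lift_definition plus_sphere_L2 :: "sphere_L2 \<Rightarrow> sphere_L2 \<Rightarrow> sphere_L2" is
  "\<lambda>f g \<omega>. f \<omega> + g \<omega>"
  by (auto simp: L2_rel_def intro: square_integrable_add elim: eventually_elim2)

definition uminus_sphere_L2 :: "sphere_L2 \<Rightarrow> sphere_L2" where
  "- f = scaleC (- 1) f"

definition minus_sphere_L2 :: "sphere_L2 \<Rightarrow> sphere_L2 \<Rightarrow> sphere_L2" where
  "f - g = f + - (g :: sphere_L2)"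

definition scaleR_sphere_L2 :: "real \<Rightarrow> sphere_L2 \<Rightarrow> sphere_L2" where
  "r *\<^sub>R f = scaleC (of_real r) f"

definition inner_sphere_L2 :: "sphere_L2 \<Rightarrow> sphere_L2 \<Rightarrow> real" where
  "inner f g = Re (cinner f g)"

definition norm_sphere_L2 :: "sphere_L2 \<Rightarrow> real" where
  "norm f = sqrt (inner f (f :: sphere_L2))"

definition sgn_sphere_L2 :: "sphere_L2 \<Rightarrow> sphere_L2" where
  "sgn f = scaleC (of_real (inverse (norm f))) f"

definition dist_sphere_L2 :: "sphere_L2 \<Rightarrow> sphere_L2 \<Rightarrow> real" where
  "dist f g = norm (f - g :: sphere_L2)"

definition uniformity_sphere_L2 :: "(sphere_L2 \<times> sphere_L2) filter" where
  "uniformity = (INF e\<in>{0<..}. principal {(f, g). dist f (g :: sphere_L2) < e})"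

definition open_sphere_L2 :: "sphere_L2 set \<Rightarrow> bool" where
  "open U \<longleftrightarrow> (\<forall>f\<in>U. \<forall>\<^sub>F (f', g) in uniformity. f' = f \<longrightarrow> g \<in> (U :: sphere_L2 set))"

instance
proof
  fix f g h :: sphere_L2 and r q :: real
  show "f + g + h = f + (g + h)"
    by transfer (auto simp: L2_rel_def add_ac intro!: square_integrable_add)
  show "f + g = g + f"
    by transfer (auto simp: L2_rel_def add_ac intro!: square_integrable_add)
  show "0 + f = f"
    by transfer (auto simp: L2_rel_def)
  show "- f + f = 0"
    unfolding uminus_sphere_L2_def
    by transfer (auto simp: L2_rel_def square_integrable_zero)
  show "f - g = f + - g"
    by (rule minus_sphere_L2_def)
  show "r *\<^sub>R (f + g) = r *\<^sub>R f + r *\<^sub>R g"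
    unfolding scaleR_sphere_L2_def
    by transfer (auto simp: L2_rel_def distrib_left distrib_right intro!: square_integrable_add square_integrable_scale)
  show "(r + q) *\<^sub>R f = r *\<^sub>R f + q *\<^sub>R f"
    unfolding scaleR_sphere_L2_def
    by transfer (auto simp: L2_rel_def distrib_left distrib_right intro!: square_integrable_add square_integrable_scale)
  show "r *\<^sub>R q *\<^sub>R f = (r * q) *\<^sub>R f"
    unfolding scaleR_sphere_L2_def
    by transfer (auto simp: L2_rel_def mult.assoc intro!: square_integrable_scale)
  show "1 *\<^sub>R f = f"
    unfolding scaleR_sphere_L2_def by transfer (auto simp: L2_rel_def)
  show "sgn f = inverse (norm f) *\<^sub>R f"
    by (simp add: sgn_sphere_L2_def scaleR_sphere_L2_def)
  show "dist f g = norm (f - g)"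
    by (rule dist_sphere_L2_def)
  show "uniformity = (INF e\<in>{0<..}. principal {(f, g). dist f (g :: sphere_L2) < e})"
    by (rule uniformity_sphere_L2_def)
  show "open U \<longleftrightarrow> (\<forall>f\<in>U. \<forall>\<^sub>F (f', g) in uniformity. f' = f \<longrightarrow> g \<in> U)" for U :: "sphere_L2 set"
    by (rule open_sphere_L2_def)
  have cnj_cinner: "cinner f g = cnj (cinner g f)"
    by transfer (subst Bochner_Integration.integral_cnj [symmetric], simp add: mult.commute)
  show "inner f g = inner g f"
    unfolding inner_sphere_L2_def using cnj_cinner by simp
  have "cinner (f + g) h = cinner f h + cinner g h"
    by transfer
       (simp add: L2_rel_def distrib_right integrable_mult_cnj flip: Bochner_Integration.integral_add)
  then show "inner (f + g) h = inner f h + inner g h"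
    by (simp add: inner_sphere_L2_def)
  have "cinner (scaleC c f) g = c * cinner f g" for c
    by transfer (simp add: mult.assoc)
  then show "inner (r *\<^sub>R f) g = r * inner f g"
    by (simp add: inner_sphere_L2_def scaleR_sphere_L2_def)
  have *: "inner f f \<ge> 0 \<and> (inner f f = 0 \<longrightarrow> f = 0)"
    unfolding inner_sphere_L2_def
  proof transfer
    fix f assume "L2_rel f f"
    then have sq: "square_integrable f"
      by (simp add: L2_rel_def)
    have "(\<integral>\<omega>. f \<omega> * cnj (f \<omega>) \<partial>sphere_measure)
        = (\<integral>\<omega>. complex_of_real ((norm (f \<omega>))\<^sup>2) \<partial>sphere_measure)"
      by (rule Bochner_Integration.integral_cong) (auto simp: complex_norm_square simp del: of_real_power)
    then have eq: "Re (\<integral>\<omega>. f \<omega> * cnj (f \<omega>) \<partial>sphere_measure)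
        = (\<integral>\<omega>. (norm (f \<omega>))\<^sup>2 \<partial>sphere_measure)"
      by (simp only: integral_complex_of_real Re_complex_of_real)
    have int: "integrable sphere_measure (\<lambda>\<omega>. (norm (f \<omega>))\<^sup>2)"
      using sq by (simp add: square_integrable_def)
    show "0 \<le> Re (\<integral>\<omega>. f \<omega> * cnj (f \<omega>) \<partial>sphere_measure) \<and>
        (Re (\<integral>\<omega>. f \<omega> * cnj (f \<omega>) \<partial>sphere_measure) = 0 \<longrightarrow> L2_rel f (\<lambda>_. 0))"
      unfolding eq
      using integral_nonneg_eq_0_iff_AE[OF int] sq
      by (auto simp: L2_rel_def square_integrable_zero)
  qed
  show "0 \<le> inner f f"
    using * by simp
  have "inner (0 :: sphere_L2) 0 = 0"
    unfolding inner_sphere_L2_def by transfer simp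
  then show "inner f f = 0 \<longleftrightarrow> f = 0"
    using * by auto
  show "norm f = sqrt (inner f f)"
    by (rule norm_sphere_L2_def)
qed

end

global_interpretation cL2: vector_space scaleC
proof
  fix a b :: complex and f g :: sphere_L2
  show "scaleC a (f + g) = scaleC a f + scaleC a g"
    by transfer (auto simp: L2_rel_def distrib_left distrib_right intro!: square_integrable_add square_integrable_scale)
  show "scaleC (a + b) f = scaleC a f + scaleC b f"
    by transfer (auto simp: L2_rel_def distrib_left distrib_right intro!: square_integrable_add square_integrable_scale)
  show "scaleC a (scaleC b f) = scaleC (a * b) f"
    by transfer (auto simp: L2_rel_def mult.assoc intro!: square_integrable_scale)
  show "scaleC 1 f = f"
    by transfer (auto simp: L2_rel_def)
qed

text \<open>
  Spans, independence and dimension below are over the complex numbers.  For the finite-dimensional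
  subspaces in \<open>Gr s\<close> the description in \<open>orth_proj\<close> determines a unique
  vector.  The operator norm \<^const>\<open>onorm\<close> only uses the norm, so it does not matter that
  the library phrases it for real normed spaces.
\<close>

definition Gr :: "nat \<Rightarrow> sphere_L2 set set" where
  "Gr s = {cL2.span B |B. finite B \<and> card B = s \<and> cL2.independent B}"

definition orth_proj :: "sphere_L2 set \<Rightarrow> sphere_L2 \<Rightarrow> sphere_L2" where
  "orth_proj V f = (THE p. p \<in> V \<and> (\<forall>v\<in>V. cinner (f - p) v = 0))"

definition proj_dist :: "sphere_L2 set \<Rightarrow> sphere_L2 set \<Rightarrow> real" where
  "proj_dist V W = onorm (\<lambda>f. orth_proj V f - orth_proj W f)"

lift_definition plane_wave :: "real \<Rightarrow> real^3 \<Rightarrow> sphere_L2" is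
  "\<lambda>\<kappa> z \<omega>. exp (\<i> * of_real (\<kappa> * (\<omega> \<bullet> z)))"
  by (auto simp: L2_rel_def intro!: square_integrable_bounded[where B = 1]
      borel_measurable_continuous_onI continuous_intros)

definition signal_space :: "real \<Rightarrow> (real^3) set \<Rightarrow> sphere_L2 set" where
  "signal_space \<kappa> X = cL2.span (plane_wave \<kappa> ` X)"


section \<open>Point configurations\<close>

definition point_sets :: "nat \<Rightarrow> (real^3) set set" where
  "point_sets s = {X. X \<subseteq> ball 0 1 \<and> finite X \<and> card X = s}"

definition min_sep :: "(real^3) set \<Rightarrow> real" where
  "min_sep X = Min {dist x y |x y. x \<in> X \<and> y \<in> X \<and> x \<noteq> y}"

definition mu :: "real \<Rightarrow> (real^3) set \<Rightarrow> real" where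
  "mu \<kappa> X = 9 / 2 * (real (card X) powr (2 / 3) / (\<kappa> * min_sep X))"

text \<open>
  The permutations of the labels correspond to the bijections from \<open>X\<close> to \<open>Y\<close>; they
  are taken extensional so that there are finitely many of them.
\<close>

definition d_match :: "(real^3) set \<Rightarrow> (real^3) set \<Rightarrow> real" where
  "d_match X Y = Min {Max ((\<lambda>x. dist x (\<pi> x)) ` X) |\<pi>. \<pi> \<in> X \<rightarrow>\<^sub>E Y \<and> bij_betw \<pi> X Y}"

definition uniform_class :: "nat \<Rightarrow> real \<Rightarrow> real \<Rightarrow> real \<Rightarrow> (real^3) set set" where
  "uniform_class s \<kappa> \<gamma> \<mu> =
     {X \<in> point_sets s. (\<Union>x\<in>X. cball x (\<gamma> / \<kappa>)) \<subseteq> ball 0 1 \<and>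
        \<gamma> / \<kappa> \<le> min_sep X / 2 \<and> mu \<kappa> X \<le> \<mu>}"

text \<open>
  The localization modulus takes values in \<^typ>\<open>ereal\<close> so that all suprema and infima are the
  intended ones without boundedness side conditions.
\<close>

definition loc_modulus :: "nat \<Rightarrow> real \<Rightarrow> (real^3) set set \<Rightarrow> real \<Rightarrow> ereal" where
  "loc_modulus s \<kappa> \<XX> \<eta> =
     (INF Xhat \<in> Gr s \<rightarrow> point_sets s.
        SUP X \<in> \<XX>.
          SUP U \<in> {U \<in> Gr s. proj_dist U (signal_space \<kappa> X) \<le> \<eta>}.
            ereal (d_match (Xhat U) X))"

definition displacement_path :: "(real^3) set set \<Rightarrow> real \<Rightarrow> bool" where
  "displacement_path \<XX> t0 \<longleftrightarrow>
     t0 > 0 \<and>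
     (\<exists>X0\<in>\<XX>. \<exists>x1\<in>X0. \<exists>v. norm v = 1 \<and> t0 \<le> min_sep X0 / 4 \<and>
        (\<forall>t\<in>{0..t0}. insert (x1 + t *\<^sub>R v) (X0 - {x1}) \<in> \<XX>))"


section \<open>Constants\<close>

definition c_nu :: real where
  "c_nu = (SUP t\<in>{0<..}. \<bar>t * cos t - sin t\<bar> / t)"

definition b_gam :: "real \<Rightarrow> real" where
  "b_gam \<gamma> = 1 - (SUP t\<in>{\<gamma>..}. (sin t / t)\<^sup>2)"

definition nu_bar :: "nat \<Rightarrow> real \<Rightarrow> real" where
  "nu_bar s \<mu> = 64 * c_nu\<^sup>2 / 27 * (\<mu>\<^sup>2 / real s)"

definition C1 :: "nat \<Rightarrow> real \<Rightarrow> real \<Rightarrow> real" where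
  "C1 s \<gamma> \<mu> =
     \<gamma>\<^sup>2 / 9 + nu_bar s \<mu>
       + sqrt (1 + nu_bar s \<mu>) * sqrt ((1 / 3 + \<gamma>\<^sup>2 / 10)\<^sup>2 + 4 * nu_bar s \<mu>)"

definition C2 :: "nat \<Rightarrow> real \<Rightarrow> real \<Rightarrow> real" where
  "C2 s \<gamma> \<mu> = 8 * \<gamma>\<^sup>2 / 15 + 6 * nu_bar s \<mu> + 2 * \<mu> / (1 - \<mu>) * C1 s \<gamma> \<mu>"

definition A_star :: "nat \<Rightarrow> real \<Rightarrow> real \<Rightarrow> real" where
  "A_star s \<gamma> \<mu> = (b_gam \<gamma> - \<mu> - nu_bar s \<mu>) / (1 - \<mu>)"

definition eta_loc :: "nat \<Rightarrow> real \<Rightarrow> real \<Rightarrow> real" where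
  "eta_loc s \<gamma> \<mu> =
     (sqrt 3 / 2 * \<gamma> * (2 / 3 - C2 s \<gamma> \<mu>)) / (1 + sqrt 3 / 2 * \<gamma> * (2 / sqrt 5 + 2 / 3))"

definition eta_gap :: "nat \<Rightarrow> real \<Rightarrow> real \<Rightarrow> real" where
  "eta_gap s \<gamma> \<mu> = sin (1 / 2 * arcsin (sqrt (A_star s \<gamma> \<mu>)))"

definition eta_star :: "nat \<Rightarrow> real \<Rightarrow> real \<Rightarrow> real" where
  "eta_star s \<gamma> \<mu> = min (eta_loc s \<gamma> \<mu>) (eta_gap s \<gamma> \<mu>)"

definition c_eta :: "nat \<Rightarrow> real \<Rightarrow> real \<Rightarrow> real \<Rightarrow> real" where
  "c_eta s \<gamma> \<mu> \<eta> = 2 / 3 - C2 s \<gamma> \<mu> - (2 / sqrt 5 + 2 / 3) * \<eta>"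

end

theory Submission
  imports Defs
begin

text \<open>
  The residual \<open>F(z) = \<parallel>(I - P) \<phi>\<^sub>z\<parallel>\<^sup>2\<close> of a subspace close to the signal space of \<open>X\<close> is strongly convex
  on the balls of radius \<open>\<gamma>/\<kappa>\<close> about the points of \<open>X\<close>, has a small gradient at these points, and exceeds
  \<open>\<eta>\<^sup>2\<close> outside the balls. Hence the critical points with residual at most \<open>\<eta>\<^sup>2\<close>, a set that depends on the
  subspace alone, consist of exactly one point near each point of \<open>X\<close>; they are the estimator for the upper
  bound. The convexity comes from replacing the Gram matrix of the plane waves by the identity, at a cost
  controlled by packing sums of the decaying sinc kernel. For the lower bound, moving one point by \<open>t\<close>
  rotates the signal space by at most \<open>\<kappa>t / sqrt (3(1 - \<mu>))\<close>, so no map can separate the two configurations.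
\<close>

section \<open>Means over the sphere\<close>

text \<open>The radius \<open>\<gamma>/\<kappa>\<close> serves two opposite ends. It must be small,
  so that near a node the kernels keep roughly their values at 0: the Hessian of the residual there
  is \<open>\<kappa>^2\<close> times 2/3, twice the second moment 1/3 of the sphere, and
  \<open>C2\<close> is what is lost. It must be large, so that outside the balls not even the
  nearest node accounts for the wave; \<open>A_star\<close> measures that gap. Passing from the
  signal space to a subspace at distance \<open>\<eta>\<close> costs (2/sqrt 5 + 2/3)
  \<open>\<eta>\<close> in the Hessian, and leaves at the nodes a gradient of at most
  \<open>2 * \<eta> * \<kappa> / sqrt 3\<close>. The quotient of gradient and Hessian bounds is the
  upper bound of the theorem; \<open>eta_loc\<close> is the level at which it reaches the radius,
  and \<open>eta_gap\<close> comes from adding two angles. A point close to a node is at least half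
  the separation away from all others, so these enter only through square sums of kernels; this
  yields the factor \<open>\<mu>^2 / s\<close> in \<open>nu_bar\<close>. Every integral over the
  sphere is derived from rotation invariance: it gives an integration by parts formula, and that
  gives the moments and a differential equation for the kernel.\<close>

abbreviation sphere_mean :: "(real^3 \<Rightarrow> 'b::{banach, second_countable_topology}) \<Rightarrow> 'b" where
  "sphere_mean \<equiv> integral\<^sup>L sphere_measure"

lemma integrable_sphere_measure:
  fixes f :: "real^3 \<Rightarrow> 'b::{banach, second_countable_topology}"
  assumes "continuous_on UNIV f"
  shows "integrable sphere_measure f"
proof -
  interpret finite_measure sphere_measure by (rule finite_measure_sphere_measure)
  have "compact (f ` sphere 0 1)"
    by (intro compact_continuous_image continuous_on_subset[OF assms]) auto
  then obtain B where B: "\<And>\<omega>. \<omega> \<in> sphere 0 1 \<Longrightarrow> norm (f \<omega>) \<le> B"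
    by (meson bounded_iff compact_imp_bounded image_eqI)
  show ?thesis
  proof (rule integrable_const_bound)
    show "AE \<omega> in sphere_measure. norm (f \<omega>) \<le> B"
      using AE_sphere_measure by eventually_elim (rule B)
    show "f \<in> borel_measurable sphere_measure"
      using borel_measurable_continuous_onI[OF assms] by simp
  qed
qed

lemma sphere_mean_cong:
  fixes f g :: "real^3 \<Rightarrow> 'b::{banach, second_countable_topology}"
  assumes "continuous_on UNIV f" "continuous_on UNIV g"
    and "\<And>\<omega>. norm \<omega> = 1 \<Longrightarrow> f \<omega> = g \<omega>"
  shows "sphere_mean f = sphere_mean g"
proof (rule integral_cong_AE)
  show "f \<in> borel_measurable sphere_measure" "g \<in> borel_measurable sphere_measure"
    using borel_measurable_continuous_onI[OF assms(1)] borel_measurable_continuous_onI[OF assms(2)] by simp_all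
  show "AE \<omega> in sphere_measure. f \<omega> = g \<omega>"
    using AE_sphere_measure by eventually_elim (simp add: assms(3))
qed

lemma sphere_mean_mono:
  fixes f g :: "real^3 \<Rightarrow> real"
  assumes "continuous_on UNIV f" "continuous_on UNIV g"
    and "\<And>\<omega>. norm \<omega> = 1 \<Longrightarrow> f \<omega> \<le> g \<omega>"
  shows "sphere_mean f \<le> sphere_mean g"
proof (rule integral_mono_AE)
  show "integrable sphere_measure f" "integrable sphere_measure g"
    by (simp_all add: integrable_sphere_measure assms)
  show "AE \<omega> in sphere_measure. f \<omega> \<le> g \<omega>"
    using AE_sphere_measure by eventually_elim (simp add: assms(3))
qed

lemma measure_sphere_measure_UNIV [simp]: "measure sphere_measure UNIV = 1"
  by (simp add: measure_def emeasure_sphere_measure_UNIV)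

text \<open>Orthogonal maps preserve volume and the unit ball and commute with the radial
  projection, so invariance passes from the uniform distribution on the ball to its image.\<close>

lemma distr_sphere_measure_orthogonal:
  assumes T: "orthogonal_transformation T"
  shows "distr sphere_measure borel T = sphere_measure"
proof -
  have lin: "linear T" by (rule orthogonal_transformation_linear[OF T])
  have [measurable]: "T \<in> borel_measurable borel"
    by (intro borel_measurable_continuous_onI linear_continuous_on linear_conv_bounded_linear[THEN iffD1] lin)
  have bij: "bij T" by (rule orthogonal_transformation_bij[OF T])
  let ?U = "uniform_measure lborel (ball (0::real^3) 1)"
  have inv: "distr ?U borel T = ?U"
  proof (rule measure_eqI)
    show "sets (distr ?U borel T) = sets ?U" by simp
    fix A assume "A \<in> sets (distr ?U borel T)"
    then have A[measurable]: "A \<in> sets borel" by simp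
    have meas: "ball 0 1 \<inter> T -` A \<in> sets borel"
      using measurable_sets[of T borel borel A] by auto
    have lm: "S \<in> lmeasurable" if "S \<in> sets borel" "S \<subseteq> ball 0 1" for S :: "(real^3) set"
      by (rule bounded_set_imp_lmeasurable) (use that bounded_subset[OF bounded_ball] in auto)
    have im: "T ` (ball 0 1 \<inter> T -` A) = ball 0 1 \<inter> A"
      using bij orthogonal_transformation_norm[OF T] unfolding bij_def surj_def by (force simp: image_iff)
    have "measure lebesgue (ball 0 1 \<inter> A) = measure lebesgue (ball 0 1 \<inter> T -` A)"
      unfolding im[symmetric] by (rule measure_orthogonal_image[OF T lm[OF meas]]) auto
    then have "emeasure lebesgue (ball 0 1 \<inter> A) = emeasure lebesgue (ball 0 1 \<inter> T -` A)"
      using lm[OF meas] lm[of "ball 0 1 \<inter> A"]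
      by (simp add: emeasure_eq_measure2 fmeasurableD2)
    then have "emeasure lborel (ball 0 1 \<inter> A) = emeasure lborel (ball 0 1 \<inter> T -` A)"
      using meas by simp
    moreover have "T -` A \<in> sets borel"
      using measurable_sets[of T borel borel A] by auto
    ultimately show "emeasure (distr ?U borel T) A = emeasure ?U A"
      by (simp add: emeasure_distr emeasure_uniform_measure)
  qed
  have "distr sphere_measure borel T = distr ?U borel (T \<circ> (\<lambda>x. x /\<^sub>R norm x))"
    unfolding sphere_measure_def by (rule distr_distr) auto
  also have "T \<circ> (\<lambda>x. x /\<^sub>R norm x) = (\<lambda>x. x /\<^sub>R norm x) \<circ> T"
    by (simp add: fun_eq_iff linear_cmul[OF lin] orthogonal_transformation_norm[OF T])
  also have "distr ?U borel ((\<lambda>x. x /\<^sub>R norm x) \<circ> T) = distr (distr ?U borel T) borel (\<lambda>x. x /\<^sub>R norm x)"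
    by (rule distr_distr[symmetric]) auto
  also have "\<dots> = sphere_measure"
    by (simp only: inv sphere_measure_def)
  finally show ?thesis .
qed

lemma sphere_mean_orthogonal:
  fixes f :: "real^3 \<Rightarrow> 'b::{banach, second_countable_topology}"
  assumes "orthogonal_transformation T" "continuous_on UNIV f"
  shows "sphere_mean (\<lambda>\<omega>. f (T \<omega>)) = sphere_mean f"
proof -
  have "T \<in> borel_measurable borel"
    using orthogonal_transformation_linear[OF assms(1)]
    by (intro borel_measurable_continuous_onI linear_continuous_on linear_conv_bounded_linear[THEN iffD1])
  then have "sphere_mean (\<lambda>\<omega>. f (T \<omega>)) = integral\<^sup>L (distr sphere_measure borel T) f"
    by (subst integral_distr) (auto intro: borel_measurable_continuous_onI assms)
  then show ?thesis
    by (simp add: distr_sphere_measure_orthogonal assms)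
qed

text \<open>Dominated convergence along arbitrary null sequences: by the mean value inequality
  \<open>B\<close> dominates all difference quotients. The derivative hypotheses concern unit
  vectors only, where the measure is concentrated.\<close>

lemma sphere_mean_has_derivative:
  fixes F F' :: "real \<Rightarrow> real^3 \<Rightarrow> real"
  assumes F: "\<And>t. continuous_on UNIV (F t)" and F': "\<And>t. continuous_on UNIV (F' t)"
    and der: "\<And>t \<omega>. norm \<omega> = 1 \<Longrightarrow> ((\<lambda>t. F t \<omega>) has_real_derivative F' t \<omega>) (at t)"
    and bd: "\<And>t \<omega>. norm \<omega> = 1 \<Longrightarrow> \<bar>F' t \<omega>\<bar> \<le> B"
  shows "((\<lambda>t. sphere_mean (F t)) has_real_derivative sphere_mean (F' t)) (at t)"
proof -
  interpret finite_measure sphere_measure by (rule finite_measure_sphere_measure)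
  have meas: "f \<in> borel_measurable sphere_measure" if "continuous_on UNIV f" for f :: "real^3 \<Rightarrow> real"
    using borel_measurable_continuous_onI[OF that] by simp
  have "(\<lambda>n. (sphere_mean (F (t + X n)) - sphere_mean (F t)) / X n) \<longlonglongrightarrow> sphere_mean (F' t)"
    if X: "\<And>n. X n \<noteq> 0" "X \<longlonglongrightarrow> 0" for X :: "nat \<Rightarrow> real"
  proof -
    have "(\<lambda>n. sphere_mean (\<lambda>\<omega>. (F (t + X n) \<omega> - F t \<omega>) / X n)) \<longlonglongrightarrow> sphere_mean (F' t)"
    proof (rule integral_dominated_convergence[where w = "\<lambda>_. B"])
      show "F' t \<in> borel_measurable sphere_measure" by (rule meas[OF F'])
      show "(\<lambda>\<omega>. (F (t + X n) \<omega> - F t \<omega>) / X n) \<in> borel_measurable sphere_measure" for n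
        using meas[OF F] by measurable
      show "integrable sphere_measure (\<lambda>_. B)" by simp
      show "AE \<omega> in sphere_measure. (\<lambda>n. (F (t + X n) \<omega> - F t \<omega>) / X n) \<longlonglongrightarrow> F' t \<omega>"
        using AE_sphere_measure
      proof eventually_elim
        case (elim \<omega>)
        then have "(\<lambda>h. (F (t + h) \<omega> - F t \<omega>) / h) \<midarrow>0\<rightarrow> F' t \<omega>"
          using der[of \<omega> t] by (simp add: DERIV_def)
        then show ?case
          using X unfolding tendsto_at_iff_sequentially by (auto simp: o_def)
      qed
      show "AE \<omega> in sphere_measure. norm ((F (t + X n) \<omega> - F t \<omega>) / X n) \<le> B" for n
        using AE_sphere_measure
      proof eventually_elim
        case (elim \<omega>)
        then have "norm (F (t + X n) \<omega> - F t \<omega>) \<le> B * norm (t + X n - t)"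
          by (intro field_differentiable_bound[of UNIV "\<lambda>t. F t \<omega>" "\<lambda>t. F' t \<omega>"])
             (auto simp: bd der)
        then show ?case using X(1)[of n] by (simp add: field_simps)
      qed
    qed
    then show ?thesis
      by (simp add: integrable_sphere_measure F)
  qed
  then show ?thesis
    unfolding DERIV_def tendsto_at_iff_sequentially by (auto simp: o_def)
qed

text \<open>Differentiate the mean of \<open>(\<omega> \<bullet> q) h (\<omega> \<bullet> p)\<close> along the rotations in the plane of \<open>p\<close> and \<open>q\<close>.\<close>

lemma sphere_mean_stein:
  fixes p q :: "real^3" and h h' :: "real \<Rightarrow> real"
  assumes p: "norm p = 1" and q: "norm q = 1" and pq: "p \<bullet> q = 0"
    and h: "\<And>u. (h has_real_derivative h' u) (at u)" and h': "continuous_on UNIV h'"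
  shows "sphere_mean (\<lambda>\<omega>. (\<omega> \<bullet> q)\<^sup>2 * h' (\<omega> \<bullet> p)) = sphere_mean (\<lambda>\<omega>. (\<omega> \<bullet> p) * h (\<omega> \<bullet> p))"
proof -
  have ch: "continuous_on UNIV h"
    using h by (meson DERIV_isCont continuous_at_imp_continuous_on)
  have comp [continuous_intros]: "continuous_on A (\<lambda>x. h (k x))" "continuous_on A (\<lambda>x. h' (k x))"
    if "continuous_on A k" for A :: "(real^3) set" and k
    using that continuous_on_compose2[OF ch, of A k] continuous_on_compose2[OF h', of A k] by auto
  have pp: "p \<bullet> p = 1" and qq: "q \<bullet> q = 1" and qp: "q \<bullet> p = 0"
    using p q pq by (simp_all add: norm_eq_1 inner_commute)
  define R where "R = (\<lambda>\<theta> \<omega>. \<omega> + ((cos \<theta> - 1) * (\<omega> \<bullet> p) - sin \<theta> * (\<omega> \<bullet> q)) *\<^sub>R p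
      + (sin \<theta> * (\<omega> \<bullet> p) + (cos \<theta> - 1) * (\<omega> \<bullet> q)) *\<^sub>R q)"
  have Rp: "R \<theta> \<omega> \<bullet> p = cos \<theta> * (\<omega> \<bullet> p) - sin \<theta> * (\<omega> \<bullet> q)"
    and Rq: "R \<theta> \<omega> \<bullet> q = sin \<theta> * (\<omega> \<bullet> p) + cos \<theta> * (\<omega> \<bullet> q)" for \<theta> \<omega>
    by (simp_all add: R_def inner_add_left pp qq pq qp algebra_simps)
  have orth: "orthogonal_transformation (R \<theta>)" for \<theta>
  proof -
    have "linear (R \<theta>)"
      by (rule linearI) (simp_all add: R_def inner_add_left algebra_simps)
    moreover have "norm (R \<theta> \<omega>) = norm \<omega>" for \<omega>
    proof -
      have "R \<theta> \<omega> \<bullet> R \<theta> \<omega> = R \<theta> \<omega> \<bullet> \<omega> + ((cos \<theta> - 1) * (\<omega> \<bullet> p) - sin \<theta> * (\<omega> \<bullet> q)) * (R \<theta> \<omega> \<bullet> p)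
          + (sin \<theta> * (\<omega> \<bullet> p) + (cos \<theta> - 1) * (\<omega> \<bullet> q)) * (R \<theta> \<omega> \<bullet> q)"
        by (subst (2) R_def) (simp add: inner_add_right)
      also have "R \<theta> \<omega> \<bullet> \<omega> = \<omega> \<bullet> \<omega> + ((cos \<theta> - 1) * (\<omega> \<bullet> p) - sin \<theta> * (\<omega> \<bullet> q)) * (\<omega> \<bullet> p)
          + (sin \<theta> * (\<omega> \<bullet> p) + (cos \<theta> - 1) * (\<omega> \<bullet> q)) * (\<omega> \<bullet> q)"
        unfolding R_def inner_add_left by (simp add: inner_commute[of p] inner_commute[of q])
      finally have "R \<theta> \<omega> \<bullet> R \<theta> \<omega> = \<omega> \<bullet> \<omega> + ((sin \<theta>)\<^sup>2 + (cos \<theta>)\<^sup>2 - 1) * ((\<omega> \<bullet> p)\<^sup>2 + (\<omega> \<bullet> q)\<^sup>2)"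
        unfolding Rp Rq by algebra
      then show ?thesis by (simp add: norm_eq_sqrt_inner)
    qed
    ultimately show ?thesis by (simp add: orthogonal_transformation)
  qed
  obtain M where M: "\<And>u. \<bar>u\<bar> \<le> 1 \<Longrightarrow> \<bar>h u\<bar> \<le> M"
  proof -
    have "compact (h ` {-1..1})"
      by (intro compact_continuous_image continuous_on_subset[OF ch]) auto
    then obtain M where "\<And>u. u \<in> {-1..1} \<Longrightarrow> norm (h u) \<le> M"
      by (meson bounded_iff compact_imp_bounded image_eqI)
    then show ?thesis by (intro that[of M]) (simp add: abs_le_iff)
  qed
  obtain M' where M': "\<And>u. \<bar>u\<bar> \<le> 1 \<Longrightarrow> \<bar>h' u\<bar> \<le> M'"
  proof -
    have "compact (h' ` {-1..1})"
      by (intro compact_continuous_image continuous_on_subset[OF h']) auto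
    then obtain M where "\<And>u. u \<in> {-1..1} \<Longrightarrow> norm (h' u) \<le> M"
      by (meson bounded_iff compact_imp_bounded image_eqI)
    then show ?thesis by (intro that[of M]) (simp add: abs_le_iff)
  qed
  define F where "F = (\<lambda>\<theta> \<omega>. (R \<theta> \<omega> \<bullet> q) * h (R \<theta> \<omega> \<bullet> p))"
  define F' where "F' = (\<lambda>\<theta> \<omega>. (R \<theta> \<omega> \<bullet> p) * h (R \<theta> \<omega> \<bullet> p) - (R \<theta> \<omega> \<bullet> q)\<^sup>2 * h' (R \<theta> \<omega> \<bullet> p))"
  have "((\<lambda>\<theta>. sphere_mean (F \<theta>)) has_real_derivative sphere_mean (F' 0)) (at 0)"
  proof (rule sphere_mean_has_derivative)
    show "continuous_on UNIV (F \<theta>)" "continuous_on UNIV (F' \<theta>)" for \<theta>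
      unfolding F_def F'_def Rp Rq by (intro continuous_intros)+
    show "((\<lambda>\<theta>. F \<theta> \<omega>) has_real_derivative F' \<theta> \<omega>) (at \<theta>)" for \<theta> \<omega>
      unfolding F_def F'_def Rp Rq
      by (auto intro!: derivative_eq_intros DERIV_chain2[OF h] simp: algebra_simps power2_eq_square)
    fix \<theta> :: real and \<omega> :: "real^3" assume "norm \<omega> = 1"
    then have n: "norm (R \<theta> \<omega>) = 1"
      using orth orthogonal_transformation_norm by metis
    have a: "\<bar>R \<theta> \<omega> \<bullet> p\<bar> \<le> 1" "\<bar>R \<theta> \<omega> \<bullet> q\<bar> \<le> 1"
      using Cauchy_Schwarz_ineq2[of "R \<theta> \<omega>" p] Cauchy_Schwarz_ineq2[of "R \<theta> \<omega>" q] by (simp_all add: n p q)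
    have "\<bar>F' \<theta> \<omega>\<bar> \<le> \<bar>R \<theta> \<omega> \<bullet> p\<bar> * \<bar>h (R \<theta> \<omega> \<bullet> p)\<bar> + (R \<theta> \<omega> \<bullet> q)\<^sup>2 * \<bar>h' (R \<theta> \<omega> \<bullet> p)\<bar>"
      unfolding F'_def by (rule order_trans[OF abs_triangle_ineq4]) (simp add: abs_mult)
    also have "\<dots> \<le> 1 * M + 1 * M'"
      using a M[OF a(1)] M'[OF a(1)] abs_square_le_1 by (intro add_mono mult_mono) auto
    finally show "\<bar>F' \<theta> \<omega>\<bar> \<le> 1 * M + 1 * M'" .
  qed
  \<comment> \<open>Rotation invariance makes the mean constant in \<open>\<theta>\<close>. Hence
    the derivative at 0 vanishes, which is the claim once \<open>F' 0\<close> is written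
    out.\<close>
  moreover have "sphere_mean (F \<theta>) = sphere_mean (F 0)" for \<theta>
  proof -
    have c: "continuous_on UNIV (\<lambda>\<omega>. (\<omega> \<bullet> q) * h (\<omega> \<bullet> p))" by (intro continuous_intros)
    have "R 0 = (\<lambda>\<omega>. \<omega>)" by (simp add: R_def fun_eq_iff)
    then show ?thesis
      using sphere_mean_orthogonal[OF orth c, of \<theta>] by (simp add: F_def)
  qed
  then have "(\<lambda>\<theta>. sphere_mean (F \<theta>)) = (\<lambda>_. sphere_mean (F 0))"
    by (rule ext)
  ultimately have "((\<lambda>\<theta>::real. sphere_mean (F 0)) has_real_derivative sphere_mean (F' 0)) (at 0)"
    by (simp only:)
  from DERIV_unique[OF DERIV_const this] have "sphere_mean (F' 0) = 0" by simp
  moreover have "F' 0 = (\<lambda>\<omega>. (\<omega> \<bullet> p) * h (\<omega> \<bullet> p) - (\<omega> \<bullet> q)\<^sup>2 * h' (\<omega> \<bullet> p))"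
    by (simp add: F'_def R_def)
  moreover have "integrable sphere_measure (\<lambda>\<omega>. (\<omega> \<bullet> p) * h (\<omega> \<bullet> p))"
      "integrable sphere_measure (\<lambda>\<omega>. (\<omega> \<bullet> q)\<^sup>2 * h' (\<omega> \<bullet> p))"
    by (intro integrable_sphere_measure continuous_intros)+
  ultimately show ?thesis by simp
qed

section \<open>The sinc kernel and its derivatives\<close>

text \<open>The real supremum \<open>c_nu\<close> bounds its family only because that family is
  bounded, here by 2. The value at \<open>pi\<close> is 1, which later lets
  \<open>c_nu / norm w\<close> absorb the plain decay \<open>1 / norm w\<close> of
  \<open>kern0\<close>.\<close>

lemma c_nu_upper: "t > 0 \<Longrightarrow> \<bar>t * cos t - sin t\<bar> / t \<le> c_nu"
  and one_le_c_nu: "1 \<le> c_nu"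
proof -
  have bd: "bdd_above ((\<lambda>t::real. \<bar>t * cos t - sin t\<bar> / t) ` {0<..})"
  proof (rule bdd_aboveI2[where M = 2])
    fix t :: real assume t: "t \<in> {0<..}"
    have "\<bar>t * cos t - sin t\<bar> \<le> \<bar>t * cos t\<bar> + \<bar>sin t\<bar>" by simp
    also have "\<dots> \<le> t * 1 + t"
      using t abs_sin_x_le_abs_x[of t] by (intro add_mono) (auto simp: abs_mult)
    finally show "\<bar>t * cos t - sin t\<bar> / t \<le> 2" using t by (simp add: field_simps)
  qed
  show *: "\<bar>t * cos t - sin t\<bar> / t \<le> c_nu" if "t > 0" for t
    unfolding c_nu_def by (rule cSUP_upper[OF _ bd]) (use that in simp)
  show "1 \<le> c_nu" using *[of pi] by simp
qed

text \<open>Coordinates adapted to \<open>p\<close>: the images of the standard axes under an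
  orthogonal map that takes the first axis to \<open>p\<close>.\<close>

lemma orthonormal_frame_exists:
  fixes p :: "real^3"
  assumes "norm p = 1"
  obtains q r where "norm q = 1" "norm r = 1" "p \<bullet> q = 0" "p \<bullet> r = 0"
    "\<And>\<omega>. (norm \<omega>)\<^sup>2 = (\<omega> \<bullet> p)\<^sup>2 + (\<omega> \<bullet> q)\<^sup>2 + (\<omega> \<bullet> r)\<^sup>2"
proof -
  obtain T :: "real^3 \<Rightarrow> real^3" where T: "orthogonal_transformation T" and Tp: "T (axis 1 1) = p"
    by (rule orthogonal_transformation_exists_1[of "axis 1 1 :: real^3" p]) (use assms in auto)
  have inn: "T x \<bullet> T y = x \<bullet> y" for x y
    using T by (simp add: orthogonal_transformation_def)
  show thesis
  proof (rule that[of "T (axis 2 1)" "T (axis 3 1)"])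
    fix \<omega> :: "real^3"
    obtain x where x: "\<omega> = T x"
      using orthogonal_transformation_surj[OF T] by (metis surjD)
    show "(norm \<omega>)\<^sup>2 = (\<omega> \<bullet> p)\<^sup>2 + (\<omega> \<bullet> T (axis 2 1))\<^sup>2 + (\<omega> \<bullet> T (axis 3 1))\<^sup>2"
      unfolding x Tp[symmetric] inn power2_norm_eq_inner inner_axis
      by (simp add: inner_vec_def sum_3 power2_eq_square)
  qed (simp_all add: Tp[symmetric] inn orthogonal_transformation_norm[OF T] inner_axis_axis)
qed

text \<open>The reflection in the plane orthogonal to \<open>q\<close> changes the sign of the
  integrand.\<close>

lemma sphere_mean_odd:
  fixes p q :: "real^3" and h :: "real \<Rightarrow> real"
  assumes q: "norm q = 1" and pq: "p \<bullet> q = 0" and h: "continuous_on UNIV h"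
  shows "sphere_mean (\<lambda>\<omega>. (\<omega> \<bullet> q) * h (\<omega> \<bullet> p)) = 0"
proof -
  have qq: "q \<bullet> q = 1" and qp: "q \<bullet> p = 0"
    using q pq by (simp_all add: norm_eq_1 inner_commute)
  define T where "T = (\<lambda>x. x - (2 * (x \<bullet> q)) *\<^sub>R q)"
  have "linear T" by (rule linearI) (simp_all add: T_def inner_add_left algebra_simps)
  moreover have "norm (T x) = norm x" for x
    by (simp add: norm_eq_sqrt_inner T_def inner_diff_left inner_diff_right qq inner_commute)
  ultimately have T: "orthogonal_transformation T" by (simp add: orthogonal_transformation)
  have c: "continuous_on UNIV (\<lambda>\<omega>. (\<omega> \<bullet> q) * h (\<omega> \<bullet> p))"
    by (intro continuous_intros continuous_on_compose2[OF h]) auto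
  have Tq: "T \<omega> \<bullet> q = - (\<omega> \<bullet> q)" and Tp: "T \<omega> \<bullet> p = \<omega> \<bullet> p" for \<omega>
    by (simp_all add: T_def inner_diff_left qq qp)
  from sphere_mean_orthogonal[OF T c] show ?thesis
    by (simp add: Tq Tp)
qed

text \<open>By \<open>sphere_mean_stein\<close> with the identity as \<open>h\<close>, three
  orthogonal directions have the same second moment, and on the sphere the three add up to
  1.\<close>

lemma sphere_mean_power2:
  fixes p :: "real^3"
  assumes p: "norm p = 1"
  shows "sphere_mean (\<lambda>\<omega>. (\<omega> \<bullet> p)\<^sup>2) = 1 / 3"
proof -
  obtain q r where fr: "norm q = 1" "norm r = 1" "p \<bullet> q = 0" "p \<bullet> r = 0"
    "\<And>\<omega>. (norm \<omega>)\<^sup>2 = (\<omega> \<bullet> p)\<^sup>2 + (\<omega> \<bullet> q)\<^sup>2 + (\<omega> \<bullet> r)\<^sup>2"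
    by (rule orthonormal_frame_exists[OF p]) blast
  have *: "sphere_mean (\<lambda>\<omega>. (\<omega> \<bullet> x)\<^sup>2) = sphere_mean (\<lambda>\<omega>. (\<omega> \<bullet> p)\<^sup>2)" if "norm x = 1" "p \<bullet> x = 0" for x
    using sphere_mean_stein[OF p that(1) that(2), of "\<lambda>u. u" "\<lambda>_. 1"]
    by (simp add: power2_eq_square)
  have [simp]: "integrable sphere_measure (\<lambda>\<omega>. (\<omega> \<bullet> x)\<^sup>2)" for x
    by (intro integrable_sphere_measure continuous_intros)
  have "sphere_mean (\<lambda>\<omega>. (\<omega> \<bullet> p)\<^sup>2 + (\<omega> \<bullet> q)\<^sup>2 + (\<omega> \<bullet> r)\<^sup>2) = sphere_mean (\<lambda>_. 1)"
    by (rule sphere_mean_cong) (auto intro!: continuous_intros simp: fr(5)[symmetric])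
  then show ?thesis by (simp add: *[of q] *[of r] fr)
qed

text \<open>\<open>sphere_mean_stein\<close> with the cube as \<open>h\<close> makes each mixed
  moment one third of the fourth moment. Multiplying the equation of the sphere by the square of the
  \<open>p\<close>-coordinate then gives (1 + 1/3 + 1/3) times the fourth moment = 1/3.\<close>

lemma sphere_mean_power4:
  fixes p :: "real^3"
  assumes p: "norm p = 1"
  shows "sphere_mean (\<lambda>\<omega>. (\<omega> \<bullet> p) ^ 4) = 1 / 5"
proof -
  obtain q r where fr: "norm q = 1" "norm r = 1" "p \<bullet> q = 0" "p \<bullet> r = 0"
    "\<And>\<omega>. (norm \<omega>)\<^sup>2 = (\<omega> \<bullet> p)\<^sup>2 + (\<omega> \<bullet> q)\<^sup>2 + (\<omega> \<bullet> r)\<^sup>2"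
    by (rule orthonormal_frame_exists[OF p]) blast
  have *: "3 * sphere_mean (\<lambda>\<omega>. (\<omega> \<bullet> x)\<^sup>2 * (\<omega> \<bullet> p)\<^sup>2) = sphere_mean (\<lambda>\<omega>. (\<omega> \<bullet> p) ^ 4)"
    if "norm x = 1" "p \<bullet> x = 0" for x
  proof -
    have "sphere_mean (\<lambda>\<omega>. (\<omega> \<bullet> x)\<^sup>2 * (3 * (\<omega> \<bullet> p)\<^sup>2)) = sphere_mean (\<lambda>\<omega>. (\<omega> \<bullet> p) * (\<omega> \<bullet> p) ^ 3)"
      by (rule sphere_mean_stein[OF p that])
         (auto intro!: continuous_intros derivative_eq_intros)
    also have "(\<lambda>\<omega>. (\<omega> \<bullet> x)\<^sup>2 * (3 * (\<omega> \<bullet> p)\<^sup>2)) = (\<lambda>\<omega>. 3 * ((\<omega> \<bullet> x)\<^sup>2 * (\<omega> \<bullet> p)\<^sup>2))"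
      by (simp add: fun_eq_iff)
    also have "(\<lambda>\<omega>. (\<omega> \<bullet> p) * (\<omega> \<bullet> p) ^ 3) = (\<lambda>\<omega>. (\<omega> \<bullet> p) ^ 4)"
      by (simp add: fun_eq_iff power3_eq_cube power4_eq_xxxx)
    finally show ?thesis by simp
  qed
  have [simp]: "integrable sphere_measure (\<lambda>\<omega>. (\<omega> \<bullet> x)\<^sup>2 * (\<omega> \<bullet> p)\<^sup>2)"
    "integrable sphere_measure (\<lambda>\<omega>. (\<omega> \<bullet> p) ^ 4)" for x
    by (intro integrable_sphere_measure continuous_intros)+
  have "sphere_mean (\<lambda>\<omega>. (\<omega> \<bullet> p) ^ 4 + (\<omega> \<bullet> q)\<^sup>2 * (\<omega> \<bullet> p)\<^sup>2 + (\<omega> \<bullet> r)\<^sup>2 * (\<omega> \<bullet> p)\<^sup>2) = sphere_mean (\<lambda>\<omega>. (\<omega> \<bullet> p)\<^sup>2)"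
  proof (rule sphere_mean_cong)
    fix \<omega> :: "real^3" assume "norm \<omega> = 1"
    then have "(\<omega> \<bullet> p)\<^sup>2 * 1 = (\<omega> \<bullet> p)\<^sup>2 * ((\<omega> \<bullet> p)\<^sup>2 + (\<omega> \<bullet> q)\<^sup>2 + (\<omega> \<bullet> r)\<^sup>2)"
      by (simp add: fr(5)[symmetric])
    then show "(\<omega> \<bullet> p) ^ 4 + (\<omega> \<bullet> q)\<^sup>2 * (\<omega> \<bullet> p)\<^sup>2 + (\<omega> \<bullet> r)\<^sup>2 * (\<omega> \<bullet> p)\<^sup>2 = (\<omega> \<bullet> p)\<^sup>2"
      by (simp add: algebra_simps power2_eq_square power4_eq_xxxx)
  qed (intro continuous_intros)+
  then show ?thesis using *[of q] *[of r] by (simp add: sphere_mean_power2[OF p] fr)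
qed

lemma cos_lower_bound: "1 - x\<^sup>2 / 2 \<le> cos (x::real)"
proof -
  have "(sin (x / 2))\<^sup>2 \<le> (x / 2)\<^sup>2"
    using abs_sin_x_le_abs_x[of "x / 2"] by (simp only: abs_le_square_iff)
  then show ?thesis
    using cos_double_sin[of "x / 2"] by (simp add: power_divide)
qed

text \<open>\<open>kern0\<close> is the Fourier transform of the sphere measure, that is, the sinc
  function of \<open>norm w\<close>, and its values are the Gram entries of plane waves.
  \<open>kern1 v\<close> and \<open>kern2 v\<close> are minus its first and second derivatives in
  direction \<open>v\<close>.\<close>

definition kern0 :: "real^3 \<Rightarrow> real" where
  "kern0 w = sphere_mean (\<lambda>\<omega>. cos (\<omega> \<bullet> w))"

definition kern1 :: "real^3 \<Rightarrow> real^3 \<Rightarrow> real" where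
  "kern1 v w = sphere_mean (\<lambda>\<omega>. (\<omega> \<bullet> v) * sin (\<omega> \<bullet> w))"

definition kern2 :: "real^3 \<Rightarrow> real^3 \<Rightarrow> real" where
  "kern2 v w = sphere_mean (\<lambda>\<omega>. (\<omega> \<bullet> v)\<^sup>2 * cos (\<omega> \<bullet> w))"

text \<open>The transversal second derivatives reduce to \<open>kern1\<close> by
  \<open>sphere_mean_stein\<close> with \<open>h\<close> the sine of \<open>t * u\<close>. Since the
  three values of \<open>kern2\<close> along a frame add up to \<open>kern0\<close>, the function
  \<open>t * f t\<close> satisfies the equation of the harmonic oscillator with the initial data of
  the sine.\<close>

lemma kern_radial:
  fixes p q :: "real^3" and t :: real
  assumes p: "norm p = 1"
  shows "t * kern0 (t *\<^sub>R p) = sin t"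
    and "t\<^sup>2 * kern1 p (t *\<^sub>R p) = sin t - t * cos t"
    and "t * kern2 p (t *\<^sub>R p) = t * kern0 (t *\<^sub>R p) - 2 * kern1 p (t *\<^sub>R p)"
    and "norm q = 1 \<Longrightarrow> p \<bullet> q = 0 \<Longrightarrow> t * kern2 q (t *\<^sub>R p) = kern1 p (t *\<^sub>R p)"
proof -
  define f where "f = (\<lambda>t. kern0 (t *\<^sub>R p))"
  define f1 where "f1 = (\<lambda>t. kern1 p (t *\<^sub>R p))"
  define f2 where "f2 = (\<lambda>t. kern2 p (t *\<^sub>R p))"
  have le1: "\<bar>\<omega> \<bullet> p\<bar> \<le> 1" if "norm \<omega> = 1" for \<omega>
    using Cauchy_Schwarz_ineq2[of \<omega> p] that p by simp
  have "(f has_real_derivative sphere_mean (\<lambda>\<omega>. - ((\<omega> \<bullet> p) * sin (t * (\<omega> \<bullet> p))))) (at t)" for t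
    unfolding f_def kern0_def inner_scaleR_right
  proof (rule sphere_mean_has_derivative[where B = 1])
    show "\<bar>- ((\<omega> \<bullet> p) * sin (t * (\<omega> \<bullet> p)))\<bar> \<le> 1" if "norm \<omega> = 1" for t \<omega>
      using le1[OF that] by (auto simp: abs_mult intro: mult_le_one)
  qed (auto intro!: continuous_intros derivative_eq_intros)
  then have df: "(f has_real_derivative - f1 t) (at t)" for t
    by (simp add: f1_def kern1_def)
  have df1: "(f1 has_real_derivative f2 t) (at t)" for t
    unfolding f1_def f2_def kern1_def kern2_def inner_scaleR_right
  proof (rule sphere_mean_has_derivative[where B = 1])
    show "\<bar>(\<omega> \<bullet> p)\<^sup>2 * cos (t * (\<omega> \<bullet> p))\<bar> \<le> 1" if "norm \<omega> = 1" for t \<omega>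
      using le1[OF that] by (simp add: abs_mult abs_square_le_1 mult_le_one)
  qed (auto intro!: continuous_intros derivative_eq_intros simp: power2_eq_square)
  show kq: "t * kern2 q (t *\<^sub>R p) = kern1 p (t *\<^sub>R p)" if "norm q = 1" "p \<bullet> q = 0" for q t
  proof -
    have "sphere_mean (\<lambda>\<omega>. (\<omega> \<bullet> q)\<^sup>2 * (t * cos (t * (\<omega> \<bullet> p)))) = sphere_mean (\<lambda>\<omega>. (\<omega> \<bullet> p) * sin (t * (\<omega> \<bullet> p)))"
      by (rule sphere_mean_stein[OF p that]) (auto intro!: continuous_intros derivative_eq_intros)
    then show ?thesis by (simp add: kern1_def kern2_def mult.left_commute[of _ t])
  qed
  obtain q r where fr: "norm q = 1" "norm r = 1" "p \<bullet> q = 0" "p \<bullet> r = 0"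
    "\<And>\<omega>. (norm \<omega>)\<^sup>2 = (\<omega> \<bullet> p)\<^sup>2 + (\<omega> \<bullet> q)\<^sup>2 + (\<omega> \<bullet> r)\<^sup>2"
    by (rule orthonormal_frame_exists[OF p]) blast
  have sum: "f t = f2 t + kern2 q (t *\<^sub>R p) + kern2 r (t *\<^sub>R p)" for t
  proof -
    have [simp]: "integrable sphere_measure (\<lambda>\<omega>. (\<omega> \<bullet> x)\<^sup>2 * cos (t * (\<omega> \<bullet> p)))" for x
      by (intro integrable_sphere_measure continuous_intros)
    have "sphere_mean (\<lambda>\<omega>. cos (t * (\<omega> \<bullet> p))) = sphere_mean (\<lambda>\<omega>. (\<omega> \<bullet> p)\<^sup>2 * cos (t * (\<omega> \<bullet> p))
        + (\<omega> \<bullet> q)\<^sup>2 * cos (t * (\<omega> \<bullet> p)) + (\<omega> \<bullet> r)\<^sup>2 * cos (t * (\<omega> \<bullet> p)))"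
      by (rule sphere_mean_cong)
         (auto intro!: continuous_intros simp: distrib_right[symmetric] fr(5)[symmetric])
    then show ?thesis by (simp add: f_def f2_def kern0_def kern2_def)
  qed
  have ode: "t * f2 t = t * f t - 2 * f1 t" for t
    using kq[OF fr(1,3), of t] kq[OF fr(2,4), of t] unfolding sum f1_def by (simp add: algebra_simps)
  then show "t * kern2 p (t *\<^sub>R p) = t * kern0 (t *\<^sub>R p) - 2 * kern1 p (t *\<^sub>R p)"
    by (simp add: f_def f1_def f2_def)
  \<comment> \<open>The oscillator energy of the difference between \<open>t * f t\<close> and
    \<open>sin t\<close>. It is conserved and vanishes at 0, so both squares vanish; this replaces a
    uniqueness theorem for the equation.\<close>
  define W where "W = (\<lambda>t. (t * f t - sin t)\<^sup>2 + (f t - t * f1 t - cos t)\<^sup>2)"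
  have "(W has_real_derivative 0) (at t)" for t
  proof -
    have "(W has_real_derivative 2 * (t * f t - sin t) * (f t - t * f1 t - cos t)
        + 2 * (f t - t * f1 t - cos t) * (sin t - 2 * f1 t - t * f2 t)) (at t)"
      unfolding W_def by (auto intro!: derivative_eq_intros df df1 simp: algebra_simps)
    also have "2 * (t * f t - sin t) * (f t - t * f1 t - cos t)
        + 2 * (f t - t * f1 t - cos t) * (sin t - 2 * f1 t - t * f2 t) = 0"
      unfolding ode by algebra
    finally show ?thesis .
  qed
  then have "W t = W 0" for t by (intro DERIV_isconst_all) auto
  moreover have "f 0 = 1" by (simp add: f_def kern0_def)
  ultimately have "W t = 0" for t by (simp add: W_def)
  then have a: "t * f t - sin t = 0" and b: "f t - t * f1 t - cos t = 0" for t
    by (simp_all add: W_def sum_power2_eq_zero_iff)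
  show "t * kern0 (t *\<^sub>R p) = sin t" using a[of t] by (simp add: f_def)
  have "t * f t - t\<^sup>2 * f1 t - t * cos t = 0"
    using b[of t] by (simp add: power2_eq_square) (simp add: algebra_simps)
  then show "t\<^sup>2 * kern1 p (t *\<^sub>R p) = sin t - t * cos t"
    using a[of t] by (simp add: f1_def)
qed

lemma kern0_eq_sinc: "w \<noteq> 0 \<Longrightarrow> kern0 w = sin (norm w) / norm w"
  using kern_radial(1)[of "w /\<^sub>R norm w" "norm w"] by (simp add: field_simps)

lemma unit_direction_exists:
  fixes w :: "real^3"
  obtains p where "norm p = 1" "w = norm w *\<^sub>R p"
proof (cases "w = 0")
  case True
  then show thesis using that[of "axis 1 1"] by simp
next
  case False
  then show thesis using that[of "w /\<^sub>R norm w"] by simp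
qed

text \<open>Split \<open>v\<close> into its part along \<open>p\<close> and a part along a unit
  vector \<open>q\<close> orthogonal to \<open>p\<close> (any such \<open>q\<close> if
  \<open>v\<close> is parallel to \<open>p\<close>). All terms that are odd in the
  \<open>q\<close>-coordinate have mean zero.\<close>

lemma kern_components:
  fixes p v :: "real^3"
  assumes p: "norm p = 1" and v: "norm v = 1"
  obtains q a b where "norm q = 1" "p \<bullet> q = 0" "a\<^sup>2 + b\<^sup>2 = 1"
    "\<And>t. kern1 v (t *\<^sub>R p) = a * kern1 p (t *\<^sub>R p)"
    "\<And>t. kern2 v (t *\<^sub>R p) = a\<^sup>2 * kern2 p (t *\<^sub>R p) + b\<^sup>2 * kern2 q (t *\<^sub>R p)"
proof -
  have pp: "p \<bullet> p = 1" and vv: "v \<bullet> v = 1" using p v by (simp_all add: norm_eq_1)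
  obtain q where q: "norm q = 1" "p \<bullet> q = 0" and vq: "v = (v \<bullet> p) *\<^sub>R p + (v \<bullet> q) *\<^sub>R q"
  proof (cases "v - (v \<bullet> p) *\<^sub>R p = 0")
    case True
    obtain q r where "norm q = 1" "p \<bullet> q = 0" by (rule orthonormal_frame_exists[OF p]) blast
    moreover have "v = (v \<bullet> p) *\<^sub>R p" using True by simp
    moreover from this have "v \<bullet> q = 0" using \<open>p \<bullet> q = 0\<close> by (metis inner_scaleR_left mult_zero_right)
    ultimately show thesis using that[of q] by simp
  next
    case False
    define r where "r = v - (v \<bullet> p) *\<^sub>R p"
    have rn: "norm r \<noteq> 0" using False by (simp add: r_def)
    have rp: "p \<bullet> r = 0" by (simp add: r_def inner_diff_right pp inner_commute)
    have vr: "v \<bullet> r = (norm r)\<^sup>2"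
    proof -
      have "r \<bullet> r = v \<bullet> r - (v \<bullet> p) * (p \<bullet> r)" by (subst r_def) (simp add: inner_diff_left)
      then show ?thesis by (simp add: rp power2_norm_eq_inner)
    qed
    show thesis
    proof (rule that[of "r /\<^sub>R norm r"])
      show "v = (v \<bullet> p) *\<^sub>R p + (v \<bullet> (r /\<^sub>R norm r)) *\<^sub>R (r /\<^sub>R norm r)"
        using rn by (simp add: vr power2_eq_square field_simps) (simp add: r_def)
    qed (use rn in \<open>simp_all add: rp\<close>)
  qed
  define a b where "a = v \<bullet> p" and "b = v \<bullet> q"
  have vab: "v = a *\<^sub>R p + b *\<^sub>R q" using vq by (simp add: a_def b_def)
  have "v \<bullet> v = a\<^sup>2 + b\<^sup>2"
    by (subst (2) vab) (simp add: inner_add_right a_def b_def power2_eq_square)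
  then have ab: "a\<^sup>2 + b\<^sup>2 = 1" using vv by simp
  have [simp]: "\<omega> \<bullet> v = a * (\<omega> \<bullet> p) + b * (\<omega> \<bullet> q)" for \<omega>
    by (simp add: vab inner_add_right)
  have [simp]: "integrable sphere_measure (\<lambda>\<omega>. (\<omega> \<bullet> x) * sin (t * (\<omega> \<bullet> p)))"
    "integrable sphere_measure (\<lambda>\<omega>. (\<omega> \<bullet> x)\<^sup>2 * cos (t * (\<omega> \<bullet> p)))"
    "integrable sphere_measure (\<lambda>\<omega>. (\<omega> \<bullet> q) * ((\<omega> \<bullet> p) * cos (t * (\<omega> \<bullet> p))))" for x t
    by (intro integrable_sphere_measure continuous_intros)+
  have o1: "sphere_mean (\<lambda>\<omega>. (\<omega> \<bullet> q) * sin (t * (\<omega> \<bullet> p))) = 0" for t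
    by (rule sphere_mean_odd[OF q]) (intro continuous_intros)
  have o2: "sphere_mean (\<lambda>\<omega>. (\<omega> \<bullet> q) * ((\<omega> \<bullet> p) * cos (t * (\<omega> \<bullet> p)))) = 0" for t
    by (rule sphere_mean_odd[OF q]) (intro continuous_intros)
  have k1: "kern1 v (t *\<^sub>R p) = a * kern1 p (t *\<^sub>R p)" for t
  proof -
    have "kern1 v (t *\<^sub>R p) = sphere_mean (\<lambda>\<omega>. a * ((\<omega> \<bullet> p) * sin (t * (\<omega> \<bullet> p))) + b * ((\<omega> \<bullet> q) * sin (t * (\<omega> \<bullet> p))))"
      by (simp only: kern1_def) (simp add: algebra_simps)
    then show ?thesis by (simp add: o1 kern1_def)
  qed
  have k2: "kern2 v (t *\<^sub>R p) = a\<^sup>2 * kern2 p (t *\<^sub>R p) + b\<^sup>2 * kern2 q (t *\<^sub>R p)" for t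
  proof -
    have "kern2 v (t *\<^sub>R p) = sphere_mean (\<lambda>\<omega>. a\<^sup>2 * ((\<omega> \<bullet> p)\<^sup>2 * cos (t * (\<omega> \<bullet> p)))
        + b\<^sup>2 * ((\<omega> \<bullet> q)\<^sup>2 * cos (t * (\<omega> \<bullet> p))) + 2 * a * b * ((\<omega> \<bullet> q) * ((\<omega> \<bullet> p) * cos (t * (\<omega> \<bullet> p)))))"
      by (simp only: kern2_def) (simp add: algebra_simps power2_eq_square)
    then show ?thesis by (simp add: o2 kern2_def)
  qed
  show thesis by (rule that[OF q ab k1 k2])
qed

lemma abs_kern0_le_1: "\<bar>kern0 w\<bar> \<le> 1"
proof -
  have "kern0 w \<le> sphere_mean (\<lambda>_. 1)" "sphere_mean (\<lambda>_. - 1) \<le> kern0 w"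
    unfolding kern0_def by (rule sphere_mean_mono; auto intro!: continuous_intros)+
  then show ?thesis by simp
qed

lemma abs_kern0_le: "\<bar>kern0 w\<bar> \<le> 1 / norm w" if "w \<noteq> 0"
  using that by (simp add: kern0_eq_sinc divide_right_mono)

text \<open>The quadratic lower bound for the cosine, averaged with second moment 1/3.\<close>

lemma kern0_ge: "kern0 w \<ge> 1 - (norm w)\<^sup>2 / 6"
proof -
  obtain p where p: "norm p = 1" and w: "w = norm w *\<^sub>R p" by (rule unit_direction_exists)
  have [simp]: "integrable sphere_measure (\<lambda>\<omega>. (\<omega> \<bullet> p)\<^sup>2)"
    "integrable sphere_measure (\<lambda>\<omega>. 1::real)"
    by (intro integrable_sphere_measure continuous_intros)+
  have "sphere_mean (\<lambda>\<omega>. 1 - (norm w)\<^sup>2 / 2 * (\<omega> \<bullet> p)\<^sup>2) \<le> kern0 (norm w *\<^sub>R p)"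
    unfolding kern0_def
  proof (rule sphere_mean_mono)
    fix \<omega> :: "real^3"
    show "1 - (norm w)\<^sup>2 / 2 * (\<omega> \<bullet> p)\<^sup>2 \<le> cos (\<omega> \<bullet> norm w *\<^sub>R p)"
      using cos_lower_bound[of "norm w * (\<omega> \<bullet> p)"] by (simp add: power_mult_distrib)
  qed (intro continuous_intros)+
  then show ?thesis using w by (simp add: sphere_mean_power2[OF p])
qed

lemma abs_kern1_le:
  assumes v: "norm v = 1"
  shows "\<bar>kern1 v w\<bar> \<le> norm w / 3"
proof -
  obtain p where p: "norm p = 1" and w: "w = norm w *\<^sub>R p" by (rule unit_direction_exists)
  have [simp]: "integrable sphere_measure (\<lambda>\<omega>. (\<omega> \<bullet> x)\<^sup>2)" for x
    by (intro integrable_sphere_measure continuous_intros)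
  have le: "\<bar>(\<omega> \<bullet> v) * sin (\<omega> \<bullet> w)\<bar> \<le> norm w / 2 * ((\<omega> \<bullet> v)\<^sup>2 + (\<omega> \<bullet> p)\<^sup>2)" for \<omega>
  proof -
    have "\<bar>(\<omega> \<bullet> v) * sin (\<omega> \<bullet> w)\<bar> \<le> \<bar>\<omega> \<bullet> v\<bar> * \<bar>\<omega> \<bullet> w\<bar>"
      unfolding abs_mult by (intro mult_left_mono abs_sin_x_le_abs_x) auto
    also have "\<bar>\<omega> \<bullet> w\<bar> = norm w * \<bar>\<omega> \<bullet> p\<bar>" by (subst w) (simp add: abs_mult)
    also have "\<bar>\<omega> \<bullet> v\<bar> * (norm w * \<bar>\<omega> \<bullet> p\<bar>) = norm w / 2 * (2 * \<bar>\<omega> \<bullet> v\<bar> * \<bar>\<omega> \<bullet> p\<bar>)" by simp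
    also have "\<dots> \<le> norm w / 2 * ((\<omega> \<bullet> v)\<^sup>2 + (\<omega> \<bullet> p)\<^sup>2)"
      using sum_squares_bound[of "\<bar>\<omega> \<bullet> v\<bar>" "\<bar>\<omega> \<bullet> p\<bar>"] by (intro mult_left_mono) auto
    finally show ?thesis .
  qed
  have "sphere_mean (\<lambda>\<omega>. norm w / 2 * ((\<omega> \<bullet> v)\<^sup>2 + (\<omega> \<bullet> p)\<^sup>2)) = norm w / 3"
    by (simp add: sphere_mean_power2 p v)
  moreover have "kern1 v w \<le> sphere_mean (\<lambda>\<omega>. norm w / 2 * ((\<omega> \<bullet> v)\<^sup>2 + (\<omega> \<bullet> p)\<^sup>2))"
    unfolding kern1_def
    by (rule sphere_mean_mono) (intro continuous_intros, intro continuous_intros, rule order_trans[OF abs_ge_self le])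
  moreover have "sphere_mean (\<lambda>\<omega>. - ((\<omega> \<bullet> v) * sin (\<omega> \<bullet> w))) \<le> sphere_mean (\<lambda>\<omega>. norm w / 2 * ((\<omega> \<bullet> v)\<^sup>2 + (\<omega> \<bullet> p)\<^sup>2))"
    by (rule sphere_mean_mono) (intro continuous_intros, intro continuous_intros, rule order_trans[OF abs_ge_minus_self le])
  ultimately show ?thesis
    by (simp only: kern1_def abs_le_iff Bochner_Integration.integral_minus)
qed

text \<open>Only the component of \<open>v\<close> along \<open>w\<close> contributes, and there
  \<open>t * kern1\<close> is exactly the quotient, up to sign, whose supremum is
  \<open>c_nu\<close>.\<close>

lemma abs_kern1_le_c_nu:
  assumes v: "norm v = 1" and w: "w \<noteq> 0"
  shows "\<bar>kern1 v w\<bar> \<le> c_nu / norm w"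
proof -
  define t where "t = norm w"
  have t: "t > 0" using w by (simp add: t_def)
  obtain p where p: "norm p = 1" and wp: "w = t *\<^sub>R p" unfolding t_def by (rule unit_direction_exists)
  obtain q a b where ab: "a\<^sup>2 + b\<^sup>2 = 1" "kern1 v w = a * kern1 p (t *\<^sub>R p)"
    unfolding wp by (rule kern_components[OF p v]) blast
  have "a\<^sup>2 \<le> 1" using ab(1) zero_le_power2[of b] by linarith
  then have "\<bar>a\<bar> \<le> 1" by (simp add: abs_square_le_1)
  then have "\<bar>kern1 v w\<bar> \<le> \<bar>kern1 p (t *\<^sub>R p)\<bar>"
    unfolding ab(2) abs_mult by (simp add: mult_left_le_one_le)
  also have "kern1 p (t *\<^sub>R p) = (sin t - t * cos t) / t\<^sup>2"
    using kern_radial(2)[OF p, of t] t by (simp add: field_simps)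
  also have "\<bar>\<dots>\<bar> = \<bar>t * cos t - sin t\<bar> / t / t"
    using t by (simp add: abs_minus_commute power2_eq_square)
  also have "\<dots> \<le> c_nu / t" using c_nu_upper[OF t] t by (intro divide_right_mono) auto
  finally show ?thesis by (simp add: t_def)
qed

lemma abs_kern2_le:
  assumes v: "norm v = 1"
  shows "\<bar>kern2 v w\<bar> \<le> 1 / 3"
proof -
  have le: "\<bar>(\<omega> \<bullet> v)\<^sup>2 * cos (\<omega> \<bullet> w)\<bar> \<le> (\<omega> \<bullet> v)\<^sup>2" for \<omega>
    by (simp add: abs_mult mult_left_le)
  have "kern2 v w \<le> sphere_mean (\<lambda>\<omega>. (\<omega> \<bullet> v)\<^sup>2)"
    unfolding kern2_def
    by (rule sphere_mean_mono) (intro continuous_intros, intro continuous_intros, rule order_trans[OF abs_ge_self le])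
  moreover have "sphere_mean (\<lambda>\<omega>. - ((\<omega> \<bullet> v)\<^sup>2 * cos (\<omega> \<bullet> w))) \<le> sphere_mean (\<lambda>\<omega>. (\<omega> \<bullet> v)\<^sup>2)"
    by (rule sphere_mean_mono) (intro continuous_intros, intro continuous_intros, rule order_trans[OF abs_ge_minus_self le])
  ultimately show ?thesis by (simp add: kern2_def sphere_mean_power2 v)
qed

text \<open>After the quadratic bound for the cosine, the mixed fourth moment is at most the mean of
  the two pure ones, 1/5, so half of \<open>(norm w)^2\<close> times 1/5 is lost.\<close>

lemma kern2_ge:
  assumes v: "norm v = 1"
  shows "kern2 v w \<ge> 1 / 3 - (norm w)\<^sup>2 / 10"
proof -
  obtain p where p: "norm p = 1" and w: "w = norm w *\<^sub>R p" by (rule unit_direction_exists)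
  have [simp]: "integrable sphere_measure (\<lambda>\<omega>. (\<omega> \<bullet> x)\<^sup>2)"
    "integrable sphere_measure (\<lambda>\<omega>. (\<omega> \<bullet> x) ^ 4)" for x
    by (intro integrable_sphere_measure continuous_intros)+
  have "sphere_mean (\<lambda>\<omega>. (\<omega> \<bullet> v)\<^sup>2 - (norm w)\<^sup>2 / 4 * ((\<omega> \<bullet> v) ^ 4 + (\<omega> \<bullet> p) ^ 4)) \<le> kern2 v w"
    unfolding kern2_def
  proof (rule sphere_mean_mono)
    fix \<omega> :: "real^3"
    have "2 * (\<omega> \<bullet> v)\<^sup>2 * (\<omega> \<bullet> p)\<^sup>2 \<le> (\<omega> \<bullet> v) ^ 4 + (\<omega> \<bullet> p) ^ 4"
      using sum_squares_bound[of "(\<omega> \<bullet> v)\<^sup>2" "(\<omega> \<bullet> p)\<^sup>2"] by simp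
    then have "(norm w)\<^sup>2 / 4 * (2 * (\<omega> \<bullet> v)\<^sup>2 * (\<omega> \<bullet> p)\<^sup>2) \<le> (norm w)\<^sup>2 / 4 * ((\<omega> \<bullet> v) ^ 4 + (\<omega> \<bullet> p) ^ 4)"
      by (intro mult_left_mono) auto
    then have "(\<omega> \<bullet> v)\<^sup>2 - (norm w)\<^sup>2 / 4 * ((\<omega> \<bullet> v) ^ 4 + (\<omega> \<bullet> p) ^ 4) \<le> (\<omega> \<bullet> v)\<^sup>2 * (1 - (norm w * (\<omega> \<bullet> p))\<^sup>2 / 2)"
      by (simp add: power_mult_distrib algebra_simps)
    also have "\<dots> \<le> (\<omega> \<bullet> v)\<^sup>2 * cos (norm w * (\<omega> \<bullet> p))"
      by (intro mult_left_mono cos_lower_bound) auto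
    also have "norm w * (\<omega> \<bullet> p) = \<omega> \<bullet> w" by (metis w inner_scaleR_right)
    finally show "(\<omega> \<bullet> v)\<^sup>2 - (norm w)\<^sup>2 / 4 * ((\<omega> \<bullet> v) ^ 4 + (\<omega> \<bullet> p) ^ 4) \<le> (\<omega> \<bullet> v)\<^sup>2 * cos (\<omega> \<bullet> w)" .
  qed (intro continuous_intros)+
  then show ?thesis by (simp add: sphere_mean_power2 sphere_mean_power4 p v)
qed

text \<open>The factor 2 covers both terms of the radial formula
  \<open>kern0 - 2 * kern1 / t\<close>: each contributes at most \<open>c_nu / t\<close>. The
  transversal part \<open>kern1 / t\<close> is smaller, and \<open>kern2 v\<close> is a convex
  combination of the two.\<close>

lemma abs_kern2_le_c_nu:
  assumes v: "norm v = 1" and w: "w \<noteq> 0"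
  shows "\<bar>kern2 v w\<bar> \<le> 2 * c_nu / norm w"
proof -
  define t where "t = norm w"
  have t: "t > 0" using w by (simp add: t_def)
  show ?thesis
  \<comment> \<open>Up to 6 the trivial bound 1/3 is already at most \<open>2 / t\<close>. Beyond 6
    the decay of \<open>kern1\<close> makes it at most \<open>c_nu / 2\<close>.\<close>
  proof (cases "t \<le> 6")
    case True
    have "\<bar>kern2 v w\<bar> \<le> 2 * 1 / t"
      using mult_mono[OF True abs_kern2_le[OF v, of w]] t by (simp add: field_simps)
    also have "\<dots> \<le> 2 * c_nu / t"
      using one_le_c_nu t by (intro divide_right_mono) auto
    finally show ?thesis by (simp add: t_def)
  next
    case False
    obtain p where p: "norm p = 1" and wp: "w = t *\<^sub>R p" unfolding t_def by (rule unit_direction_exists)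
    obtain q a b where q: "norm q = 1" "p \<bullet> q = 0" and ab: "a\<^sup>2 + b\<^sup>2 = 1"
      "kern2 v w = a\<^sup>2 * kern2 p (t *\<^sub>R p) + b\<^sup>2 * kern2 q (t *\<^sub>R p)"
      unfolding wp by (rule kern_components[OF p v]) blast
    have tp: "t *\<^sub>R p \<noteq> 0" and nt: "norm (t *\<^sub>R p) = t" using t p by auto
    have k1: "\<bar>kern1 p (t *\<^sub>R p)\<bar> / t \<le> (c_nu / 2) / t"
    proof (rule divide_right_mono)
      have "\<bar>kern1 p (t *\<^sub>R p)\<bar> \<le> c_nu / t"
        using abs_kern1_le_c_nu[OF p tp] nt by simp
      also have "\<dots> \<le> c_nu / 2" using False one_le_c_nu by (intro divide_left_mono) auto
      finally show "\<bar>kern1 p (t *\<^sub>R p)\<bar> \<le> c_nu / 2" .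
    qed (use t in simp)
    have "kern2 q (t *\<^sub>R p) = kern1 p (t *\<^sub>R p) / t"
      using kern_radial(4)[OF p q, of t] t by (simp add: field_simps)
    then have A: "\<bar>kern2 q (t *\<^sub>R p)\<bar> \<le> 2 * c_nu / t"
      using k1 t one_le_c_nu by (simp add: field_simps)
    have "kern2 p (t *\<^sub>R p) = kern0 (t *\<^sub>R p) - 2 * (kern1 p (t *\<^sub>R p) / t)"
      using kern_radial(3)[OF p, of t] t by (simp add: field_simps)
    then have "\<bar>kern2 p (t *\<^sub>R p)\<bar> \<le> \<bar>kern0 (t *\<^sub>R p)\<bar> + 2 * (\<bar>kern1 p (t *\<^sub>R p)\<bar> / t)"
      using t abs_triangle_ineq4[of "kern0 (t *\<^sub>R p)" "2 * (kern1 p (t *\<^sub>R p) / t)"] by (simp add: abs_mult)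
    also have "\<dots> \<le> 1 / t + 2 * (c_nu / 2 / t)"
      using abs_kern0_le[OF tp] nt k1 by (intro add_mono mult_left_mono) auto
    also have "\<dots> \<le> 2 * c_nu / t" using one_le_c_nu t by (simp add: field_simps)
    finally have B: "\<bar>kern2 p (t *\<^sub>R p)\<bar> \<le> 2 * c_nu / t" .
    have "\<bar>kern2 v w\<bar> \<le> a\<^sup>2 * \<bar>kern2 p (t *\<^sub>R p)\<bar> + b\<^sup>2 * \<bar>kern2 q (t *\<^sub>R p)\<bar>"
      unfolding ab(2) by (rule order_trans[OF abs_triangle_ineq]) (simp add: abs_mult)
    also have "\<dots> \<le> a\<^sup>2 * (2 * c_nu / t) + b\<^sup>2 * (2 * c_nu / t)"
      by (intro add_mono mult_left_mono A B) auto
    also have "\<dots> = 2 * c_nu / t" by (simp only: distrib_right[symmetric] ab(1) mult_1_left)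
    finally show ?thesis by (simp add: t_def)
  qed
qed

section \<open>Packing sums\<close>

text \<open>Compare volumes: the balls of radius \<open>\<delta> / 2\<close> about the points are
  disjoint and lie in the ball of radius \<open>r + \<delta> / 2\<close> about
  \<open>z\<close>.\<close>

lemma card_separated_le:
  fixes Y :: "(real^3) set"
  assumes fin: "finite Y" and sep: "\<And>x y. x \<in> Y \<Longrightarrow> y \<in> Y \<Longrightarrow> x \<noteq> y \<Longrightarrow> \<delta> \<le> dist x y"
    and \<delta>: "\<delta> > 0" and r: "r \<ge> 0" and sub: "Y \<subseteq> cball z r"
  shows "real (card Y) * (\<delta> / 2) ^ 3 \<le> (r + \<delta> / 2) ^ 3"
proof -
  let ?V = "unit_ball_vol 3"
  have disj: "disjoint_family_on (\<lambda>y. ball y (\<delta> / 2)) Y"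
    unfolding disjoint_family_on_def
  proof (intro ballI impI)
    fix x y assume "x \<in> Y" "y \<in> Y" "x \<noteq> y"
    then have "\<delta> \<le> dist x y" by (rule sep)
    show "ball x (\<delta> / 2) \<inter> ball y (\<delta> / 2) = {}"
    proof (rule ccontr)
      assume "ball x (\<delta> / 2) \<inter> ball y (\<delta> / 2) \<noteq> {}"
      then obtain u where "dist x u < \<delta> / 2" "dist y u < \<delta> / 2" by auto
      with dist_triangle2[of x y u] \<open>\<delta> \<le> dist x y\<close> show False by linarith
    qed
  qed
  have "real (card Y) * (?V * (\<delta> / 2) ^ 3) = (\<Sum>y\<in>Y. measure lborel (ball y (\<delta> / 2)))"
    using \<delta> by (simp add: content_ball)
  also have "\<dots> = measure lborel (\<Union>y\<in>Y. ball y (\<delta> / 2))"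
    by (rule measure_finite_Union[symmetric])
       (use fin disj emeasure_lborel_ball_finite in \<open>auto simp: less_top\<close>)
  also have "\<dots> \<le> measure lborel (cball z (r + \<delta> / 2))"
  proof (rule measure_mono_fmeasurable)
    show "(\<Union>y\<in>Y. ball y (\<delta> / 2)) \<subseteq> cball z (r + \<delta> / 2)"
    proof
      fix u assume "u \<in> (\<Union>y\<in>Y. ball y (\<delta> / 2))"
      then obtain y where "y \<in> Y" "dist y u < \<delta> / 2" by auto
      then show "u \<in> cball z (r + \<delta> / 2)"
        using sub dist_triangle[of z u y] by (force simp: subset_iff)
    qed
    show "(\<Union>y\<in>Y. ball y (\<delta> / 2)) \<in> sets lborel" by (auto intro!: borel_open open_UN)
    show "cball z (r + \<delta> / 2) \<in> fmeasurable lborel"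
      using emeasure_lborel_cball_finite[of z "r + \<delta> / 2"] by (intro fmeasurableI) (auto simp: less_top)
  qed
  also have "\<dots> = ?V * (r + \<delta> / 2) ^ 3"
    using \<delta> r by (simp add: content_cball)
  finally have "?V * (real (card Y) * (\<delta> / 2) ^ 3) \<le> ?V * (r + \<delta> / 2) ^ 3"
    by (simp add: mult.left_commute)
  then show ?thesis by (simp add: mult_le_cancel_left_pos)
qed

text \<open>
  Listing the points by increasing distance, the \<open>k\<close>-th distance is at least \<open>c\<close> times the cube
  root of \<open>k\<close>; the sums are then compared with those of \<open>k\<close> to the powers \<open>-1/3\<close> and \<open>-2/3\<close>.
\<close>

lemma sums_le_of_counting:
  fixes d :: "'a \<Rightarrow> real"
  assumes fin: "finite Y" and c: "c > 0" and pos: "\<And>y. y \<in> Y \<Longrightarrow> d y > 0"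
    and count: "\<And>S y. S \<subseteq> Y \<Longrightarrow> y \<in> S \<Longrightarrow> (\<And>x. x \<in> S \<Longrightarrow> d x \<le> d y) \<Longrightarrow> real (card S) \<le> (d y / c) ^ 3"
  shows "(\<Sum>y\<in>Y. 1 / d y) \<le> 3 / (2 * c) * (root 3 (card Y))\<^sup>2"
    and "(\<Sum>y\<in>Y. 1 / (d y)\<^sup>2) \<le> 3 / c\<^sup>2 * root 3 (card Y)"
proof -
  have "S \<subseteq> Y \<longrightarrow> (\<Sum>y\<in>S. 1 / d y) \<le> 3 / (2 * c) * (root 3 (card S))\<^sup>2
      \<and> (\<Sum>y\<in>S. 1 / (d y)\<^sup>2) \<le> 3 / c\<^sup>2 * root 3 (card S)" if "finite S" for S
    using that
  proof (induction S rule: finite_ranking_induct[where f = d])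
    case (insert x S)
    show ?case
    proof (cases "x \<in> S")
      case True
      then show ?thesis using insert by (simp add: insert_absorb)
    next
      case False
      show ?thesis
      proof
        assume sub: "insert x S \<subseteq> Y"
        then have IH1: "(\<Sum>y\<in>S. 1 / d y) \<le> 3 / (2 * c) * (root 3 (card S))\<^sup>2"
          and IH2: "(\<Sum>y\<in>S. 1 / (d y)\<^sup>2) \<le> 3 / c\<^sup>2 * root 3 (card S)"
          using insert.IH by auto
        \<comment> \<open>The ranking induction adds points in order of increasing \<open>d\<close>,
          so \<open>x\<close> is the farthest one and counting gives \<open>d x \<ge> c * a\<close>.
          As \<open>a ^ 3 - b ^ 3 = 1\<close>, the new term is dominated by the increment of the
          claimed bound, because \<open>(a - b)^2 * (a + 2 * b)\<close> and
          \<open>(a - b)^2 * (2 * a + b)\<close> are nonnegative; the bounds telescope.\<close>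
        define a b where "a = root 3 (real (card S) + 1)" and "b = root 3 (real (card S))"
        have b0: "0 \<le> b" and ba: "b \<le> a" and a0: "0 < a" by (simp_all add: a_def b_def)
        have cub: "a ^ 3 - b ^ 3 = 1" by (simp add: a_def b_def)
        have card: "real (card (insert x S)) = real (card S) + 1"
          using insert.hyps(1) False by simp
        have "real (card (insert x S)) \<le> (d x / c) ^ 3"
          using insert.hyps(2) by (intro count[OF sub]) auto
        then have "a \<le> root 3 ((d x / c) ^ 3)" unfolding a_def card by simp
        also have "\<dots> = d x / c" using pos[of x] sub c by (simp add: real_root_power_cancel)
        finally have dx: "c * a \<le> d x" using c by (simp add: field_simps)
        have ca: "c * a > 0" using c a0 by simp
        have "1 / d x \<le> 1 / (c * a)" by (rule divide_left_mono) (use dx ca in auto)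
        also have "\<dots> \<le> 3 / (2 * c) * (a\<^sup>2 - b\<^sup>2)"
        proof -
          have "0 \<le> (a - b)\<^sup>2 * (a + 2 * b)" using a0 b0 by simp
          also have "\<dots> = 3 * (a * (a\<^sup>2 - b\<^sup>2)) - 2 * (a ^ 3 - b ^ 3)" by algebra
          finally have "2 \<le> 3 * (a * (a\<^sup>2 - b\<^sup>2))" unfolding cub by simp
          then show ?thesis using c a0 by (simp add: field_simps)
        qed
        finally have s1: "1 / d x \<le> 3 / (2 * c) * (a\<^sup>2 - b\<^sup>2)" .
        have "(c * a)\<^sup>2 \<le> (d x)\<^sup>2" using dx ca by (intro power_mono) auto
        then have "1 / (d x)\<^sup>2 \<le> 1 / (c * a)\<^sup>2" by (intro divide_left_mono) (use ca c a0 pos[of x] sub in auto)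
        also have "\<dots> \<le> 3 / c\<^sup>2 * (a - b)"
        proof -
          have "0 \<le> (a - b)\<^sup>2 * (2 * a + b)" using a0 b0 by simp
          also have "\<dots> = 3 * (a\<^sup>2 * (a - b)) - (a ^ 3 - b ^ 3)" by algebra
          finally have "1 \<le> 3 * (a\<^sup>2 * (a - b))" unfolding cub by simp
          then show ?thesis using c a0 by (simp add: field_simps)
        qed
        finally have s2: "1 / (d x)\<^sup>2 \<le> 3 / c\<^sup>2 * (a - b)" .
        show "(\<Sum>y\<in>insert x S. 1 / d y) \<le> 3 / (2 * c) * (root 3 (card (insert x S)))\<^sup>2
            \<and> (\<Sum>y\<in>insert x S. 1 / (d y)\<^sup>2) \<le> 3 / c\<^sup>2 * root 3 (card (insert x S))"
          using IH1 IH2 s1[unfolded right_diff_distrib] s2[unfolded right_diff_distrib]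
          unfolding card a_def[symmetric] b_def[symmetric] sum.insert[OF insert.hyps(1) False]
          by linarith
      qed
    qed
  qed simp
  from this[OF fin] show "(\<Sum>y\<in>Y. 1 / d y) \<le> 3 / (2 * c) * (root 3 (card Y))\<^sup>2"
    and "(\<Sum>y\<in>Y. 1 / (d y)\<^sup>2) \<le> 3 / c\<^sup>2 * root 3 (card Y)" by auto
qed

text \<open>At distance \<open>d\<close>, packing allows at most
  \<open>(2 * d / \<delta> + 1) ^ 3\<close> points. For \<open>d \<ge> \<delta>\<close> the base is
  at most \<open>3 * d / \<delta>\<close>, for \<open>d \<ge> \<delta> / 2\<close> at most
  \<open>4 * d / \<delta>\<close>. Thus \<open>c\<close> is \<open>\<delta> / 3\<close> or
  \<open>\<delta> / 4\<close>, and the constants are 9/2, the factor in \<open>mu\<close>, and 3 *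
  16 = 48.\<close>

lemma separated_inverse_dist_sums:
  fixes Y :: "(real^3) set"
  assumes fin: "finite Y" and sep: "\<And>x y. x \<in> Y \<Longrightarrow> y \<in> Y \<Longrightarrow> x \<noteq> y \<Longrightarrow> \<delta> \<le> dist x y"
    and \<delta>: "\<delta> > 0"
  shows "(\<And>y. y \<in> Y \<Longrightarrow> \<delta> \<le> dist z y) \<Longrightarrow> (\<Sum>y\<in>Y. 1 / dist z y) \<le> 9 / (2 * \<delta>) * (root 3 (card Y))\<^sup>2"
    and "(\<And>y. y \<in> Y \<Longrightarrow> \<delta> / 2 \<le> dist z y) \<Longrightarrow> (\<Sum>y\<in>Y. 1 / (dist z y)\<^sup>2) \<le> 48 / \<delta>\<^sup>2 * root 3 (card Y)"
proof -
  have count: "real (card S) \<le> (dist z y / c) ^ 3"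
    if S: "S \<subseteq> Y" "y \<in> S" "\<And>x. x \<in> S \<Longrightarrow> dist z x \<le> dist z y"
      and c: "c > 0" "2 * dist z y / \<delta> + 1 \<le> dist z y / c" for S y c
  proof -
    have "real (card S) * (\<delta> / 2) ^ 3 \<le> (dist z y + \<delta> / 2) ^ 3"
      by (rule card_separated_le[where z = z]) (use S fin sep \<delta> finite_subset in \<open>auto simp: subset_iff\<close>)
    then have "real (card S) \<le> (dist z y + \<delta> / 2) ^ 3 / (\<delta> / 2) ^ 3"
      using \<delta> by (simp add: field_simps)
    also have "\<dots> = (2 * dist z y / \<delta> + 1) ^ 3"
    proof -
      have "(dist z y + \<delta> / 2) / (\<delta> / 2) = 2 * dist z y / \<delta> + 1"
        using \<delta> by (simp add: field_simps)
      then show ?thesis by (simp only: power_divide[symmetric])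
    qed
    also have "\<dots> \<le> (dist z y / c) ^ 3" using c \<delta> by (intro power_mono) auto
    finally show ?thesis .
  qed
  show "(\<Sum>y\<in>Y. 1 / dist z y) \<le> 9 / (2 * \<delta>) * (root 3 (card Y))\<^sup>2"
    if far: "\<And>y. y \<in> Y \<Longrightarrow> \<delta> \<le> dist z y"
  proof -
    have "(\<Sum>y\<in>Y. 1 / dist z y) \<le> 3 / (2 * (\<delta> / 3)) * (root 3 (card Y))\<^sup>2"
    proof (rule sums_le_of_counting(1)[OF fin])
      fix S y assume S: "S \<subseteq> Y" "y \<in> S" "\<And>x. x \<in> S \<Longrightarrow> dist z x \<le> dist z y"
      show "real (card S) \<le> (dist z y / (\<delta> / 3)) ^ 3"
        by (rule count) (use S far[of y] \<delta> in \<open>auto simp: field_simps\<close>)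
    qed (use \<delta> far in force)+
    then show ?thesis by simp
  qed
  show "(\<Sum>y\<in>Y. 1 / (dist z y)\<^sup>2) \<le> 48 / \<delta>\<^sup>2 * root 3 (card Y)"
    if far: "\<And>y. y \<in> Y \<Longrightarrow> \<delta> / 2 \<le> dist z y"
  proof -
    have "(\<Sum>y\<in>Y. 1 / (dist z y)\<^sup>2) \<le> 3 / (\<delta> / 4)\<^sup>2 * root 3 (card Y)"
    proof (rule sums_le_of_counting(2)[OF fin])
      fix S y assume S: "S \<subseteq> Y" "y \<in> S" "\<And>x. x \<in> S \<Longrightarrow> dist z x \<le> dist z y"
      show "real (card S) \<le> (dist z y / (\<delta> / 4)) ^ 3"
        by (rule count) (use S far[of y] \<delta> in \<open>auto simp: field_simps\<close>)
    qed (use \<delta> far in force)+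
    then show ?thesis by (simp add: power_divide)
  qed
qed

section \<open>Minimal separation and the packing parameter\<close>

lemma min_sep_le_dist:
  assumes "finite X" "x \<in> X" "y \<in> X" "x \<noteq> y"
  shows "min_sep X \<le> dist x y"
  unfolding min_sep_def
proof (rule Min_le)
  have "{dist x y |x y. x \<in> X \<and> y \<in> X \<and> x \<noteq> y} \<subseteq> (\<lambda>(x, y). dist x y) ` (X \<times> X)" by auto
  then show "finite {dist x y |x y. x \<in> X \<and> y \<in> X \<and> x \<noteq> y}"
    by (rule finite_subset) (simp add: assms)
qed (use assms in auto)

lemma min_sep_pos:
  assumes "finite X" "card X \<ge> 2"
  shows "min_sep X > 0"
proof -
  have fin: "finite {dist x y |x y. x \<in> X \<and> y \<in> X \<and> x \<noteq> y}"
    by (rule finite_subset[of _ "(\<lambda>(x, y). dist x y) ` (X \<times> X)"]) (auto simp: assms)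
  obtain x y where "x \<in> X" "y \<in> X" "x \<noteq> y"
    using assms by (metis card_2_iff' card_le_Suc0_iff_eq not_less_eq_eq numeral_2_eq_2)
  then have "{dist x y |x y. x \<in> X \<and> y \<in> X \<and> x \<noteq> y} \<noteq> {}" by auto
  from Min_in[OF fin this] show ?thesis unfolding min_sep_def by auto
qed

lemma powr_two_thirds: "x \<ge> 0 \<Longrightarrow> x powr (2 / 3) = (root 3 x)\<^sup>2"
  by (cases "x = 0") (simp_all add: root_powr_inverse powr_powr[symmetric] powr_realpow[symmetric] powr_powr)

lemma sum_inverse_dist_le_mu:
  assumes X: "finite X" "card X \<ge> 2" and \<kappa>: "\<kappa> > 0" and x: "x \<in> X"
  shows "(\<Sum>y\<in>X - {x}. 1 / (\<kappa> * dist x y)) \<le> mu \<kappa> X"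
proof -
  have \<delta>: "min_sep X > 0" by (rule min_sep_pos[OF X])
  have "(\<Sum>y\<in>X - {x}. 1 / dist x y) \<le> 9 / (2 * min_sep X) * (root 3 (card (X - {x})))\<^sup>2"
    by (rule separated_inverse_dist_sums(1)) (use X x \<delta> min_sep_le_dist in auto)
  also have "\<dots> \<le> 9 / (2 * min_sep X) * (root 3 (card X))\<^sup>2"
    using \<delta> X by (intro mult_left_mono power_mono) (auto simp: card_mono)
  finally have "(\<Sum>y\<in>X - {x}. 1 / dist x y) / \<kappa> \<le> 9 / (2 * min_sep X) * (root 3 (card X))\<^sup>2 / \<kappa>"
    using \<kappa> by (intro divide_right_mono) auto
  then show ?thesis
    by (simp add: mu_def powr_two_thirds sum_divide_distrib field_simps)
qed

text \<open>The packing bound \<open>48 * s powr (1/3) / (\<kappa> * min_sep X)^2\<close> expressed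
  through \<open>mu\<close>: the square of \<open>mu\<close> carries \<open>s powr (4/3)\<close>,
  which leaves the divisor \<open>s\<close>, and 48 times the square of 2/9 is 64/27.\<close>

lemma sum_inverse_dist_sq_le_mu:
  assumes X: "finite X" "card X \<ge> 2" and \<kappa>: "\<kappa> > 0" and Y: "Y \<subseteq> X"
    and far: "\<And>y. y \<in> Y \<Longrightarrow> min_sep X / 2 \<le> dist z y"
  shows "(\<Sum>y\<in>Y. 1 / (\<kappa> * dist z y)\<^sup>2) \<le> 64 / 27 * ((mu \<kappa> X)\<^sup>2 / card X)"
proof -
  have \<delta>: "min_sep X > 0" by (rule min_sep_pos[OF X])
  define a where "a = root 3 (card X)"
  have a3: "a ^ 3 = card X" and a0: "a > 0" using X by (auto simp: a_def)
  have "(\<Sum>y\<in>Y. 1 / (dist z y)\<^sup>2) \<le> 48 / (min_sep X)\<^sup>2 * root 3 (card Y)"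
    by (rule separated_inverse_dist_sums(2))
       (use X Y \<delta> far min_sep_le_dist finite_subset in \<open>auto simp: subset_iff\<close>)
  also have "\<dots> \<le> 48 / (min_sep X)\<^sup>2 * a"
    unfolding a_def using \<delta> X Y by (intro mult_left_mono) (auto simp: card_mono)
  finally have "(\<Sum>y\<in>Y. 1 / (dist z y)\<^sup>2) / \<kappa>\<^sup>2 \<le> 48 / (min_sep X)\<^sup>2 * a / \<kappa>\<^sup>2"
    using \<kappa> by (intro divide_right_mono) auto
  also have "\<dots> = 64 / 27 * ((9 / 2 * (a\<^sup>2 / (\<kappa> * min_sep X)))\<^sup>2 / a ^ 3)"
    using a0 \<kappa> \<delta> by (simp add: field_simps power2_eq_square power3_eq_cube)
  also have "\<dots> = 64 / 27 * ((mu \<kappa> X)\<^sup>2 / card X)"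
    unfolding a3 by (simp add: mu_def powr_two_thirds a_def)
  finally show ?thesis
    by (simp add: sum_divide_distrib power_mult_distrib mult.commute)
qed

section \<open>Orthogonal projections\<close>

lemma cinner_commute: "cinner f g = cnj (cinner g f)"
  by transfer (subst Bochner_Integration.integral_cnj [symmetric], simp add: mult.commute)

lemma cinner_add_left: "cinner (f + g) h = cinner f h + cinner g h"
  by transfer
     (simp add: L2_rel_def distrib_right integrable_mult_cnj flip: Bochner_Integration.integral_add)

lemma cinner_scaleC_left: "cinner (scaleC c f) g = c * cinner f g"
  by transfer (simp add: mult.assoc)

lemma cinner_add_right: "cinner h (f + g) = cinner h f + cinner h g"
  by (subst (1 2 3) cinner_commute) (simp add: cinner_add_left)

lemma cinner_scaleC_right: "cinner g (scaleC c f) = cnj c * cinner g f"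
  by (subst (1 2) cinner_commute) (simp add: cinner_scaleC_left)

lemma scaleR_eq_scaleC: "r *\<^sub>R (f :: sphere_L2) = scaleC (of_real r) f"
  by (rule scaleR_sphere_L2_def)

lemma minus_eq_scaleC: "- (f :: sphere_L2) = scaleC (- 1) f"
  by (rule uminus_sphere_L2_def)

lemma cinner_zero_left [simp]: "cinner 0 f = 0"
  using cinner_add_left[of 0 0 f] by simp

lemma cinner_zero_right [simp]: "cinner f 0 = 0"
  using cinner_add_right[of f 0 0] by simp

lemma cinner_minus_left: "cinner (- f) g = - cinner f g"
  by (simp only: minus_eq_scaleC cinner_scaleC_left mult_minus_left mult_1_left)

lemma cinner_diff_left: "cinner (f - g) h = cinner f h - cinner g h"
  using cinner_add_left[of f "- g" h] by (simp add: cinner_minus_left)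

lemma cinner_sum_left: "cinner (sum f A) g = (\<Sum>a\<in>A. cinner (f a) g)"
  by (induction A rule: infinite_finite_induct) (simp_all add: cinner_add_left)

lemma cinner_sum_right: "cinner g (sum f A) = (\<Sum>a\<in>A. cinner g (f a))"
  by (induction A rule: infinite_finite_induct) (simp_all add: cinner_add_right)

lemma inner_eq_Re_cinner: "inner f g = Re (cinner f g)"
  by (rule inner_sphere_L2_def)

lemma cinner_self: "cinner f f = of_real ((norm f)\<^sup>2)"
proof -
  have "Im (cinner f f) = 0" using cinner_commute[of f f] by (simp add: complex_eq_iff)
  then show ?thesis
    by (simp add: complex_eq_iff power2_norm_eq_inner inner_eq_Re_cinner)
qed

lemma norm_scaleC: "norm (scaleC c f) = cmod c * norm f"
proof -
  have "complex_of_real ((norm (scaleC c f))\<^sup>2) = c * (cnj c * cinner f f)"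
    unfolding cinner_self[symmetric] by (simp only: cinner_scaleC_left cinner_scaleC_right mult.left_commute)
  also have "\<dots> = (c * cnj c) * cinner f f" by (simp only: mult.assoc)
  also have "\<dots> = of_real ((cmod c * norm f)\<^sup>2)"
    by (simp only: complex_norm_square[symmetric] cinner_self of_real_mult[symmetric] power_mult_distrib)
  finally have "(norm (scaleC c f))\<^sup>2 = (cmod c * norm f)\<^sup>2"
    by (simp only: of_real_eq_iff)
  then show ?thesis by (simp add: power2_eq_iff_nonneg)
qed

lemma subspace_scaleR:
  "cL2.subspace V \<Longrightarrow> f \<in> V \<Longrightarrow> r *\<^sub>R f \<in> V"
  by (simp add: scaleR_eq_scaleC cL2.subspace_scale)

lemma subspace_diff:
  assumes "cL2.subspace V" "f \<in> V" "g \<in> V"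
  shows "f - g \<in> V"
proof -
  have "f + scaleC (- 1) g \<in> V" using assms by (intro cL2.subspace_add cL2.subspace_scale)
  then show ?thesis by (simp add: minus_eq_scaleC[symmetric])
qed

text \<open>\<open>orth_proj\<close> is a definite description. Uniqueness holds in every subspace;
  existence is what has to be assumed and is verified below for finite spans.\<close>

locale projectable =
  fixes V :: "sphere_L2 set"
  assumes subspace: "cL2.subspace V"
    and proj_exists: "\<exists>p\<in>V. \<forall>v\<in>V. cinner (f - p) v = 0"
begin

lemma orth_proj_eqI:
  assumes "p \<in> V" "\<And>v. v \<in> V \<Longrightarrow> cinner (f - p) v = 0"
  shows "orth_proj V f = p"
  unfolding orth_proj_def
proof (rule the_equality)
  fix q assume q: "q \<in> V \<and> (\<forall>v\<in>V. cinner (f - q) v = 0)"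
  have "p - q \<in> V" using assms q subspace by (simp add: subspace_diff)
  then have "cinner (p - q) (p - q) = cinner (f - q) (p - q) - cinner (f - p) (p - q)"
    by (simp add: cinner_diff_left)
  also have "\<dots> = 0" using \<open>p - q \<in> V\<close> assms q by simp
  finally show "q = p" by (simp add: cinner_self)
qed (use assms in auto)

lemma proj_in: "orth_proj V f \<in> V"
  and proj_orth: "v \<in> V \<Longrightarrow> cinner (f - orth_proj V f) v = 0"
proof -
  obtain p where "p \<in> V" "\<forall>v\<in>V. cinner (f - p) v = 0" using proj_exists by blast
  then show "orth_proj V f \<in> V" "v \<in> V \<Longrightarrow> cinner (f - orth_proj V f) v = 0"
    using orth_proj_eqI[of p f] by auto
qed

lemma cinner_proj: "v \<in> V \<Longrightarrow> cinner (orth_proj V f) v = cinner f v"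
  using proj_orth[of v f] by (simp add: cinner_diff_left)

lemma inner_proj_orth: "v \<in> V \<Longrightarrow> inner (f - orth_proj V f) v = 0"
  by (simp add: inner_eq_Re_cinner proj_orth)

lemma inner_proj: "v \<in> V \<Longrightarrow> inner (orth_proj V f) v = inner f v"
  by (simp add: inner_eq_Re_cinner cinner_proj)

lemma proj_of_mem: "f \<in> V \<Longrightarrow> orth_proj V f = f"
  by (rule orth_proj_eqI) auto

lemma proj_add: "orth_proj V (f + g) = orth_proj V f + orth_proj V g"
  by (rule orth_proj_eqI)
     (auto intro: cL2.subspace_add subspace proj_in simp: cinner_add_left cinner_diff_left cinner_proj)

lemma proj_scaleR: "orth_proj V (r *\<^sub>R f) = r *\<^sub>R orth_proj V f"
  by (rule orth_proj_eqI)
     (auto intro: subspace_scaleR subspace proj_in simp: scaleR_eq_scaleC cinner_scaleC_left cinner_diff_left cinner_proj intro!: cL2.subspace_scale)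

lemma inner_proj_self_adjoint: "inner (orth_proj V f) g = inner f (orth_proj V g)"
proof -
  have "inner (orth_proj V f) g = inner (orth_proj V f) (orth_proj V g)"
    using inner_proj[OF proj_in, of g f] by (simp add: inner_commute)
  also have "\<dots> = inner f (orth_proj V g)" by (rule inner_proj[OF proj_in])
  finally show ?thesis .
qed

lemma norm_proj_pythagoras: "(norm f)\<^sup>2 = (norm (orth_proj V f))\<^sup>2 + (norm (f - orth_proj V f))\<^sup>2"
  using inner_proj_orth[OF proj_in, of f f]
  by (simp add: power2_norm_eq_inner inner_diff_left inner_diff_right inner_commute)

lemma norm_proj_le: "norm (orth_proj V f) \<le> norm f"
  using norm_proj_pythagoras[of f] zero_le_power2[of "norm (f - orth_proj V f)"]
  by (intro power2_le_imp_le[OF _ norm_ge_zero]) linarith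

lemma norm_proj_eq_inner: "(norm (orth_proj V f))\<^sup>2 = inner (orth_proj V f) f"
  using inner_proj[OF proj_in, of f f] by (simp add: power2_norm_eq_inner inner_commute)

lemma bounded_linear_proj: "bounded_linear (orth_proj V)"
  by (rule bounded_linear_intro[where K = 1]) (simp_all add: proj_add proj_scaleR norm_proj_le)

lemma norm_diff_proj_le:
  assumes "u \<in> V"
  shows "norm (f - orth_proj V f) \<le> norm (f - u)"
proof -
  have "orth_proj V f - u \<in> V" by (intro subspace_diff subspace proj_in assms)
  from inner_proj_orth[OF this, of f]
  have "(norm (f - u))\<^sup>2 = (norm (f - orth_proj V f))\<^sup>2 + (norm (orth_proj V f - u))\<^sup>2"
    by (simp add: power2_norm_eq_inner inner_diff_left inner_diff_right inner_commute)
  then show ?thesis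
    using zero_le_power2[of "norm (orth_proj V f - u)"]
    by (intro power2_le_imp_le[OF _ norm_ge_zero]) linarith
qed

end

lemma projectable_span:
  assumes "finite B"
  shows "projectable (cL2.span B)"
proof
  show "cL2.subspace (cL2.span B)" by (rule cL2.subspace_span)
  show "\<exists>p\<in>cL2.span B. \<forall>v\<in>cL2.span B. cinner (f - p) v = 0" for f
    using assms
  proof (induction B arbitrary: f)
    case empty
    then show ?case by simp
  next
    case (insert b B)
    obtain p where p: "p \<in> cL2.span B" "\<forall>v\<in>cL2.span B. cinner (f - p) v = 0"
      using insert.IH by blast
    obtain b' where b': "b' \<in> cL2.span B" "\<forall>v\<in>cL2.span B. cinner (b - b') v = 0"
      using insert.IH by blast
    define q where "q = b - b'"
    \<comment> \<open>One Gram-Schmidt step. If \<open>b\<close> already lies in the span, then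
      \<open>q = 0\<close>, the quotient is 0 by convention, and orthogonality to \<open>q\<close>
      is trivial.\<close>
    define c where "c = cinner (f - p) q / cinner q q"
    have "cL2.span B \<subseteq> cL2.span (insert b B)" by (intro cL2.span_mono) auto
    then have mono: "u \<in> cL2.span (insert b B)" if "u \<in> cL2.span B" for u using that by auto
    have qin: "q \<in> cL2.span (insert b B)"
      unfolding q_def by (intro subspace_diff cL2.subspace_span mono[OF b'(1)] cL2.span_base) auto
    show ?case
    proof
      show "p + scaleC c q \<in> cL2.span (insert b B)"
        by (intro cL2.span_add cL2.span_scale qin mono p)
      show "\<forall>v\<in>cL2.span (insert b B). cinner (f - (p + scaleC c q)) v = 0"
      proof
        fix v assume "v \<in> cL2.span (insert b B)"
        then obtain k where k: "v - scaleC k b \<in> cL2.span B" by (auto simp: cL2.span_insert)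
        define u where "u = v - scaleC k b + scaleC k b'"
        have u: "u \<in> cL2.span B" unfolding u_def by (intro cL2.span_add cL2.span_scale k b')
        have v: "v = u + scaleC k q"
          by (simp add: u_def q_def cL2.scale_right_diff_distrib)
        have "cinner (f - (p + scaleC c q)) u = 0"
          using p(2) b'(2) u by (simp add: cinner_diff_left cinner_add_left cinner_scaleC_left q_def)
        moreover have "cinner (f - (p + scaleC c q)) q = 0"
          by (simp add: cinner_diff_left cinner_add_left cinner_scaleC_left c_def) (simp add: cinner_self)
        ultimately show "cinner (f - (p + scaleC c q)) v = 0"
          unfolding v by (simp add: cinner_add_right cinner_scaleC_right)
      qed
    qed
  qed
qed

lemma projectable_Gr: "V \<in> Gr s \<Longrightarrow> projectable V"
  by (auto simp: Gr_def projectable_span)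

context
  fixes V W :: "sphere_L2 set"
  assumes V: "projectable V" and W: "projectable W"
begin

interpretation V: projectable V by (rule V)
interpretation W: projectable W by (rule W)

lemma norm_proj_diff_le: "norm (orth_proj V f - orth_proj W f) \<le> proj_dist V W * norm f"
  unfolding proj_dist_def
  by (rule onorm) (intro bounded_linear_sub V.bounded_linear_proj W.bounded_linear_proj)

text \<open>Write the difference of the projectors as \<open>P_V (I - P_W) - (I - P_V) P_W\<close>.
  The two values are orthogonal, and their arguments are the orthogonal parts of \<open>f\<close>
  along and off \<open>W\<close>, so the same factor \<open>e\<close> for both pieces is also a
  factor for the sum.\<close>

lemma proj_dist_leI:
  assumes e: "e \<ge> 0" and VW: "\<And>v. v \<in> V \<Longrightarrow> norm (v - orth_proj W v) \<le> e * norm v"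
    and WV: "\<And>w. w \<in> W \<Longrightarrow> norm (w - orth_proj V w) \<le> e * norm w"
  shows "proj_dist V W \<le> e"
  unfolding proj_dist_def
proof (rule onorm_bound[OF e])
  fix f
  define a where "a = orth_proj V (f - orth_proj W f)"
  define b where "b = orth_proj W f - orth_proj V (orth_proj W f)"
  have eq: "orth_proj V f - orth_proj W f = a - b"
  proof -
    have "orth_proj V f = orth_proj V ((f - orth_proj W f) + orth_proj W f)" by simp
    also have "\<dots> = a + orth_proj V (orth_proj W f)" unfolding V.proj_add a_def ..
    finally show ?thesis by (simp add: b_def)
  qed
  have orth: "inner b a = 0"
    unfolding b_def a_def by (rule V.inner_proj_orth[OF V.proj_in])
  have b: "norm b \<le> e * norm (orth_proj W f)"
    unfolding b_def by (rule WV[OF W.proj_in])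
  \<comment> \<open>Duality: pairing \<open>a\<close> with the part of \<open>f\<close> off
    \<open>W\<close> leaves only the part of \<open>a\<close> off \<open>W\<close>, to which the
    hypothesis on vectors of \<open>V\<close> applies. One factor \<open>norm a\<close> then
    cancels.\<close>
  have a: "norm a \<le> e * norm (f - orth_proj W f)"
  proof -
    have "(norm a)\<^sup>2 = inner a (f - orth_proj W f)"
      unfolding a_def by (rule V.norm_proj_eq_inner)
    also have "\<dots> = inner (a - orth_proj W a) (f - orth_proj W f)"
      using W.inner_proj_orth[OF W.proj_in, of f a] by (simp add: inner_diff_left inner_commute)
    also have "\<dots> \<le> norm (a - orth_proj W a) * norm (f - orth_proj W f)"
      by (rule norm_cauchy_schwarz)
    also have "\<dots> \<le> (e * norm a) * norm (f - orth_proj W f)"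
      by (intro mult_right_mono VW) (auto simp: a_def V.proj_in)
    finally have "norm a * norm a \<le> norm a * (e * norm (f - orth_proj W f))"
      by (simp only: power2_eq_square mult_ac)
    then show ?thesis
      by (cases "norm a = 0") (simp_all only: mult_le_cancel_left_pos zero_less_norm_iff norm_eq_zero e mult_nonneg_nonneg norm_ge_zero norm_zero simp_thms)
  qed
  have "(norm (a - b))\<^sup>2 = (norm a)\<^sup>2 + (norm b)\<^sup>2"
    using orth by (simp add: power2_norm_eq_inner inner_diff_left inner_diff_right inner_commute)
  also have "\<dots> \<le> (e * norm (f - orth_proj W f))\<^sup>2 + (e * norm (orth_proj W f))\<^sup>2"
    by (intro add_mono power_mono a b) auto
  also have "\<dots> = (e * norm f)\<^sup>2"
    unfolding power_mult_distrib W.norm_proj_pythagoras[of f] by (simp add: algebra_simps)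
  finally have "norm (a - b) \<le> e * norm f" by (rule power2_le_imp_le) (simp add: e)
  then show "norm (orth_proj V f - orth_proj W f) \<le> e * norm f" by (simp only: eq)
qed

end

section \<open>Nearly orthonormal families\<close>

text \<open>Unit vectors whose Gram matrix is strictly diagonally dominant; \<open>row_sum\<close>
  is the Gershgorin condition.\<close>

locale nearly_orthonormal =
  fixes X :: "'a set" and \<phi> :: "'a \<Rightarrow> sphere_L2" and \<mu> :: real
  assumes finite: "finite X" and unit: "\<And>x. x \<in> X \<Longrightarrow> norm (\<phi> x) = 1"
    and mu: "0 \<le> \<mu>" "\<mu> < 1"
    and row_sum: "\<And>x. x \<in> X \<Longrightarrow> (\<Sum>y\<in>X - {x}. cmod (cinner (\<phi> x) (\<phi> y))) \<le> \<mu>"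
begin

definition synth :: "('a \<Rightarrow> complex) \<Rightarrow> sphere_L2" where
  "synth c = (\<Sum>x\<in>X. scaleC (c x) (\<phi> x))"

definition energy :: "sphere_L2 \<Rightarrow> real" where
  "energy f = (\<Sum>x\<in>X. (cmod (cinner f (\<phi> x)))\<^sup>2)"

lemma energy_nonneg: "0 \<le> energy f"
  by (simp add: energy_def sum_nonneg)

text \<open>Schur test for the off-diagonal Gram matrix: split each product of two coefficients into
  half squares, and use symmetry to sum both halves along rows.\<close>

lemma synth_norm_bounds:
  "\<bar>(norm (synth c))\<^sup>2 - (\<Sum>x\<in>X. (cmod (c x))\<^sup>2)\<bar> \<le> \<mu> * (\<Sum>x\<in>X. (cmod (c x))\<^sup>2)"
proof -
  define K where "K = (\<lambda>x y. if x = y then 0 else cmod (cinner (\<phi> x) (\<phi> y)))"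
  have K_sym: "K x y = K y x" for x y
    using cinner_commute[of "\<phi> x" "\<phi> y"] by (simp add: K_def)
  have K_sum: "(\<Sum>y\<in>X. K x y) \<le> \<mu>" if "x \<in> X" for x
  proof -
    have "(\<Sum>y\<in>X. K x y) = (\<Sum>y\<in>X - {x}. K x y)"
      using finite that by (simp add: sum.remove[of X x] K_def)
    also have "\<dots> = (\<Sum>y\<in>X - {x}. cmod (cinner (\<phi> x) (\<phi> y)))"
      by (rule sum.cong) (auto simp: K_def)
    finally show ?thesis using row_sum[OF that] by simp
  qed
  have "complex_of_real ((norm (synth c))\<^sup>2) = (\<Sum>x\<in>X. \<Sum>y\<in>X. c x * (cnj (c y) * cinner (\<phi> x) (\<phi> y)))"
    unfolding cinner_self[symmetric] synth_def
    by (subst cinner_sum_left)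
       (simp add: cinner_sum_right cinner_scaleC_left cinner_scaleC_right sum_distrib_left mult.left_commute)
  also have "\<dots> = (\<Sum>x\<in>X. \<Sum>y\<in>X. (if x = y then of_real ((cmod (c x))\<^sup>2) else 0)
      + (if x = y then 0 else c x * (cnj (c y) * cinner (\<phi> x) (\<phi> y))))"
    by (intro sum.cong refl)
       (auto simp: cinner_self unit complex_norm_square simp del: of_real_power)
  also have "\<dots> = of_real (\<Sum>x\<in>X. (cmod (c x))\<^sup>2)
      + (\<Sum>x\<in>X. \<Sum>y\<in>X. if x = y then 0 else c x * (cnj (c y) * cinner (\<phi> x) (\<phi> y)))"
    using finite by (simp add: sum.distrib)
  finally have "complex_of_real ((norm (synth c))\<^sup>2 - (\<Sum>x\<in>X. (cmod (c x))\<^sup>2))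
      = (\<Sum>x\<in>X. \<Sum>y\<in>X. if x = y then 0 else c x * (cnj (c y) * cinner (\<phi> x) (\<phi> y)))"
    by (simp only: of_real_diff) simp
  then have "\<bar>(norm (synth c))\<^sup>2 - (\<Sum>x\<in>X. (cmod (c x))\<^sup>2)\<bar>
      = cmod (\<Sum>x\<in>X. \<Sum>y\<in>X. if x = y then 0 else c x * (cnj (c y) * cinner (\<phi> x) (\<phi> y)))"
    by (simp only: norm_of_real[where 'a = complex, symmetric])
  also have "\<dots> \<le> (\<Sum>x\<in>X. \<Sum>y\<in>X. cmod (if x = y then 0 else c x * (cnj (c y) * cinner (\<phi> x) (\<phi> y))))"
    by (rule order_trans[OF norm_sum sum_mono]) (rule norm_sum)
  also have "\<dots> \<le> (\<Sum>x\<in>X. \<Sum>y\<in>X. (cmod (c x))\<^sup>2 / 2 * K x y + (cmod (c y))\<^sup>2 / 2 * K x y)"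
  proof (intro sum_mono)
    fix x y
    have "cmod (if x = y then 0 else c x * (cnj (c y) * cinner (\<phi> x) (\<phi> y))) = (cmod (c x) * cmod (c y)) * K x y"
      by (simp add: K_def norm_mult)
    also have "\<dots> \<le> ((cmod (c x))\<^sup>2 / 2 + (cmod (c y))\<^sup>2 / 2) * K x y"
      using sum_squares_bound[of "cmod (c x)" "cmod (c y)"] by (intro mult_right_mono) (auto simp: K_def)
    finally show "cmod (if x = y then 0 else c x * (cnj (c y) * cinner (\<phi> x) (\<phi> y)))
        \<le> (cmod (c x))\<^sup>2 / 2 * K x y + (cmod (c y))\<^sup>2 / 2 * K x y"
      by (simp only: distrib_right)
  qed
  also have "\<dots> = (\<Sum>x\<in>X. \<Sum>y\<in>X. (cmod (c x))\<^sup>2 / 2 * K x y) + (\<Sum>x\<in>X. \<Sum>y\<in>X. (cmod (c y))\<^sup>2 / 2 * K x y)"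
    by (simp only: sum.distrib)
  also have "(\<Sum>x\<in>X. \<Sum>y\<in>X. (cmod (c y))\<^sup>2 / 2 * K x y) = (\<Sum>x\<in>X. \<Sum>y\<in>X. (cmod (c x))\<^sup>2 / 2 * K x y)"
    by (subst sum.swap) (simp only: K_sym)
  also have "(\<Sum>x\<in>X. \<Sum>y\<in>X. (cmod (c x))\<^sup>2 / 2 * K x y) + (\<Sum>x\<in>X. \<Sum>y\<in>X. (cmod (c x))\<^sup>2 / 2 * K x y)
      = (\<Sum>x\<in>X. (cmod (c x))\<^sup>2 * (\<Sum>y\<in>X. K x y))"
    by (simp only: sum_distrib_left[symmetric] sum.distrib[symmetric]) (simp add: mult.commute)
  also have "\<dots> \<le> (\<Sum>x\<in>X. (cmod (c x))\<^sup>2 * \<mu>)"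
    by (intro sum_mono mult_left_mono K_sum) auto
  finally show ?thesis by (simp only: sum_distrib_left mult.commute[of _ \<mu>])
qed

lemma synth_coeff_le: "(1 - \<mu>) * (\<Sum>x\<in>X. (cmod (c x))\<^sup>2) \<le> (norm (synth c))\<^sup>2"
  using synth_norm_bounds[of c] by (simp add: algebra_simps abs_le_iff)

lemma synth_norm_le: "(norm (synth c))\<^sup>2 \<le> (1 + \<mu>) * (\<Sum>x\<in>X. (cmod (c x))\<^sup>2)"
  using synth_norm_bounds[of c] by (simp add: algebra_simps abs_le_iff)

lemma inj: "inj_on \<phi> X"
proof (rule inj_onI, rule ccontr)
  fix x y assume xy: "x \<in> X" "y \<in> X" "\<phi> x = \<phi> y" "x \<noteq> y"
  have "cmod (cinner (\<phi> x) (\<phi> y)) \<le> (\<Sum>y\<in>X - {x}. cmod (cinner (\<phi> x) (\<phi> y)))"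
    using xy finite by (intro member_le_sum[of y "X - {x}" "\<lambda>y. cmod (cinner (\<phi> x) (\<phi> y))"]) auto
  also have "\<dots> \<le> \<mu>" by (rule row_sum[OF xy(1)])
  finally show False using xy mu by (simp add: cinner_self unit)
qed

lemma span_eq_range_synth: "cL2.span (\<phi> ` X) = range synth"
proof -
  have eq: "(\<Sum>v\<in>\<phi> ` X. scaleC (k v) v) = synth (k \<circ> \<phi>)" for k
    unfolding synth_def by (subst sum.reindex[OF inj]) simp
  have "cL2.span (\<phi> ` X) = range (\<lambda>k. synth (k \<circ> \<phi>))"
    using finite by (simp add: cL2.span_finite eq)
  also have "\<dots> = range synth"
  proof
    show "range synth \<subseteq> range (\<lambda>k. synth (k \<circ> \<phi>))"
    proof
      fix u assume "u \<in> range synth"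
      then obtain c where c: "u = synth c" by auto
      have "synth c = synth ((\<lambda>v. c (inv_into X \<phi> v)) \<circ> \<phi>)"
        unfolding synth_def by (rule sum.cong) (auto simp: inv_into_f_f[OF inj])
      then show "u \<in> range (\<lambda>k. synth (k \<circ> \<phi>))" using c by blast
    qed
  qed auto
  finally show ?thesis .
qed

lemma independent: "cL2.independent (\<phi> ` X)"
proof (rule cL2.independent_if_scalars_zero)
  show "Finite_Set.finite (\<phi> ` X)" using finite by simp
  fix k v assume 0: "(\<Sum>v\<in>\<phi> ` X. scaleC (k v) v) = 0" and v: "v \<in> \<phi> ` X"
  obtain x where x: "x \<in> X" "v = \<phi> x" using v by auto
  have "synth (k \<circ> \<phi>) = 0"
    unfolding synth_def using 0 by (subst (asm) sum.reindex[OF inj]) simp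
  then have "(1 - \<mu>) * (\<Sum>x\<in>X. (cmod (k (\<phi> x)))\<^sup>2) \<le> 0"
    using synth_coeff_le[of "k \<circ> \<phi>"] by simp
  moreover have "(cmod (k (\<phi> x)))\<^sup>2 \<le> (\<Sum>x\<in>X. (cmod (k (\<phi> x)))\<^sup>2)"
    using x finite by (intro member_le_sum) auto
  ultimately have "(cmod (k (\<phi> x)))\<^sup>2 \<le> 0"
    using mu by (smt (verit) mult_pos_pos)
  then show "k v = 0" using x by simp
qed

lemma span_in_Gr: "cL2.span (\<phi> ` X) \<in> Gr (card X)"
  unfolding Gr_def using finite independent inj by (auto intro!: exI[of _ "\<phi> ` X"] card_image)

text \<open>Taking inner products with the frame is adjoint to \<open>synth\<close>. With
  \<open>w\<close> the synthesis of the coefficients of \<open>u\<close>, the energy equals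
  \<open>inner w u\<close>; Cauchy-Schwarz and the bound on \<open>norm w\<close> allow one factor
  \<open>energy u\<close> to be cancelled.\<close>

lemma energy_le: "energy u \<le> (1 + \<mu>) * (norm u)\<^sup>2"
proof -
  define w where "w = synth (\<lambda>x. cinner u (\<phi> x))"
  have "cinner w u = (\<Sum>x\<in>X. cinner u (\<phi> x) * cnj (cinner u (\<phi> x)))"
    unfolding w_def synth_def
    by (simp add: cinner_sum_left cinner_scaleC_left cinner_commute[symmetric])
  also have "\<dots> = of_real (energy u)"
    by (simp add: energy_def complex_norm_square del: of_real_power)
  finally have "energy u = inner w u" by (simp add: inner_eq_Re_cinner)
  also have "\<dots> \<le> norm w * norm u" by (rule norm_cauchy_schwarz)
  finally have "(energy u)\<^sup>2 \<le> (norm w * norm u)\<^sup>2"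
    using energy_nonneg by (intro power_mono)
  also have "\<dots> \<le> (1 + \<mu>) * energy u * (norm u)\<^sup>2"
    unfolding power_mult_distrib w_def energy_def by (intro mult_right_mono synth_norm_le) auto
  finally have "energy u * energy u \<le> energy u * ((1 + \<mu>) * (norm u)\<^sup>2)"
    by (simp add: power2_eq_square mult_ac)
  then show ?thesis
    using energy_nonneg[of u] mu by (cases "energy u = 0") (auto simp: mult_le_cancel_left)
qed

text \<open>Dual to the upper bound: expand one copy of \<open>u\<close> in the frame, apply
  Cauchy-Schwarz to the coefficients, and bound the expansion coefficients by
  \<open>synth_coeff_le\<close>.\<close>

lemma energy_ge:
  assumes "u \<in> cL2.span (\<phi> ` X)"
  shows "(1 - \<mu>) * (norm u)\<^sup>2 \<le> energy u"
proof (cases "u = 0")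
  case False
  obtain c where u: "u = synth c" using assms by (auto simp: span_eq_range_synth)
  define C where "C = (\<Sum>x\<in>X. (cmod (c x))\<^sup>2)"
  have "(norm u)\<^sup>2 = cmod (cinner u u)" by (simp add: cinner_self norm_power)
  also have "cinner u u = (\<Sum>x\<in>X. c x * cnj (cinner u (\<phi> x)))"
    by (subst (1) u) (simp add: synth_def cinner_sum_left cinner_scaleC_left cinner_commute[symmetric])
  also have "cmod \<dots> \<le> (\<Sum>x\<in>X. cmod (c x) * cmod (cinner u (\<phi> x)))"
    by (rule order_trans[OF norm_sum]) (simp add: norm_mult)
  finally have "((norm u)\<^sup>2)\<^sup>2 \<le> (\<Sum>x\<in>X. cmod (c x) * cmod (cinner u (\<phi> x)))\<^sup>2"
    by (intro power_mono) auto
  also have "\<dots> \<le> C * energy u"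
    unfolding C_def energy_def by (rule Cauchy_Schwarz_ineq_sum)
  finally have "(1 - \<mu>) * ((norm u)\<^sup>2)\<^sup>2 \<le> ((1 - \<mu>) * C) * energy u"
    using mu by (simp add: mult.assoc mult_left_mono)
  also have "\<dots> \<le> (norm u)\<^sup>2 * energy u"
    unfolding C_def u by (intro mult_right_mono synth_coeff_le energy_nonneg)
  finally have "(norm u)\<^sup>2 * ((1 - \<mu>) * (norm u)\<^sup>2) \<le> (norm u)\<^sup>2 * energy u"
    by (simp only: power2_eq_square mult_ac)
  then show ?thesis using False by (simp add: mult_le_cancel_left_pos)
qed (simp add: energy_nonneg)

text \<open>The real form of the identity minus the frame operator. On the span it is the error made
  by treating the frame as orthonormal.\<close>

definition defect :: "sphere_L2 \<Rightarrow> sphere_L2 \<Rightarrow> real" where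
  "defect u w = inner u w - (\<Sum>x\<in>X. Re (cinner u (\<phi> x) * cnj (cinner w (\<phi> x))))"

lemma defect_self:
  assumes "u \<in> cL2.span (\<phi> ` X)"
  shows "\<bar>defect u u\<bar> \<le> \<mu> * (norm u)\<^sup>2"
proof -
  have "defect u u = (norm u)\<^sup>2 - energy u"
    unfolding defect_def energy_def power2_norm_eq_inner
    by (simp add: complex_norm_square[symmetric] dot_square_norm del: of_real_power times_complex.sel)
  then show ?thesis
    using energy_ge[OF assms] energy_le[of u] by (simp add: algebra_simps abs_le_iff)
qed

text \<open>Polarization of the diagonal bound \<open>defect_self\<close>.\<close>

lemma defect_le:
  assumes u: "u \<in> cL2.span (\<phi> ` X)" and w: "w \<in> cL2.span (\<phi> ` X)"
  shows "\<bar>defect u w\<bar> \<le> \<mu> * (norm u * norm w)"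
proof (cases "u = 0 \<or> w = 0")
  case True
  then show ?thesis by (auto simp: defect_def)
next
  case False
  define n where "n = norm u * norm w"
  have n: "n > 0" using False by (simp add: n_def)
  \<comment> \<open>Rescaling to equal norms makes the parallelogram law produce the product of the
    norms instead of the mean of their squares.\<close>
  define u' w' where "u' = norm w *\<^sub>R u" and "w' = norm u *\<^sub>R w"
  have norms: "norm u' = n" "norm w' = n" by (simp_all add: u'_def w'_def n_def)
  have sub: "cL2.subspace (cL2.span (\<phi> ` X))" by (rule cL2.subspace_span)
  have mem: "u' + w' \<in> cL2.span (\<phi> ` X)" "u' - w' \<in> cL2.span (\<phi> ` X)"
    unfolding u'_def w'_def
    by (intro cL2.span_add subspace_diff subspace_scaleR sub u w)+
  have "4 * defect u' w' = defect (u' + w') (u' + w') - defect (u' - w') (u' - w')"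
    by (simp add: defect_def inner_add_left inner_add_right inner_diff_left inner_diff_right
        inner_commute cinner_add_left cinner_diff_left algebra_simps sum.distrib sum_subtractf
        sum_distrib_left)
  also have "\<bar>\<dots>\<bar> \<le> \<mu> * (norm (u' + w'))\<^sup>2 + \<mu> * (norm (u' - w'))\<^sup>2"
    using defect_self[OF mem(1)] defect_self[OF mem(2)] by linarith
  also have "\<dots> = \<mu> * (2 * (norm u')\<^sup>2 + 2 * (norm w')\<^sup>2)"
    by (simp add: power2_norm_eq_inner inner_add_left inner_add_right inner_diff_left
        inner_diff_right inner_commute algebra_simps)
  finally have "\<bar>defect u' w'\<bar> \<le> \<mu> * n\<^sup>2" by (simp add: norms)
  moreover have "defect u' w' = n * defect u w"
  proof -
    have "cinner u' (\<phi> x) * cnj (cinner w' (\<phi> x)) = of_real n * (cinner u (\<phi> x) * cnj (cinner w (\<phi> x)))" for x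
      by (simp add: u'_def w'_def n_def scaleR_eq_scaleC cinner_scaleC_left)
    then have "(\<Sum>x\<in>X. Re (cinner u' (\<phi> x) * cnj (cinner w' (\<phi> x)))) = n * (\<Sum>x\<in>X. Re (cinner u (\<phi> x) * cnj (cinner w (\<phi> x))))"
      unfolding sum_distrib_left by (intro sum.cong) (simp_all only: Re_complex_of_real times_complex.sel Im_complex_of_real mult_zero_left diff_zero)
    then show ?thesis
      unfolding defect_def by (simp add: u'_def w'_def n_def right_diff_distrib)
  qed
  ultimately have "n * \<bar>defect u w\<bar> \<le> n * (\<mu> * n)"
    using n by (simp add: abs_mult power2_eq_square mult_ac)
  then show ?thesis using n by (simp add: n_def mult_le_cancel_left_pos)
qed

abbreviation "P \<equiv> orth_proj (cL2.span (\<phi> ` X))"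

lemma projectable: "projectable (cL2.span (\<phi> ` X))"
  using finite by (intro projectable_span) simp

lemma energy_proj: "cinner (P f) (\<phi> x) = cinner f (\<phi> x)" if "x \<in> X"
proof -
  interpret projectable "cL2.span (\<phi> ` X)" by (rule projectable)
  show ?thesis by (rule cinner_proj) (use that in \<open>auto intro: cL2.span_base\<close>)
qed

lemma norm_proj_le_energy: "(1 - \<mu>) * (norm (P f))\<^sup>2 \<le> energy f"
proof -
  interpret projectable "cL2.span (\<phi> ` X)" by (rule projectable)
  have "energy (P f) = energy f" unfolding energy_def by (intro sum.cong) (simp_all add: energy_proj)
  then show ?thesis using energy_ge[OF proj_in, of f] by simp
qed

text \<open>A vector and its projection have the same frame coefficients, so
  \<open>defect_le\<close> applies to the projections, whose norms are at most the square root of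
  energy over \<open>1 - \<mu>\<close>. The error is kept in terms of energies because these are
  explicit kernel sums.\<close>

lemma inner_proj_approx:
  "\<bar>inner (P f) g - (\<Sum>x\<in>X. Re (cinner f (\<phi> x) * cnj (cinner g (\<phi> x))))\<bar>
    \<le> \<mu> / (1 - \<mu>) * (sqrt (energy f) * sqrt (energy g))"
proof -
  interpret projectable "cL2.span (\<phi> ` X)" by (rule projectable)
  have le: "sqrt (1 - \<mu>) * norm (P f) \<le> sqrt (energy f)" for f
    using real_sqrt_le_mono[OF norm_proj_le_energy[of f]] by (simp add: real_sqrt_mult)
  have "inner (P f) (P g) = inner (P f) g"
    using inner_proj[OF proj_in, of g f] by (simp add: inner_commute)
  moreover have "(\<Sum>x\<in>X. Re (cinner (P f) (\<phi> x) * cnj (cinner (P g) (\<phi> x))))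
      = (\<Sum>x\<in>X. Re (cinner f (\<phi> x) * cnj (cinner g (\<phi> x))))"
    by (intro sum.cong) (simp_all only: energy_proj)
  ultimately have "\<bar>inner (P f) g - (\<Sum>x\<in>X. Re (cinner f (\<phi> x) * cnj (cinner g (\<phi> x))))\<bar>
      \<le> \<mu> * (norm (P f) * norm (P g))"
    using defect_le[OF proj_in proj_in, of f g] by (simp only: defect_def)
  also have "\<dots> = \<mu> / (1 - \<mu>) * ((sqrt (1 - \<mu>) * norm (P f)) * (sqrt (1 - \<mu>) * norm (P g)))"
  proof -
    have "(sqrt (1 - \<mu>) * norm (P f)) * (sqrt (1 - \<mu>) * norm (P g))
        = (sqrt (1 - \<mu>) * sqrt (1 - \<mu>)) * (norm (P f) * norm (P g))"
      by (simp only: mult_ac)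
    also have "\<dots> = (1 - \<mu>) * (norm (P f) * norm (P g))" using mu by simp
    finally have eq: "(sqrt (1 - \<mu>) * norm (P f)) * (sqrt (1 - \<mu>) * norm (P g)) = (1 - \<mu>) * (norm (P f) * norm (P g))" .
    show ?thesis unfolding eq using mu by simp
  qed
  also have "\<dots> \<le> \<mu> / (1 - \<mu>) * (sqrt (energy f) * sqrt (energy g))"
    using mu by (intro mult_left_mono mult_mono le) (auto simp: energy_nonneg)
  finally show ?thesis .
qed

end

section \<open>Plane waves and their directional derivatives\<close>

lemma square_integrable_continuous:
  assumes "continuous_on UNIV f"
  shows "square_integrable f"
proof -
  have "integrable sphere_measure (\<lambda>\<omega>. (norm (f \<omega>))\<^sup>2)"
    by (intro integrable_sphere_measure continuous_intros assms)
  then show ?thesis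
    using borel_measurable_continuous_onI[OF assms] by (simp add: square_integrable_def)
qed

definition L2_of :: "(real^3 \<Rightarrow> complex) \<Rightarrow> sphere_L2" where
  "L2_of f = abs_sphere_L2 f"

lemma L2_rel_continuous: "continuous_on UNIV f \<Longrightarrow> L2_rel f f"
  by (simp add: L2_rel_def square_integrable_continuous)

lemma cinner_L2_of:
  "continuous_on UNIV f \<Longrightarrow> continuous_on UNIV g \<Longrightarrow>
    cinner (L2_of f) (L2_of g) = sphere_mean (\<lambda>\<omega>. f \<omega> * cnj (g \<omega>))"
  unfolding L2_of_def by (intro cinner.abs_eq L2_rel_continuous)

lemma L2_of_add:
  "continuous_on UNIV f \<Longrightarrow> continuous_on UNIV g \<Longrightarrow> L2_of f + L2_of g = L2_of (\<lambda>\<omega>. f \<omega> + g \<omega>)"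
  unfolding L2_of_def by (intro plus_sphere_L2.abs_eq L2_rel_continuous)

lemma L2_of_scaleC: "continuous_on UNIV f \<Longrightarrow> scaleC c (L2_of f) = L2_of (\<lambda>\<omega>. c * f \<omega>)"
  unfolding L2_of_def by (intro scaleC.abs_eq L2_rel_continuous)

lemma L2_of_diff:
  assumes "continuous_on UNIV f" "continuous_on UNIV g"
  shows "L2_of f - L2_of g = L2_of (\<lambda>\<omega>. f \<omega> - g \<omega>)"
proof -
  have "L2_of (\<lambda>\<omega>. f \<omega> - g \<omega>) + L2_of g = L2_of f"
    using assms by (simp add: L2_of_add continuous_on_diff)
  then show ?thesis by (simp add: algebra_simps)
qed

lemma norm_L2_of:
  assumes "continuous_on UNIV f"
  shows "(norm (L2_of f))\<^sup>2 = sphere_mean (\<lambda>\<omega>. (cmod (f \<omega>))\<^sup>2)"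
proof -
  have "complex_of_real ((norm (L2_of f))\<^sup>2) = sphere_mean (\<lambda>\<omega>. complex_of_real ((cmod (f \<omega>))\<^sup>2))"
    unfolding cinner_self[symmetric] cinner_L2_of[OF assms assms]
    by (simp add: complex_norm_square del: of_real_power)
  then show ?thesis by (simp only: integral_complex_of_real of_real_eq_iff)
qed

lemma norm_L2_of_le:
  assumes f: "continuous_on UNIV f" and B: "B \<ge> 0" "\<And>\<omega>. norm \<omega> = 1 \<Longrightarrow> cmod (f \<omega>) \<le> B"
  shows "norm (L2_of f) \<le> B"
proof (rule power2_le_imp_le[OF _ B(1)])
  have "sphere_mean (\<lambda>\<omega>. (cmod (f \<omega>))\<^sup>2) \<le> sphere_mean (\<lambda>_. B\<^sup>2)"
    by (rule sphere_mean_mono) (auto intro!: continuous_intros f power_mono B)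
  then show "(norm (L2_of f))\<^sup>2 \<le> B\<^sup>2" by (simp add: norm_L2_of[OF f])
qed

text \<open>The \<open>n\<close>-th derivative of the plane wave in direction \<open>v\<close>, as a
  function on the sphere.\<close>

definition wave_fun :: "nat \<Rightarrow> real \<Rightarrow> real^3 \<Rightarrow> real^3 \<Rightarrow> real^3 \<Rightarrow> complex" where
  "wave_fun n \<kappa> v z \<omega> = (\<i> * of_real (\<kappa> * (\<omega> \<bullet> v))) ^ n * exp (\<i> * of_real (\<kappa> * (\<omega> \<bullet> z)))"

definition wave :: "nat \<Rightarrow> real \<Rightarrow> real^3 \<Rightarrow> real^3 \<Rightarrow> sphere_L2" where
  "wave n \<kappa> v z = L2_of (wave_fun n \<kappa> v z)"

lemma continuous_wave_fun: "continuous_on UNIV (wave_fun n \<kappa> v z)"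
  unfolding wave_fun_def by (intro continuous_intros)

lemma plane_wave_eq_wave: "plane_wave \<kappa> z = wave 0 \<kappa> v z"
  unfolding wave_def L2_of_def wave_fun_def plane_wave_def by simp

lemma has_vector_derivative_quadraticI:
  fixes f :: "real \<Rightarrow> 'a::real_normed_vector"
  assumes "\<And>h. norm (f (t + h) - f t - h *\<^sub>R d) \<le> C * h\<^sup>2"
  shows "(f has_vector_derivative d) (at t)"
  unfolding has_vector_derivative_def has_derivative_at
proof
  show "bounded_linear (\<lambda>h. h *\<^sub>R d)" by (rule bounded_linear_scaleR_left)
  show "(\<lambda>h. norm (f (t + h) - f t - h *\<^sub>R d) / norm h) \<midarrow>0\<rightarrow> 0"
  proof (rule Lim_null_comparison)
    show "\<forall>\<^sub>F h in at 0. norm (norm (f (t + h) - f t - h *\<^sub>R d) / norm h) \<le> C * \<bar>h\<bar>"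
      unfolding eventually_at_filter
    proof (intro always_eventually allI impI)
      fix h :: real assume "h \<noteq> 0"
      then show "norm (norm (f (t + h) - f t - h *\<^sub>R d) / norm h) \<le> C * \<bar>h\<bar>"
        using assms[of h] by (simp add: pos_divide_le_eq power2_eq_square mult.assoc)
    qed
    show "(\<lambda>h. C * \<bar>h\<bar>) \<midarrow>0\<rightarrow> 0" by (auto intro!: tendsto_eq_intros)
  qed
qed

text \<open>The derivative exists in norm, as the quadratic Taylor remainder of the exponential is
  uniform on the sphere: \<open>|\<omega> \<bullet> v|\<close> is at most 1 there.\<close>

lemma wave_has_vector_derivative:
  assumes v: "norm v = 1"
  shows "((\<lambda>t. wave n \<kappa> v (z + t *\<^sub>R v)) has_vector_derivative wave (Suc n) \<kappa> v (z + t *\<^sub>R v)) (at t)"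
proof (rule has_vector_derivative_quadraticI)
  fix h :: real
  let ?f = "wave_fun n \<kappa> v" and ?g = "wave_fun (Suc n) \<kappa> v" and ?z = "z + t *\<^sub>R v"
  let ?r = "\<lambda>\<omega>. ?f (z + (t + h) *\<^sub>R v) \<omega> - ?f ?z \<omega> - of_real h * ?g ?z \<omega>"
  note cont = continuous_wave_fun
  have eq: "wave n \<kappa> v (z + (t + h) *\<^sub>R v) - wave n \<kappa> v ?z - h *\<^sub>R wave (Suc n) \<kappa> v ?z = L2_of ?r"
    unfolding wave_def scaleR_eq_scaleC
    by (simp add: L2_of_diff L2_of_scaleC cont continuous_on_diff continuous_on_mult_left)
  show "norm (wave n \<kappa> v (z + (t + h) *\<^sub>R v) - wave n \<kappa> v ?z - h *\<^sub>R wave (Suc n) \<kappa> v ?z) \<le> \<bar>\<kappa>\<bar> ^ (n + 2) * h\<^sup>2"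
    unfolding eq
  proof (rule norm_L2_of_le)
    show "continuous_on UNIV ?r" by (intro continuous_intros cont)
    fix \<omega> :: "real^3" assume \<omega>: "norm \<omega> = 1"
    define a where "a = \<kappa> * h * (\<omega> \<bullet> v)"
    have le: "\<bar>\<omega> \<bullet> v\<bar> \<le> 1" using Cauchy_Schwarz_ineq2[of \<omega> v] v \<omega> by simp
    have arg: "\<i> * of_real (\<kappa> * (\<omega> \<bullet> (z + (t + h) *\<^sub>R v))) = \<i> * of_real (\<kappa> * (\<omega> \<bullet> ?z)) + \<i> * of_real a"
      by (simp add: a_def inner_add_right algebra_simps)
    have "?r \<omega> = (\<i> * of_real (\<kappa> * (\<omega> \<bullet> v))) ^ n * exp (\<i> * of_real (\<kappa> * (\<omega> \<bullet> ?z))) * (exp (\<i> * of_real a) - (1 + \<i> * of_real a))"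
      unfolding wave_fun_def arg exp_add by (simp add: a_def algebra_simps)
    then have "cmod (?r \<omega>) = \<bar>\<kappa> * (\<omega> \<bullet> v)\<bar> ^ n * cmod (exp (\<i> * of_real a) - (1 + \<i> * of_real a))"
      by (simp only: norm_mult norm_power norm_exp_i_times norm_ii norm_of_real mult_1_left mult_1_right)
    also have "\<dots> \<le> \<bar>\<kappa> * (\<omega> \<bullet> v)\<bar> ^ n * a\<^sup>2"
      using Taylor_exp[of "\<i> * of_real a" 1] by (intro mult_left_mono) (auto simp: norm_mult power2_eq_square)
    also have "\<dots> = \<bar>\<kappa>\<bar> ^ (n + 2) * h\<^sup>2 * \<bar>\<omega> \<bullet> v\<bar> ^ (n + 2)"
    proof -
      have "a\<^sup>2 = \<bar>\<kappa>\<bar>\<^sup>2 * h\<^sup>2 * \<bar>\<omega> \<bullet> v\<bar>\<^sup>2" by (simp add: a_def power_mult_distrib)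
      then show ?thesis by (simp only: abs_mult power_mult_distrib power_add mult_ac)
    qed
    also have "\<dots> \<le> \<bar>\<kappa>\<bar> ^ (n + 2) * h\<^sup>2 * 1"
      using le by (intro mult_left_mono power_le_one) auto
    finally show "cmod (?r \<omega>) \<le> \<bar>\<kappa>\<bar> ^ (n + 2) * h\<^sup>2" by simp
  qed simp
qed

text \<open>The moments of order 0, 2 and 4. The values \<open>1 / sqrt 3\<close> and
  \<open>1 / sqrt 5\<close> reappear in the constants of the theorem.\<close>

lemma norm_wave:
  "norm (wave 0 \<kappa> v z) = 1"
  "\<kappa> > 0 \<Longrightarrow> norm v = 1 \<Longrightarrow> norm (wave 1 \<kappa> v z) = \<kappa> / sqrt 3"
  "\<kappa> > 0 \<Longrightarrow> norm v = 1 \<Longrightarrow> norm (wave 2 \<kappa> v z) = \<kappa>\<^sup>2 / sqrt 5"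
proof -
  have sq: "(norm (wave n \<kappa> v z))\<^sup>2 = \<kappa> ^ (2 * n) * sphere_mean (\<lambda>\<omega>. (\<omega> \<bullet> v) ^ (2 * n))" for n
  proof -
    have "(norm (wave n \<kappa> v z))\<^sup>2 = sphere_mean (\<lambda>\<omega>. (cmod (wave_fun n \<kappa> v z \<omega>))\<^sup>2)"
      unfolding wave_def by (rule norm_L2_of[OF continuous_wave_fun])
    also have "(\<lambda>\<omega>. (cmod (wave_fun n \<kappa> v z \<omega>))\<^sup>2) = (\<lambda>\<omega>. \<kappa> ^ (2 * n) * (\<omega> \<bullet> v) ^ (2 * n))"
      by (simp add: fun_eq_iff wave_fun_def norm_mult norm_power norm_exp_i_times[of "\<kappa> * _", simplified]
          power_mult_distrib power_mult[symmetric] mult.commute[of _ 2] power_even_abs)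
    finally show ?thesis by simp
  qed
  show "norm (wave 0 \<kappa> v z) = 1" by (rule power2_eq_imp_eq) (use sq[of 0] in simp_all)
  show "norm (wave 1 \<kappa> v z) = \<kappa> / sqrt 3" if "\<kappa> > 0" "norm v = 1"
  proof (rule power2_eq_imp_eq)
    show "(norm (wave 1 \<kappa> v z))\<^sup>2 = (\<kappa> / sqrt 3)\<^sup>2"
      using sq[of 1] by (simp add: sphere_mean_power2 that power_divide)
  qed (use that in auto)
  show "norm (wave 2 \<kappa> v z) = \<kappa>\<^sup>2 / sqrt 5" if "\<kappa> > 0" "norm v = 1"
  proof (rule power2_eq_imp_eq)
    show "(norm (wave 2 \<kappa> v z))\<^sup>2 = (\<kappa>\<^sup>2 / sqrt 5)\<^sup>2"
      using sq[of 2] by (simp add: sphere_mean_power4 that power_divide)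
  qed (use that in auto)
qed

lemma sphere_mean_antipodal:
  fixes g :: "real^3 \<Rightarrow> real"
  assumes "continuous_on UNIV g" "\<And>\<omega>. g (- \<omega>) = - g \<omega>"
  shows "sphere_mean g = 0"
proof -
  have "orthogonal_transformation (\<lambda>x::real^3. - x)"
    by (simp only: orthogonal_transformation_neg orthogonal_transformation_id)
  from sphere_mean_orthogonal[OF this assms(1)] show ?thesis by (simp add: assms(2))
qed

lemma sphere_mean_complex:
  assumes "continuous_on UNIV f" "continuous_on UNIV g"
  shows "sphere_mean (\<lambda>\<omega>. complex_of_real (f \<omega>) + \<i> * of_real (g \<omega>)) = of_real (sphere_mean f) + \<i> * of_real (sphere_mean g)"
proof -
  have [simp]: "integrable sphere_measure (\<lambda>\<omega>. complex_of_real (f \<omega>))"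
    "integrable sphere_measure (\<lambda>\<omega>. complex_of_real (g \<omega>))"
    by (intro integrable_sphere_measure continuous_intros assms)+
  show ?thesis by simp
qed

text \<open>All these overlaps are real: the imaginary part of the integrand is odd under the
  antipodal map.\<close>

lemma cinner_wave:
  "cinner (wave 0 \<kappa> v z) (plane_wave \<kappa> x) = of_real (kern0 (\<kappa> *\<^sub>R (z - x)))"
  "cinner (wave 1 \<kappa> v z) (plane_wave \<kappa> x) = of_real (- \<kappa> * kern1 v (\<kappa> *\<^sub>R (z - x)))"
  "cinner (wave 2 \<kappa> v z) (plane_wave \<kappa> x) = of_real (- \<kappa>\<^sup>2 * kern2 v (\<kappa> *\<^sub>R (z - x)))"
proof -
  define w where "w = \<kappa> *\<^sub>R (z - x)"
  have gen: "cinner (wave n \<kappa> v z) (plane_wave \<kappa> x) = sphere_mean (\<lambda>\<omega>. (\<i> * of_real (\<kappa> * (\<omega> \<bullet> v))) ^ n * (of_real (cos (\<omega> \<bullet> w)) + \<i> * of_real (sin (\<omega> \<bullet> w))))" for n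
  proof -
    have "wave_fun n \<kappa> v z \<omega> * cnj (wave_fun 0 \<kappa> v x \<omega>) = (\<i> * of_real (\<kappa> * (\<omega> \<bullet> v))) ^ n * (of_real (cos (\<omega> \<bullet> w)) + \<i> * of_real (sin (\<omega> \<bullet> w)))" for \<omega>
    proof -
      have "cnj (exp (\<i> * of_real (\<kappa> * (\<omega> \<bullet> x)))) = exp (- (\<i> * of_real (\<kappa> * (\<omega> \<bullet> x))))"
        by (simp add: exp_cnj)
      then have "wave_fun n \<kappa> v z \<omega> * cnj (wave_fun 0 \<kappa> v x \<omega>) = (\<i> * of_real (\<kappa> * (\<omega> \<bullet> v))) ^ n * (exp (\<i> * of_real (\<kappa> * (\<omega> \<bullet> z))) * exp (- (\<i> * of_real (\<kappa> * (\<omega> \<bullet> x)))))"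
        unfolding wave_fun_def by (simp only: power_0 mult_1_left mult.assoc)
      also have "exp (\<i> * of_real (\<kappa> * (\<omega> \<bullet> z))) * exp (- (\<i> * of_real (\<kappa> * (\<omega> \<bullet> x)))) = exp (\<i> * of_real (\<omega> \<bullet> w))"
        unfolding exp_add[symmetric] by (simp add: w_def inner_diff_right algebra_simps)
      also have "exp (\<i> * of_real (\<omega> \<bullet> w)) = of_real (cos (\<omega> \<bullet> w)) + \<i> * of_real (sin (\<omega> \<bullet> w))"
        by (simp add: exp_Euler cos_of_real sin_of_real)
      finally show ?thesis .
    qed
    then show ?thesis
      unfolding plane_wave_eq_wave[of _ _ v] wave_def by (simp only: cinner_L2_of[OF continuous_wave_fun continuous_wave_fun])
  qed
  have "sphere_mean (\<lambda>\<omega>. sin (\<omega> \<bullet> w)) = 0"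
    by (rule sphere_mean_antipodal) (auto intro!: continuous_intros)
  then show "cinner (wave 0 \<kappa> v z) (plane_wave \<kappa> x) = of_real (kern0 (\<kappa> *\<^sub>R (z - x)))"
    unfolding gen w_def[symmetric] kern0_def
    using sphere_mean_complex[of "\<lambda>\<omega>. cos (\<omega> \<bullet> w)" "\<lambda>\<omega>. sin (\<omega> \<bullet> w)"]
    by (simp add: continuous_on_cos continuous_on_sin continuous_on_inner continuous_on_id continuous_on_const)
  have "sphere_mean (\<lambda>\<omega>. \<kappa> * ((\<omega> \<bullet> v) * cos (\<omega> \<bullet> w))) = 0"
    by (rule sphere_mean_antipodal) (auto intro!: continuous_intros)
  moreover have "sphere_mean (\<lambda>\<omega>. complex_of_real (- \<kappa> * ((\<omega> \<bullet> v) * sin (\<omega> \<bullet> w))) + \<i> * of_real (\<kappa> * ((\<omega> \<bullet> v) * cos (\<omega> \<bullet> w))))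
      = of_real (sphere_mean (\<lambda>\<omega>. - \<kappa> * ((\<omega> \<bullet> v) * sin (\<omega> \<bullet> w)))) + \<i> * of_real (sphere_mean (\<lambda>\<omega>. \<kappa> * ((\<omega> \<bullet> v) * cos (\<omega> \<bullet> w))))"
    by (rule sphere_mean_complex) (intro continuous_intros)+
  moreover have "(\<lambda>\<omega>. (\<i> * of_real (\<kappa> * (\<omega> \<bullet> v))) ^ 1 * (of_real (cos (\<omega> \<bullet> w)) + \<i> * of_real (sin (\<omega> \<bullet> w))))
      = (\<lambda>\<omega>. complex_of_real (- \<kappa> * ((\<omega> \<bullet> v) * sin (\<omega> \<bullet> w))) + \<i> * of_real (\<kappa> * ((\<omega> \<bullet> v) * cos (\<omega> \<bullet> w))))"
    by (simp add: fun_eq_iff complex_eq_iff)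
  ultimately show "cinner (wave 1 \<kappa> v z) (plane_wave \<kappa> x) = of_real (- \<kappa> * kern1 v (\<kappa> *\<^sub>R (z - x)))"
    unfolding gen w_def[symmetric] kern1_def by simp
  have "sphere_mean (\<lambda>\<omega>. - \<kappa>\<^sup>2 * ((\<omega> \<bullet> v)\<^sup>2 * sin (\<omega> \<bullet> w))) = 0"
    by (rule sphere_mean_antipodal) (auto intro!: continuous_intros)
  moreover have "sphere_mean (\<lambda>\<omega>. complex_of_real (- \<kappa>\<^sup>2 * ((\<omega> \<bullet> v)\<^sup>2 * cos (\<omega> \<bullet> w))) + \<i> * of_real (- \<kappa>\<^sup>2 * ((\<omega> \<bullet> v)\<^sup>2 * sin (\<omega> \<bullet> w))))
      = of_real (sphere_mean (\<lambda>\<omega>. - \<kappa>\<^sup>2 * ((\<omega> \<bullet> v)\<^sup>2 * cos (\<omega> \<bullet> w)))) + \<i> * of_real (sphere_mean (\<lambda>\<omega>. - \<kappa>\<^sup>2 * ((\<omega> \<bullet> v)\<^sup>2 * sin (\<omega> \<bullet> w))))"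
    by (rule sphere_mean_complex) (intro continuous_intros)+
  moreover have "(\<lambda>\<omega>. (\<i> * of_real (\<kappa> * (\<omega> \<bullet> v))) ^ 2 * (of_real (cos (\<omega> \<bullet> w)) + \<i> * of_real (sin (\<omega> \<bullet> w))))
      = (\<lambda>\<omega>. complex_of_real (- \<kappa>\<^sup>2 * ((\<omega> \<bullet> v)\<^sup>2 * cos (\<omega> \<bullet> w))) + \<i> * of_real (- \<kappa>\<^sup>2 * ((\<omega> \<bullet> v)\<^sup>2 * sin (\<omega> \<bullet> w))))"
    by (simp add: fun_eq_iff power_mult_distrib) (simp add: algebra_simps)
  ultimately show "cinner (wave 2 \<kappa> v z) (plane_wave \<kappa> x) = of_real (- \<kappa>\<^sup>2 * kern2 v (\<kappa> *\<^sub>R (z - x)))"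
    unfolding gen w_def[symmetric] kern2_def by simp
qed

lemma norm_plane_wave [simp]: "norm (plane_wave \<kappa> z) = 1"
  unfolding plane_wave_eq_wave[of _ _ 0] by (rule norm_wave)

lemma cinner_plane_wave: "cinner (plane_wave \<kappa> z) (plane_wave \<kappa> x) = of_real (kern0 (\<kappa> *\<^sub>R (z - x)))"
  unfolding plane_wave_eq_wave[of _ z 0] by (rule cinner_wave)

text \<open>The squared distance of two unit waves is \<open>2 - 2 * kern0\<close>, and
  \<open>kern0_ge\<close> turns this into the Lipschitz constant
  \<open>\<kappa> / sqrt 3\<close>.\<close>

lemma norm_plane_wave_diff_le:
  assumes "\<kappa> > 0"
  shows "norm (plane_wave \<kappa> z - plane_wave \<kappa> x) \<le> \<kappa> * dist z x / sqrt 3"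
proof (rule power2_le_imp_le)
  have "(norm (plane_wave \<kappa> z - plane_wave \<kappa> x))\<^sup>2 = 2 - 2 * kern0 (\<kappa> *\<^sub>R (z - x))"
  proof -
    have "inner (plane_wave \<kappa> z) (plane_wave \<kappa> x) = kern0 (\<kappa> *\<^sub>R (z - x))"
      by (simp add: inner_eq_Re_cinner cinner_plane_wave)
    moreover have "inner (plane_wave \<kappa> y) (plane_wave \<kappa> y) = 1" for y
      by (simp add: norm_eq_1[symmetric])
    ultimately show ?thesis
      by (simp add: power2_norm_eq_inner inner_diff_left inner_diff_right inner_commute[of "plane_wave \<kappa> x" "plane_wave \<kappa> z"])
  qed
  also have "\<dots> \<le> (\<kappa> * dist z x / sqrt 3)\<^sup>2"
    using kern0_ge[of "\<kappa> *\<^sub>R (z - x)"] by (simp add: power_divide power_mult_distrib dist_norm)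
  finally show "(norm (plane_wave \<kappa> z - plane_wave \<kappa> x))\<^sup>2 \<le> (\<kappa> * dist z x / sqrt 3)\<^sup>2" .
qed (use assms in simp)

section \<open>Critical points of strongly convex functions\<close>

text \<open>Formulated with derivatives along lines: for the residual they come from moving a plane
  wave in one direction, and the arguments below run along segments.\<close>

locale line_smooth =
  fixes F :: "'a::euclidean_space \<Rightarrow> real" and D1 D2 :: "'a \<Rightarrow> 'a \<Rightarrow> real"
  assumes der1: "\<And>z v t. norm v = 1 \<Longrightarrow>
      ((\<lambda>t. F (z + t *\<^sub>R v)) has_real_derivative D1 (z + t *\<^sub>R v) v) (at t)"
    and der2: "\<And>z v t. norm v = 1 \<Longrightarrow>
      ((\<lambda>t. D1 (z + t *\<^sub>R v) v) has_real_derivative D2 (z + t *\<^sub>R v) v) (at t)"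
    and cont: "continuous_on UNIV F"
begin

definition critical :: "'a \<Rightarrow> bool" where
  "critical z \<longleftrightarrow> (\<forall>v. norm v = 1 \<longrightarrow> D1 z v = 0)"

context
  fixes x :: 'a and \<rho> m G :: real
  assumes m: "0 < m" and lower: "\<And>z v. z \<in> cball x \<rho> \<Longrightarrow> norm v = 1 \<Longrightarrow> m \<le> D2 z v"
    and grad: "\<And>v. norm v = 1 \<Longrightarrow> \<bar>D1 x v\<bar> \<le> G" and G: "0 \<le> G" "G < m * \<rho>"
begin

lemma rho_pos: "0 < \<rho>"
  using G m by (smt (verit) mult_nonneg_nonpos)

text \<open>Mean value theorem for the directional derivative on the segment from \<open>z\<close>
  to \<open>y\<close>, which stays in the convex ball.\<close>

lemma gradient_monotone:
  assumes y: "y \<in> cball x \<rho>" and z: "z \<in> cball x \<rho>" and ne: "y \<noteq> z"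
  defines "u \<equiv> (y - z) /\<^sub>R norm (y - z)"
  shows "m * dist y z \<le> D1 y u - D1 z u"
proof -
  define d where "d = norm (y - z)"
  have d: "d > 0" using ne by (simp add: d_def)
  have u: "norm u = 1" using ne by (simp add: u_def)
  have zy: "z + d *\<^sub>R u = y" using d by (simp add: u_def d_def)
  obtain t where t: "0 < t" "t < d"
    and eq: "D1 (z + d *\<^sub>R u) u - D1 (z + 0 *\<^sub>R u) u = (d - 0) * D2 (z + t *\<^sub>R u) u"
    using MVT2[OF d der2[OF u, of z]] by blast
  have "z + t *\<^sub>R u = (1 - t / d) *\<^sub>R z + (t / d) *\<^sub>R y"
    using d by (simp add: zy[symmetric] algebra_simps)
  then have "z + t *\<^sub>R u \<in> cball x \<rho>"
    using convexD[OF convex_cball z y, of "1 - t / d" "t / d"] t d by simp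
  then have "m \<le> D2 (z + t *\<^sub>R u) u" by (rule lower) (rule u)
  then have "m * d \<le> d * D2 (z + t *\<^sub>R u) u" using d by (simp add: mult.commute mult_left_mono)
  then show ?thesis using eq by (simp add: zy dist_norm flip: d_def)
qed

lemma critical_unique:
  assumes "y \<in> cball x \<rho>" "z \<in> cball x \<rho>" "critical y" "critical z"
  shows "y = z"
proof (rule ccontr)
  assume ne: "y \<noteq> z"
  then have "m * dist y z \<le> 0"
    using gradient_monotone[OF assms(1,2) ne] assms(3,4) by (simp add: critical_def)
  then show False using m ne by (simp add: mult_le_0_iff)
qed

text \<open>Only the derivative pointing away from \<open>x\<close> is required to be nonpositive.
  Hence the estimate covers both critical points and a minimizer that might a priori lie on the
  boundary of the ball.\<close>

lemma critical_dist_le: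
  assumes z: "z \<in> cball x \<rho>" and le: "\<And>u. z \<noteq> x \<Longrightarrow> u = (z - x) /\<^sub>R norm (z - x) \<Longrightarrow> D1 z u \<le> 0"
  shows "dist z x \<le> G / m"
proof (cases "z = x")
  case False
  let ?u = "(z - x) /\<^sub>R norm (z - x)"
  have "x \<in> cball x \<rho>" using rho_pos by simp
  from gradient_monotone[OF z this False] le[OF False refl]
  have "m * dist z x \<le> - D1 x ?u" by simp
  also have "\<dots> \<le> G" using grad[of ?u] False by simp
  finally show ?thesis using m by (simp add: field_simps)
qed (use m G in simp)

text \<open>At a minimizer over the closed ball the outward derivative is nonpositive, since
  otherwise a step towards \<open>x\<close> would decrease \<open>F\<close>. So it lies within
  \<open>G / m < \<rho>\<close> of \<open>x\<close>, is interior, and is critical. The clause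
  \<open>F z \<le> F x\<close> transfers smallness of the residual from the node to the critical
  point.\<close>

lemma critical_exists: "\<exists>z\<in>ball x \<rho>. F z \<le> F x \<and> critical z"
proof -
  have xin: "x \<in> cball x \<rho>" using rho_pos by simp
  obtain z where z: "z \<in> cball x \<rho>" and min: "\<And>y. y \<in> cball x \<rho> \<Longrightarrow> F z \<le> F y"
    using continuous_attains_inf[of "cball x \<rho>" F] xin continuous_on_subset[OF cont]
    by (metis compact_cball empty_iff subset_UNIV)
  have "dist z x \<le> G / m"
  proof (rule critical_dist_le[OF z])
    fix u assume ne: "z \<noteq> x" and u: "u = (z - x) /\<^sub>R norm (z - x)"
    define d where "d = norm (z - x)"
    have d: "d > 0" "norm u = 1" using ne by (simp_all add: d_def u)
    show "D1 z u \<le> 0"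
    proof (rule ccontr)
      assume "\<not> D1 z u \<le> 0"
      then obtain e where e: "e > 0" "\<And>h. h > 0 \<Longrightarrow> h < e \<Longrightarrow> F (z + (0 - h) *\<^sub>R u) < F (z + 0 *\<^sub>R u)"
        using DERIV_pos_inc_left[OF der1[OF d(2), of z 0]] by auto
      define h where "h = min (e / 2) d"
      have h: "0 < h" "h < e" "h \<le> d" using e d by (auto simp: h_def)
      have "z + (0 - h) *\<^sub>R u = (1 - h / d) *\<^sub>R z + (h / d) *\<^sub>R x"
        using d(1) by (simp add: u d_def[symmetric] divide_inverse algebra_simps)
      then have "z + (0 - h) *\<^sub>R u \<in> cball x \<rho>"
        using convexD[OF convex_cball z xin, of "1 - h / d" "h / d"] h d by simp
      then show False using min e(2)[OF h(1,2)] by force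
    qed
  qed
  also have "G / m < \<rho>" using G m by (simp add: field_simps)
  finally have lt: "dist z x < \<rho>" .
  have "D1 z v = 0" if v: "norm v = 1" for v
  proof (rule DERIV_local_min)
    show "((\<lambda>t. F (z + t *\<^sub>R v)) has_real_derivative D1 z v) (at 0)"
      using der1[OF v, of z 0] by simp
    show "0 < \<rho> - dist z x" using lt by simp
    show "\<forall>t. \<bar>0 - t\<bar> < \<rho> - dist z x \<longrightarrow> F (z + 0 *\<^sub>R v) \<le> F (z + t *\<^sub>R v)"
    proof (intro allI impI)
      fix t assume t: "\<bar>0 - t\<bar> < \<rho> - dist z x"
      have "dist x (z + t *\<^sub>R v) \<le> dist x z + \<bar>t\<bar>"
        using dist_triangle[of x "z + t *\<^sub>R v" z] v by (simp add: dist_norm)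
      then have "z + t *\<^sub>R v \<in> cball x \<rho>" using t by (simp add: dist_commute)
      then show "F (z + 0 *\<^sub>R v) \<le> F (z + t *\<^sub>R v)" using min by simp
    qed
  qed
  then show ?thesis using lt min[OF xin] by (auto simp: critical_def dist_commute)
qed

end

end

section \<open>The residual of a subspace and its derivatives along lines\<close>

definition residual :: "real \<Rightarrow> sphere_L2 set \<Rightarrow> real^3 \<Rightarrow> real" where
  "residual \<kappa> V z = (norm (plane_wave \<kappa> z - orth_proj V (plane_wave \<kappa> z)))\<^sup>2"

definition residual_d1 :: "real \<Rightarrow> sphere_L2 set \<Rightarrow> real^3 \<Rightarrow> real^3 \<Rightarrow> real" where
  "residual_d1 \<kappa> V z v = - 2 * inner (orth_proj V (wave 1 \<kappa> v z)) (wave 0 \<kappa> v z)"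

definition residual_d2 :: "real \<Rightarrow> sphere_L2 set \<Rightarrow> real^3 \<Rightarrow> real^3 \<Rightarrow> real" where
  "residual_d2 \<kappa> V z v = - 2 * (inner (orth_proj V (wave 2 \<kappa> v z)) (wave 0 \<kappa> v z)
     + inner (orth_proj V (wave 1 \<kappa> v z)) (wave 1 \<kappa> v z))"

lemma continuous_plane_wave:
  assumes "\<kappa> > 0"
  shows "continuous_on UNIV (plane_wave \<kappa>)"
proof (rule lipschitz_on_continuous_on)
  show "(\<kappa> / sqrt 3)-lipschitz_on UNIV (plane_wave \<kappa>)"
    using norm_plane_wave_diff_le[OF assms] assms by (intro lipschitz_onI) (auto simp: dist_norm)
qed

lemma residual_eq:
  assumes "projectable V"
  shows "residual \<kappa> V z = 1 - inner (orth_proj V (plane_wave \<kappa> z)) (plane_wave \<kappa> z)"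
proof -
  interpret projectable V by (rule assms)
  show ?thesis
    unfolding residual_def using norm_proj_pythagoras[of "plane_wave \<kappa> z"] norm_proj_eq_inner[of "plane_wave \<kappa> z"]
    by simp
qed

text \<open>The residual is 1 minus the quadratic form of the projector at the plane wave. The
  product rule gives two terms, which agree in the first derivative because the projector is
  self-adjoint.\<close>

lemma line_smooth_residual:
  assumes "projectable V" and \<kappa>: "\<kappa> > 0"
  shows "line_smooth (residual \<kappa> V) (residual_d1 \<kappa> V) (residual_d2 \<kappa> V)"
proof
  interpret projectable V by (rule assms)
  note eq = residual_eq[OF assms(1)]
  have inner_der: "((\<lambda>t. inner (orth_proj V (f t)) (g t)) has_real_derivative
      inner (orth_proj V (f t)) g' + inner (orth_proj V f') (g t)) (at t)"
    if "(f has_vector_derivative f') (at t)" "(g has_vector_derivative g') (at t)" for f g f' g' t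
  proof -
    have "((\<lambda>t. orth_proj V (f t)) has_vector_derivative orth_proj V f') (at t)"
      by (rule bounded_linear.has_vector_derivative[OF bounded_linear_proj that(1)])
    from bounded_bilinear.has_vector_derivative[OF bounded_bilinear_inner this that(2)]
    show ?thesis by (simp add: has_real_derivative_iff_has_vector_derivative)
  qed
  fix z v :: "real^3" and t :: real
  assume v: "norm v = 1"
  let ?w = "\<lambda>n t. wave n \<kappa> v (z + t *\<^sub>R v)"
  have w0: "((?w 0) has_vector_derivative ?w 1 t) (at t)" for t
    using wave_has_vector_derivative[OF v, of 0 \<kappa> z t] by simp
  have w1: "((?w 1) has_vector_derivative ?w 2 t) (at t)" for t
    using wave_has_vector_derivative[OF v, of 1 \<kappa> z t] by (simp add: numeral_2_eq_2)
  have sym: "inner (orth_proj V (?w 0 t)) (?w 1 t) = inner (orth_proj V (?w 1 t)) (?w 0 t)" for t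
    using inner_proj_self_adjoint[of "?w 0 t" "?w 1 t"] by (simp add: inner_commute)
  show "((\<lambda>t. residual \<kappa> V (z + t *\<^sub>R v)) has_real_derivative residual_d1 \<kappa> V (z + t *\<^sub>R v) v) (at t)"
    unfolding eq plane_wave_eq_wave[of \<kappa> _ v] residual_d1_def
    by (rule DERIV_cong[OF DERIV_diff[OF DERIV_const inner_der[OF w0 w0]]]) (simp add: sym del: One_nat_def)
  show "((\<lambda>t. residual_d1 \<kappa> V (z + t *\<^sub>R v) v) has_real_derivative residual_d2 \<kappa> V (z + t *\<^sub>R v) v) (at t)"
    unfolding residual_d1_def residual_d2_def
    by (rule DERIV_cong[OF DERIV_cmult[OF inner_der[OF w1 w0]]]) simp
next
  interpret projectable V by (rule assms)
  show "continuous_on UNIV (residual \<kappa> V)"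
    unfolding residual_def
    by (intro continuous_intros bounded_linear.continuous_on[OF bounded_linear_proj] continuous_plane_wave \<kappa>)
qed

section \<open>The residual near and away from a configuration\<close>

text \<open>Addition of angles: \<open>\<phi>\<close> makes an angle of at most arcsin e with
  \<open>V\<close>, vectors of \<open>V\<close> make at most that angle with \<open>W\<close>, and
  cos (2 arcsin e) is \<open>1 - 2 * e^2\<close>.\<close>

lemma norm_proj_ge_of_small_residual:
  assumes "projectable V" "projectable W" and \<phi>: "norm \<phi> = 1" and e: "0 \<le> e" "e < 1"
    and near: "\<And>f. norm (orth_proj V f - orth_proj W f) \<le> e * norm f"
    and small: "norm (\<phi> - orth_proj V \<phi>) \<le> e"
  shows "1 - 2 * e\<^sup>2 \<le> norm (orth_proj W \<phi>)"
proof -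
  interpret V: projectable V by (rule assms)
  interpret W: projectable W by (rule assms)
  define b r c where "b = orth_proj V \<phi>" and "r = \<phi> - b" and "c = orth_proj W b"
  have e2: "e\<^sup>2 < 1" using e by (simp add: abs_square_less_1)
  have bsq: "1 - e\<^sup>2 \<le> (norm b)\<^sup>2"
    using V.norm_proj_pythagoras[of \<phi>] power_mono[OF small norm_ge_zero, of 2] \<phi>
    unfolding b_def[symmetric] by simp
  have rb: "inner r b = 0" unfolding r_def b_def by (rule V.inner_proj_orth[OF V.proj_in])
  have "norm (b - c) \<le> e * norm b"
    using near[of b] V.proj_of_mem[of b] V.proj_in[of \<phi>] by (simp add: c_def b_def)
  then have "(norm (b - c))\<^sup>2 \<le> e\<^sup>2 * (norm b)\<^sup>2"
    using power_mono[of "norm (b - c)" "e * norm b" 2] by (simp add: power_mult_distrib)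
  then have csq: "(1 - e\<^sup>2) * (norm b)\<^sup>2 \<le> (norm c)\<^sup>2"
    using W.norm_proj_pythagoras[of b] unfolding c_def[symmetric] by (simp add: algebra_simps)
  have cb: "inner b c = (norm c)\<^sup>2"
    using W.norm_proj_eq_inner[of b] by (simp add: c_def inner_commute)
  have bpos: "(norm b)\<^sup>2 > 0" using bsq e2 by linarith
  have "(1 - e\<^sup>2) * (1 - e\<^sup>2) \<le> (1 - e\<^sup>2) * (norm b)\<^sup>2"
    using bsq e2 by (intro mult_left_mono) auto
  then have "(1 - e\<^sup>2)\<^sup>2 \<le> (norm c)\<^sup>2" using csq by (simp add: power2_eq_square)
  then have cn: "1 - e\<^sup>2 \<le> norm c" by (rule power2_le_imp_le) simp
  then have cpos: "norm c > 0" using e2 by linarith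
  \<comment> \<open>\<open>k *\<^sub>R b\<close> is the component of \<open>c\<close> along
    \<open>b\<close>, and \<open>c'\<close> the orthogonal rest. Since \<open>r\<close> is
    orthogonal to \<open>b\<close>, only \<open>c'\<close> pairs with \<open>r\<close>, and both
    have a factor \<open>e\<close>; this is how \<open>e^2\<close> rather than \<open>e\<close> is
    lost.\<close>
  define k where "k = (norm c)\<^sup>2 / (norm b)\<^sup>2"
  define c' where "c' = c - k *\<^sub>R b"
  have k: "1 - e\<^sup>2 \<le> k" using csq bpos by (simp add: k_def pos_le_divide_eq)
  have kb: "k * (norm b)\<^sup>2 = (norm c)\<^sup>2" using bpos by (simp add: k_def)
  have "(norm c')\<^sup>2 = (norm c)\<^sup>2 - 2 * k * inner b c + k * (k * (norm b)\<^sup>2)"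
    unfolding c'_def power2_norm_eq_inner
    by (simp add: inner_diff_left inner_diff_right inner_commute)
  also have "\<dots> = (1 - k) * (norm c)\<^sup>2" unfolding kb cb by (simp add: algebra_simps)
  also have "\<dots> \<le> e\<^sup>2 * (norm c)\<^sup>2" using k by (intro mult_right_mono) auto
  also have "\<dots> = (e * norm c)\<^sup>2" by (simp add: power_mult_distrib)
  finally have c': "norm c' \<le> e * norm c" by (rule power2_le_imp_le) (simp add: e)
  have "\<bar>inner r c'\<bar> \<le> norm r * norm c'" by (rule Cauchy_Schwarz_ineq2)
  also have "\<dots> \<le> e * (e * norm c)"
    using small c' e by (intro mult_mono) (auto simp: r_def b_def)
  finally have "- (e\<^sup>2 * norm c) \<le> inner r c'" by (simp add: power2_eq_square abs_le_iff mult.assoc)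
  also have "inner r c' = inner r c" by (simp add: c'_def inner_diff_right rb)
  finally have rc: "- (e\<^sup>2 * norm c) \<le> inner r c" .
  have "(1 - e\<^sup>2) * norm c \<le> norm c * norm c" using cn by (intro mult_right_mono) auto
  then have "(1 - 2 * e\<^sup>2) * norm c \<le> inner b c + inner r c"
    using rc unfolding cb by (simp add: power2_eq_square algebra_simps)
  also have "\<dots> = inner \<phi> c" by (simp add: r_def inner_diff_left)
  also have "\<dots> = inner (orth_proj W \<phi>) c"
    using W.inner_proj[of c \<phi>] W.proj_in[of b] by (simp add: c_def)
  also have "\<dots> \<le> norm (orth_proj W \<phi>) * norm c" by (rule norm_cauchy_schwarz)
  finally show ?thesis using cpos by (simp add: mult_le_cancel_right_pos)
qed

section \<open>The constants governing the gap away from the nodes\<close>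

lemma b_gam_sup:
  assumes "\<gamma> > 0" "\<gamma> \<le> t"
  shows "(sin t / t)\<^sup>2 \<le> 1 - b_gam \<gamma>"
proof -
  have "bdd_above ((\<lambda>t. (sin t / t)\<^sup>2) ` {\<gamma>..})"
  proof (rule bdd_aboveI2[where M = 1])
    fix t :: real assume "t \<in> {\<gamma>..}"
    then have "\<bar>sin t / t\<bar> \<le> 1" using assms(1) abs_sin_x_le_abs_x[of t] by simp
    then show "(sin t / t)\<^sup>2 \<le> 1" by (simp add: abs_square_le_1)
  qed
  then show ?thesis
    unfolding b_gam_def using assms by (auto intro: cSUP_upper)
qed

lemma nu_bar_nonneg: "0 \<le> nu_bar s \<mu>"
  by (simp add: nu_bar_def)

lemma A_star_le_1:
  assumes "\<gamma> > 0" "0 \<le> \<mu>" "\<mu> < 1"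
  shows "A_star s \<gamma> \<mu> \<le> 1"
proof -
  have "b_gam \<gamma> \<le> 1" using b_gam_sup[OF assms(1), of \<gamma>] zero_le_power2[of "sin \<gamma> / \<gamma>"] by linarith
  then show ?thesis using assms nu_bar_nonneg[of s \<mu>] by (simp add: A_star_def)
qed

text \<open>By the half-angle formula, \<open>\<eta> < eta_gap\<close> says exactly that cos (2
  arcsin \<open>\<eta>\<close>) exceeds \<open>sqrt (1 - A_star)\<close>, the largest cosine
  possible far from the nodes.\<close>

lemma eta_gap_bounds:
  assumes A: "0 < A_star s \<gamma> \<mu>" "A_star s \<gamma> \<mu> \<le> 1" and \<eta>: "0 \<le> \<eta>" "\<eta> < eta_gap s \<gamma> \<mu>"
  shows "\<eta> < 1" and "1 - A_star s \<gamma> \<mu> < (1 - 2 * \<eta>\<^sup>2)\<^sup>2" and "0 < 1 - 2 * \<eta>\<^sup>2"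
proof -
  let ?A = "A_star s \<gamma> \<mu>" and ?\<alpha> = "arcsin (sqrt (A_star s \<gamma> \<mu>))"
  have sA: "sqrt ?A \<le> 1" "- 1 \<le> sqrt ?A" using A order_trans[of "-1" 0 "sqrt ?A"] by auto
  show "\<eta> < 1" using \<eta> sin_le_one[of "1 / 2 * ?\<alpha>"] unfolding eta_gap_def by linarith
  have "\<eta>\<^sup>2 < (sin (1 / 2 * ?\<alpha>))\<^sup>2"
    using \<eta> unfolding eta_gap_def by (intro power_strict_mono) auto
  also have "2 * (sin (1 / 2 * ?\<alpha>))\<^sup>2 = 1 - cos ?\<alpha>"
    using cos_double_sin[of "1 / 2 * ?\<alpha>"] by simp
  then have "(sin (1 / 2 * ?\<alpha>))\<^sup>2 = (1 - sqrt (1 - ?A)) / 2"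
    using cos_arcsin[OF sA(2,1)] A by simp
  finally have lt: "sqrt (1 - ?A) < 1 - 2 * \<eta>\<^sup>2" by simp
  moreover have "0 \<le> sqrt (1 - ?A)" using A by simp
  ultimately show pos: "0 < 1 - 2 * \<eta>\<^sup>2" by linarith
  have "(sqrt (1 - ?A))\<^sup>2 < (1 - 2 * \<eta>\<^sup>2)\<^sup>2"
    by (rule power_strict_mono[OF lt]) (use A in auto)
  then show "1 - ?A < (1 - 2 * \<eta>\<^sup>2)\<^sup>2" using A by simp
qed

locale uniform_config =
  fixes s :: nat and \<kappa> \<gamma> \<mu> :: real and X :: "(real^3) set"
  assumes s: "2 \<le> s" and \<kappa>: "0 < \<kappa>" and \<gamma>: "0 < \<gamma>" and \<mu>: "0 \<le> \<mu>" "\<mu> < 1"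
    and X: "X \<in> uniform_class s \<kappa> \<gamma> \<mu>"
begin

lemma finite_X: "finite X" and card_X: "card X = s"
  and cball_subset: "x \<in> X \<Longrightarrow> cball x (\<gamma> / \<kappa>) \<subseteq> ball 0 1"
  and rho_le: "\<gamma> / \<kappa> \<le> min_sep X / 2" and mu_le: "mu \<kappa> X \<le> \<mu>"
  using X by (auto simp: uniform_class_def point_sets_def)

lemma X_nonempty: "X \<noteq> {}"
  using card_X s by auto

lemma sep_pos: "0 < min_sep X"
  by (rule min_sep_pos) (use finite_X card_X s in auto)

lemma sep_le: "x \<in> X \<Longrightarrow> y \<in> X \<Longrightarrow> x \<noteq> y \<Longrightarrow> min_sep X \<le> dist x y"
  by (rule min_sep_le_dist[OF finite_X])

lemma nu_sum_le:
  assumes Y: "Y \<subseteq> X" and far: "\<And>y. y \<in> Y \<Longrightarrow> min_sep X / 2 \<le> dist z y"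
  shows "(\<Sum>y\<in>Y. (c_nu / (\<kappa> * dist z y))\<^sup>2) \<le> nu_bar s \<mu>"
proof -
  have mu_nonneg: "0 \<le> mu \<kappa> X" using \<kappa> sep_pos by (simp add: mu_def)
  have "(\<Sum>y\<in>Y. (c_nu / (\<kappa> * dist z y))\<^sup>2) = c_nu\<^sup>2 * (\<Sum>y\<in>Y. 1 / (\<kappa> * dist z y)\<^sup>2)"
    by (simp add: sum_distrib_left power_divide)
  also have "\<dots> \<le> c_nu\<^sup>2 * (64 / 27 * ((mu \<kappa> X)\<^sup>2 / card X))"
    by (intro mult_left_mono sum_inverse_dist_sq_le_mu Y far) (use finite_X card_X s \<kappa> in auto)
  also have "\<dots> \<le> c_nu\<^sup>2 * (64 / 27 * (\<mu>\<^sup>2 / card X))"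
    using mu_le mu_nonneg by (intro mult_left_mono divide_right_mono power_mono) auto
  finally show ?thesis by (simp add: nu_bar_def card_X mult_ac)
qed

text \<open>The off-diagonal Gram entries are sinc values, at most
  \<open>1 / (\<kappa> * dist x y)\<close>, and \<open>mu\<close> is the packing bound for their row
  sums.\<close>

sublocale frame: nearly_orthonormal X "plane_wave \<kappa>" \<mu>
proof
  show "finite X" by (rule finite_X)
  show "norm (plane_wave \<kappa> x) = 1" for x by simp
  show "0 \<le> \<mu>" "\<mu> < 1" by (rule \<mu>)+
  fix x assume x: "x \<in> X"
  have "(\<Sum>y\<in>X - {x}. cmod (cinner (plane_wave \<kappa> x) (plane_wave \<kappa> y))) \<le> (\<Sum>y\<in>X - {x}. 1 / (\<kappa> * dist x y))"
  proof (rule sum_mono)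
    fix y assume "y \<in> X - {x}"
    then have "\<kappa> *\<^sub>R (x - y) \<noteq> 0" using \<kappa> by auto
    from abs_kern0_le[OF this] show "cmod (cinner (plane_wave \<kappa> x) (plane_wave \<kappa> y)) \<le> 1 / (\<kappa> * dist x y)"
      using \<kappa> by (simp add: cinner_plane_wave dist_norm)
  qed
  also have "\<dots> \<le> mu \<kappa> X"
    by (rule sum_inverse_dist_le_mu) (use finite_X card_X s \<kappa> x in auto)
  finally show "(\<Sum>y\<in>X - {x}. cmod (cinner (plane_wave \<kappa> x) (plane_wave \<kappa> y))) \<le> \<mu>"
    using mu_le by simp
qed

lemma signal_space_eq: "cL2.span (plane_wave \<kappa> ` X) = signal_space \<kappa> X"
  by (simp add: signal_space_def)

lemmas projectable_signal = frame.projectable[unfolded signal_space_eq]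

lemma far_kernel_sums:
  assumes Y: "Y \<subseteq> X" and far: "\<And>y. y \<in> Y \<Longrightarrow> min_sep X / 2 \<le> dist z y"
  shows "(\<Sum>y\<in>Y. (kern0 (\<kappa> *\<^sub>R (z - y)))\<^sup>2) \<le> nu_bar s \<mu>"
    and "norm v = 1 \<Longrightarrow> (\<Sum>y\<in>Y. (kern1 v (\<kappa> *\<^sub>R (z - y)))\<^sup>2) \<le> nu_bar s \<mu>"
    and "norm v = 1 \<Longrightarrow> (\<Sum>y\<in>Y. (kern2 v (\<kappa> *\<^sub>R (z - y)))\<^sup>2) \<le> 4 * nu_bar s \<mu>"
proof -
  have ne: "\<kappa> *\<^sub>R (z - y) \<noteq> 0" and nrm: "norm (\<kappa> *\<^sub>R (z - y)) = \<kappa> * dist z y" if "y \<in> Y" for y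
    using far[OF that] sep_pos \<kappa> by (auto simp: dist_norm)
  note nu = nu_sum_le[OF Y far]
  have "(\<Sum>y\<in>Y. (kern0 (\<kappa> *\<^sub>R (z - y)))\<^sup>2) \<le> (\<Sum>y\<in>Y. (c_nu / (\<kappa> * dist z y))\<^sup>2)"
  proof (rule sum_mono)
    fix y assume y: "y \<in> Y"
    have "\<bar>kern0 (\<kappa> *\<^sub>R (z - y))\<bar> \<le> 1 / (\<kappa> * dist z y)"
      using abs_kern0_le[OF ne[OF y]] by (simp only: nrm[OF y])
    also have "\<dots> \<le> c_nu / (\<kappa> * dist z y)"
      using one_le_c_nu \<kappa> by (intro divide_right_mono) auto
    finally show "(kern0 (\<kappa> *\<^sub>R (z - y)))\<^sup>2 \<le> (c_nu / (\<kappa> * dist z y))\<^sup>2"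
      by (rule abs_le_square_iff[THEN iffD1, OF order_trans[OF _ abs_ge_self]])
  qed
  then show "(\<Sum>y\<in>Y. (kern0 (\<kappa> *\<^sub>R (z - y)))\<^sup>2) \<le> nu_bar s \<mu>" using nu by simp
  assume v: "norm v = 1"
  have "(\<Sum>y\<in>Y. (kern1 v (\<kappa> *\<^sub>R (z - y)))\<^sup>2) \<le> (\<Sum>y\<in>Y. (c_nu / (\<kappa> * dist z y))\<^sup>2)"
  proof (rule sum_mono)
    fix y assume y: "y \<in> Y"
    have "\<bar>kern1 v (\<kappa> *\<^sub>R (z - y))\<bar> \<le> c_nu / (\<kappa> * dist z y)"
      using abs_kern1_le_c_nu[OF v ne[OF y]] by (simp only: nrm[OF y])
    then show "(kern1 v (\<kappa> *\<^sub>R (z - y)))\<^sup>2 \<le> (c_nu / (\<kappa> * dist z y))\<^sup>2"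
      by (rule abs_le_square_iff[THEN iffD1, OF order_trans[OF _ abs_ge_self]])
  qed
  then show "(\<Sum>y\<in>Y. (kern1 v (\<kappa> *\<^sub>R (z - y)))\<^sup>2) \<le> nu_bar s \<mu>" using nu by simp
  have "(\<Sum>y\<in>Y. (kern2 v (\<kappa> *\<^sub>R (z - y)))\<^sup>2) \<le> (\<Sum>y\<in>Y. 4 * (c_nu / (\<kappa> * dist z y))\<^sup>2)"
  proof (rule sum_mono)
    fix y assume y: "y \<in> Y"
    have "\<bar>kern2 v (\<kappa> *\<^sub>R (z - y))\<bar> \<le> 2 * (c_nu / (\<kappa> * dist z y))"
      using abs_kern2_le_c_nu[OF v ne[OF y]] unfolding nrm[OF y] by simp
    then have "(kern2 v (\<kappa> *\<^sub>R (z - y)))\<^sup>2 \<le> (2 * (c_nu / (\<kappa> * dist z y)))\<^sup>2"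
      by (rule abs_le_square_iff[THEN iffD1, OF order_trans[OF _ abs_ge_self]])
    then show "(kern2 v (\<kappa> *\<^sub>R (z - y)))\<^sup>2 \<le> 4 * (c_nu / (\<kappa> * dist z y))\<^sup>2"
      by (simp only: power_mult_distrib) simp
  qed
  then show "(\<Sum>y\<in>Y. (kern2 v (\<kappa> *\<^sub>R (z - y)))\<^sup>2) \<le> 4 * nu_bar s \<mu>"
    using nu by (simp add: sum_distrib_left[symmetric])
qed

lemma far_from_others:
  assumes "x \<in> X" "dist z x \<le> min_sep X / 2" "y \<in> X - {x}"
  shows "min_sep X / 2 \<le> dist z y"
proof -
  have "min_sep X \<le> dist x y" using assms by (intro sep_le) auto
  then show ?thesis using dist_triangle[of x y z] assms(2) by (simp add: dist_commute)
qed

lemma energy_wave: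
  "frame.energy (wave 0 \<kappa> v z) = (\<Sum>y\<in>X. (kern0 (\<kappa> *\<^sub>R (z - y)))\<^sup>2)"
  "frame.energy (wave 1 \<kappa> v z) = \<kappa>\<^sup>2 * (\<Sum>y\<in>X. (kern1 v (\<kappa> *\<^sub>R (z - y)))\<^sup>2)"
  "frame.energy (wave 2 \<kappa> v z) = \<kappa> ^ 4 * (\<Sum>y\<in>X. (kern2 v (\<kappa> *\<^sub>R (z - y)))\<^sup>2)"
  unfolding frame.energy_def cinner_wave norm_of_real
  by (simp_all add: power_mult_distrib sum_distrib_left flip: power_mult)

text \<open>Of the energy of the wave, the nearest node contributes at most
  \<open>1 - b_gam \<gamma>\<close> and all others together at most \<open>nu_bar\<close>; dividing
  by \<open>1 - \<mu>\<close> gives \<open>1 - A_star\<close>.\<close>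

lemma residual_signal_far:
  assumes far: "\<And>x. x \<in> X \<Longrightarrow> \<gamma> / \<kappa> \<le> dist z x"
  shows "(norm (orth_proj (signal_space \<kappa> X) (plane_wave \<kappa> z)))\<^sup>2 \<le> 1 - A_star s \<gamma> \<mu>"
proof -
  \<comment> \<open>At most one node needs to be singled out: once some node is within half the
    separation, all others are at least that far away. If there is none, any node serves.\<close>
  obtain x where x: "x \<in> X" and others: "\<And>y. y \<in> X - {x} \<Longrightarrow> min_sep X / 2 \<le> dist z y"
  proof (cases "\<exists>x\<in>X. dist z x \<le> min_sep X / 2")
    case True
    then show thesis using that far_from_others by blast
  next
    case False
    then show thesis using that X_nonempty by (meson DiffE equals0I less_imp_le not_le)
  qed
  have "\<kappa> *\<^sub>R (z - x) \<noteq> 0" using far[OF x] \<gamma> \<kappa> by (auto simp: field_simps)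
  then have "kern0 (\<kappa> *\<^sub>R (z - x)) = sin (\<kappa> * dist z x) / (\<kappa> * dist z x)"
    using kern0_eq_sinc \<kappa> by (simp add: dist_norm)
  moreover have "\<gamma> \<le> \<kappa> * dist z x" using far[OF x] \<kappa> by (simp add: field_simps)
  ultimately have near: "(kern0 (\<kappa> *\<^sub>R (z - x)))\<^sup>2 \<le> 1 - b_gam \<gamma>"
    using b_gam_sup[OF \<gamma>] by metis
  have "(1 - \<mu>) * (norm (orth_proj (signal_space \<kappa> X) (plane_wave \<kappa> z)))\<^sup>2 \<le> frame.energy (wave 0 \<kappa> 0 z)"
    using frame.norm_proj_le_energy[of "plane_wave \<kappa> z"]
    unfolding signal_space_eq by (simp only: plane_wave_eq_wave[of \<kappa> z 0])
  also have "\<dots> = (kern0 (\<kappa> *\<^sub>R (z - x)))\<^sup>2 + (\<Sum>y\<in>X - {x}. (kern0 (\<kappa> *\<^sub>R (z - y)))\<^sup>2)"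
    unfolding energy_wave by (rule sum.remove[OF finite_X x])
  also have "\<dots> \<le> (1 - b_gam \<gamma>) + nu_bar s \<mu>"
    by (intro add_mono near far_kernel_sums(1) others) auto
  finally show ?thesis
    using \<mu> by (simp add: A_star_def field_simps)
qed

text \<open>With residual at most \<open>\<eta>^2\<close>, the two angles would keep the projection
  of the wave onto the signal space longer than \<open>residual_signal_far\<close> allows.\<close>

lemma residual_gt:
  assumes A: "0 < A_star s \<gamma> \<mu>" and V: "V \<in> Gr s" and \<eta>: "0 \<le> \<eta>" "\<eta> < eta_gap s \<gamma> \<mu>"
    and near: "proj_dist V (signal_space \<kappa> X) \<le> \<eta>"
    and far: "\<And>x. x \<in> X \<Longrightarrow> \<gamma> / \<kappa> \<le> dist z x"
  shows "\<eta>\<^sup>2 < residual \<kappa> V z"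
proof (rule ccontr)
  assume "\<not> \<eta>\<^sup>2 < residual \<kappa> V z"
  then have small: "norm (plane_wave \<kappa> z - orth_proj V (plane_wave \<kappa> z)) \<le> \<eta>"
    unfolding residual_def not_less by (rule power2_le_imp_le) (rule \<eta>)
  note gap = eta_gap_bounds[OF A A_star_le_1[OF \<gamma> \<mu>] \<eta>]
  have "1 - 2 * \<eta>\<^sup>2 \<le> norm (orth_proj (signal_space \<kappa> X) (plane_wave \<kappa> z))"
  proof (rule norm_proj_ge_of_small_residual[OF projectable_Gr[OF V] projectable_signal])
    show "norm (orth_proj V f - orth_proj (signal_space \<kappa> X) f) \<le> \<eta> * norm f" for f
      using norm_proj_diff_le[OF projectable_Gr[OF V] projectable_signal, of f]
        mult_right_mono[OF near norm_ge_zero[of f]] by linarith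
  qed (fact | use gap \<eta> in simp)+
  then have "(1 - 2 * \<eta>\<^sup>2)\<^sup>2 \<le> (norm (orth_proj (signal_space \<kappa> X) (plane_wave \<kappa> z)))\<^sup>2"
    using gap by (intro power_mono) auto
  also have "\<dots> \<le> 1 - A_star s \<gamma> \<mu>" by (rule residual_signal_far[OF far])
  finally show False using gap by linarith
qed

lemma C1_nonneg: "0 \<le> C1 s \<gamma> \<mu>"
  using nu_bar_nonneg[of s \<mu>] by (simp add: C1_def)

text \<open>Keeps the lower bounds \<open>1 - t^2 / 6\<close> and \<open>1 / 3 - t^2 / 10\<close>
  positive for \<open>t \<le> \<gamma>\<close>, so that they may be multiplied.\<close>

lemma gamma_sq_lt:
  assumes "C2 s \<gamma> \<mu> < 2 / 3"
  shows "\<gamma>\<^sup>2 < 5 / 4"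
proof -
  have "0 \<le> 2 * \<mu> / (1 - \<mu>) * C1 s \<gamma> \<mu>" using C1_nonneg \<mu> by simp
  then show ?thesis using assms nu_bar_nonneg[of s \<mu>] by (simp add: C2_def)
qed

text \<open>Half the negative Hessian is a sum of two projected inner products.
  \<open>inner_proj_approx\<close> replaces each by a sum over the nodes, at a total cost of
  \<open>\<mu> / (1 - \<mu>)\<close> times \<open>\<kappa>^2 * C1\<close>; \<open>C1\<close> is the
  energy bound for the pairs of first derivatives and of second derivative with wave.
  \<open>C2\<close> is twice the loss in the main term plus twice this error.\<close>

lemma residual_d2_signal_ge:
  assumes C2: "C2 s \<gamma> \<mu> < 2 / 3" and x: "x \<in> X" and z: "z \<in> cball x (\<gamma> / \<kappa>)" and v: "norm v = 1"
  shows "\<kappa>\<^sup>2 * (2 / 3 - C2 s \<gamma> \<mu>) \<le> residual_d2 \<kappa> (signal_space \<kappa> X) z v"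
proof -
  let ?\<nu> = "nu_bar s \<mu>"
  define k0 k1 k2 where "k0 = (\<lambda>y. kern0 (\<kappa> *\<^sub>R (z - y)))" and "k1 = (\<lambda>y. kern1 v (\<kappa> *\<^sub>R (z - y)))"
    and "k2 = (\<lambda>y. kern2 v (\<kappa> *\<^sub>R (z - y)))"
  define t where "t = \<kappa> * dist z x"
  have t: "0 \<le> t" "t \<le> \<gamma>" and nt: "norm (\<kappa> *\<^sub>R (z - x)) = t"
    using z \<kappa> by (auto simp: t_def dist_commute field_simps) (simp add: dist_norm norm_minus_commute scaleR_diff_right[symmetric])
  have tsq: "t\<^sup>2 \<le> \<gamma>\<^sup>2" using t by (intro power_mono)
  have dzx: "dist z x \<le> min_sep X / 2" using z rho_le unfolding mem_cball dist_commute[of x z] by linarith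
  note far = far_from_others[OF x dzx]
  have s0: "(\<Sum>y\<in>X - {x}. (k0 y)\<^sup>2) \<le> ?\<nu>" and s1: "(\<Sum>y\<in>X - {x}. (k1 y)\<^sup>2) \<le> ?\<nu>"
    and s2: "(\<Sum>y\<in>X - {x}. (k2 y)\<^sup>2) \<le> 4 * ?\<nu>"
    unfolding k0_def k1_def k2_def
    by (intro far_kernel_sums far v; auto)+
  have n0: "\<bar>k0 x\<bar> \<le> 1" "1 - t\<^sup>2 / 6 \<le> k0 x" and n1: "\<bar>k1 x\<bar> \<le> t / 3"
    and n2: "\<bar>k2 x\<bar> \<le> 1 / 3" "1 / 3 - t\<^sup>2 / 10 \<le> k2 x"
    using abs_kern0_le_1[of "\<kappa> *\<^sub>R (z - x)"] kern0_ge[of "\<kappa> *\<^sub>R (z - x)"] abs_kern1_le[OF v, of "\<kappa> *\<^sub>R (z - x)"]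
      abs_kern2_le[OF v, of "\<kappa> *\<^sub>R (z - x)"] kern2_ge[OF v, of "\<kappa> *\<^sub>R (z - x)"]
    unfolding nt by (simp_all add: k0_def k1_def k2_def)
  have n1sq: "(k1 x)\<^sup>2 \<le> t\<^sup>2 / 9"
    using power_mono[OF n1 abs_ge_zero, of 2] by (simp add: power_divide)
  have e0: "frame.energy (wave 0 \<kappa> v z) \<le> 1 + ?\<nu>"
    unfolding energy_wave k0_def[symmetric] sum.remove[OF finite_X x]
    using s0 n0(1) abs_square_le_1[of "k0 x"] by (simp add: k0_def)
  have e1: "frame.energy (wave 1 \<kappa> v z) \<le> \<kappa>\<^sup>2 * (\<gamma>\<^sup>2 / 9 + ?\<nu>)"
    unfolding energy_wave sum.remove[OF finite_X x]
    using s1 n1sq tsq by (intro mult_left_mono) (auto simp: k1_def)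
  have e2: "frame.energy (wave 2 \<kappa> v z) \<le> \<kappa> ^ 4 * ((1 / 3 + \<gamma>\<^sup>2 / 10)\<^sup>2 + 4 * ?\<nu>)"
    unfolding energy_wave sum.remove[OF finite_X x]
  proof (intro mult_left_mono add_mono)
    have "\<bar>k2 x\<bar> \<le> \<bar>1 / 3 + \<gamma>\<^sup>2 / 10\<bar>" using n2(1) zero_le_power2[of \<gamma>] by linarith
    then show "(kern2 v (\<kappa> *\<^sub>R (z - x)))\<^sup>2 \<le> (1 / 3 + \<gamma>\<^sup>2 / 10)\<^sup>2"
      by (simp only: abs_le_square_iff k2_def)
    show "(\<Sum>y\<in>X - {x}. (kern2 v (\<kappa> *\<^sub>R (z - y)))\<^sup>2) \<le> 4 * ?\<nu>" using s2 by (simp add: k2_def)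
  qed simp
  have "sqrt (frame.energy (wave 2 \<kappa> v z)) * sqrt (frame.energy (wave 0 \<kappa> v z))
      \<le> sqrt (\<kappa> ^ 4 * ((1 / 3 + \<gamma>\<^sup>2 / 10)\<^sup>2 + 4 * ?\<nu>)) * sqrt (1 + ?\<nu>)"
    by (intro mult_mono real_sqrt_le_mono e0 e2) (auto simp: frame.energy_nonneg nu_bar_nonneg)
  also have "\<dots> = \<kappa>\<^sup>2 * (sqrt (1 + ?\<nu>) * sqrt ((1 / 3 + \<gamma>\<^sup>2 / 10)\<^sup>2 + 4 * ?\<nu>))"
  proof -
    have "sqrt (\<kappa> ^ 4) = \<kappa>\<^sup>2"
      using real_sqrt_unique[of "\<kappa>\<^sup>2" "\<kappa> ^ 4"] by simp
    then show ?thesis by (simp add: real_sqrt_mult)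
  qed
  finally have err: "sqrt (frame.energy (wave 2 \<kappa> v z)) * sqrt (frame.energy (wave 0 \<kappa> v z))
      + sqrt (frame.energy (wave 1 \<kappa> v z)) * sqrt (frame.energy (wave 1 \<kappa> v z)) \<le> \<kappa>\<^sup>2 * C1 s \<gamma> \<mu>"
    using e1 frame.energy_nonneg[of "wave 1 \<kappa> v z"] by (simp add: C1_def algebra_simps)
  \<comment> \<open>The node \<open>x\<close> gives -1/3 plus (1/9 + 1/10 + 1/18) = 4/15 times
    \<open>\<gamma>^2\<close>. Each other node is bounded by squares, with weight 1/4 on
    \<open>(k2 y)^2\<close> since those sum to \<open>4 * ?\<nu>\<close>; the three square sums then
    contribute \<open>?\<nu>\<close> each.\<close>
  have main: "(\<Sum>y\<in>X. (k1 y)\<^sup>2 - k2 y * k0 y) \<le> - 1 / 3 + 4 / 15 * \<gamma>\<^sup>2 + 3 * ?\<nu>"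
  proof -
    have "(1 / 3 - t\<^sup>2 / 10) * (1 - t\<^sup>2 / 6) \<le> k2 x * k0 x"
      using n0 n2 tsq gamma_sq_lt[OF C2] by (intro mult_mono) auto
    moreover have "1 / 3 - t\<^sup>2 / 10 - t\<^sup>2 / 18 \<le> (1 / 3 - t\<^sup>2 / 10) * (1 - t\<^sup>2 / 6)"
      by (simp add: algebra_simps)
    ultimately have "(k1 x)\<^sup>2 - k2 x * k0 x \<le> - 1 / 3 + 4 / 15 * \<gamma>\<^sup>2"
      using n1sq tsq by linarith
    moreover have "(\<Sum>y\<in>X - {x}. (k1 y)\<^sup>2 - k2 y * k0 y) \<le> 3 * ?\<nu>"
    proof -
      have "(\<Sum>y\<in>X - {x}. (k1 y)\<^sup>2 - k2 y * k0 y) \<le> (\<Sum>y\<in>X - {x}. (k1 y)\<^sup>2 + ((k2 y)\<^sup>2 / 4 + (k0 y)\<^sup>2))"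
      proof (rule sum_mono)
        fix y
        have "0 \<le> (k2 y / 2 + k0 y)\<^sup>2" by simp
        then show "(k1 y)\<^sup>2 - k2 y * k0 y \<le> (k1 y)\<^sup>2 + ((k2 y)\<^sup>2 / 4 + (k0 y)\<^sup>2)"
          by (simp add: power2_sum power_divide)
      qed
      also have "\<dots> = (\<Sum>y\<in>X - {x}. (k1 y)\<^sup>2) + ((\<Sum>y\<in>X - {x}. (k2 y)\<^sup>2) / 4 + (\<Sum>y\<in>X - {x}. (k0 y)\<^sup>2))"
        by (simp add: sum.distrib sum_divide_distrib)
      finally show ?thesis using s0 s1 s2 by linarith
    qed
    ultimately show ?thesis unfolding sum.remove[OF finite_X x] by linarith
  qed
  define S where "S = \<mu> / (1 - \<mu>)"
  have S: "0 \<le> S" using \<mu> by (simp add: S_def)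
  let ?P = "orth_proj (signal_space \<kappa> X)"
  have a1: "inner (?P (wave 1 \<kappa> v z)) (wave 1 \<kappa> v z) \<le> \<kappa>\<^sup>2 * (\<Sum>y\<in>X. (k1 y)\<^sup>2)
      + S * (sqrt (frame.energy (wave 1 \<kappa> v z)) * sqrt (frame.energy (wave 1 \<kappa> v z)))"
  proof -
    have "(\<Sum>y\<in>X. Re (cinner (wave 1 \<kappa> v z) (plane_wave \<kappa> y) * cnj (cinner (wave 1 \<kappa> v z) (plane_wave \<kappa> y))))
        = \<kappa>\<^sup>2 * (\<Sum>y\<in>X. (k1 y)\<^sup>2)"
      unfolding cinner_wave sum_distrib_left k1_def by (simp add: power2_eq_square mult_ac)
    then show ?thesis
      using frame.inner_proj_approx[of "wave 1 \<kappa> v z" "wave 1 \<kappa> v z"]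
      unfolding signal_space_eq S_def by linarith
  qed
  have a2: "inner (?P (wave 2 \<kappa> v z)) (wave 0 \<kappa> v z) \<le> \<kappa>\<^sup>2 * (\<Sum>y\<in>X. - (k2 y * k0 y))
      + S * (sqrt (frame.energy (wave 2 \<kappa> v z)) * sqrt (frame.energy (wave 0 \<kappa> v z)))"
  proof -
    have "(\<Sum>y\<in>X. Re (cinner (wave 2 \<kappa> v z) (plane_wave \<kappa> y) * cnj (cinner (wave 0 \<kappa> v z) (plane_wave \<kappa> y))))
        = \<kappa>\<^sup>2 * (\<Sum>y\<in>X. - (k2 y * k0 y))"
      unfolding cinner_wave sum_distrib_left k2_def k0_def by (simp add: mult_ac)
    then show ?thesis
      using frame.inner_proj_approx[of "wave 2 \<kappa> v z" "wave 0 \<kappa> v z"]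
      unfolding signal_space_eq S_def by linarith
  qed
  have "inner (?P (wave 2 \<kappa> v z)) (wave 0 \<kappa> v z) + inner (?P (wave 1 \<kappa> v z)) (wave 1 \<kappa> v z)
      \<le> \<kappa>\<^sup>2 * (\<Sum>y\<in>X. (k1 y)\<^sup>2 - k2 y * k0 y)
        + S * (sqrt (frame.energy (wave 2 \<kappa> v z)) * sqrt (frame.energy (wave 0 \<kappa> v z))
      + sqrt (frame.energy (wave 1 \<kappa> v z)) * sqrt (frame.energy (wave 1 \<kappa> v z)))"
  proof -
    have "(\<Sum>y\<in>X. (k1 y)\<^sup>2 - k2 y * k0 y) = (\<Sum>y\<in>X. (k1 y)\<^sup>2) + (\<Sum>y\<in>X. - (k2 y * k0 y))"
      by (simp add: sum.distrib[symmetric])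
    then show ?thesis using a1 a2 by (simp only: distrib_left)
  qed
  also have "\<dots> \<le> \<kappa>\<^sup>2 * (- 1 / 3 + 4 / 15 * \<gamma>\<^sup>2 + 3 * ?\<nu>) + S * (\<kappa>\<^sup>2 * C1 s \<gamma> \<mu>)"
    by (intro add_mono mult_left_mono main err S) auto
  also have "\<dots> = - (\<kappa>\<^sup>2 * (2 / 3 - C2 s \<gamma> \<mu>)) / 2"
    by (simp add: C2_def S_def algebra_simps)
  finally have bound: "inner (?P (wave 2 \<kappa> v z)) (wave 0 \<kappa> v z) + inner (?P (wave 1 \<kappa> v z)) (wave 1 \<kappa> v z)
      \<le> - (\<kappa>\<^sup>2 * (2 / 3 - C2 s \<gamma> \<mu>)) / 2" .
  have "q \<le> - 2 * p" if "p \<le> - q / 2" for p q :: real using that by simp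
  from this[OF bound] show ?thesis unfolding residual_d2_def .
qed

end

section \<open>Localization\<close>

text \<open>\<open>eta_loc\<close> is the solution of
  \<open>\<eta> = sqrt 3 / 2 * \<gamma> * c_eta\<close>. Below it the gradient bound at a node is
  less than the convexity constant times the radius, as \<open>critical_exists\<close>
  requires.\<close>

lemma c_eta_bounds:
  assumes \<kappa>: "0 < \<kappa>" and \<gamma>: "0 < \<gamma>" and \<eta>: "0 \<le> \<eta>" "\<eta> < eta_loc s \<gamma> \<mu>"
  shows "0 < c_eta s \<gamma> \<mu> \<eta>"
    and "2 * (\<eta> * (\<kappa> / sqrt 3)) < \<kappa>\<^sup>2 * c_eta s \<gamma> \<mu> \<eta> * (\<gamma> / \<kappa>)"
proof -
  define K where "K = 2 / sqrt 5 + 2 / (3::real)"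
  have K: "0 \<le> K" by (simp add: K_def)
  define b where "b = sqrt 3 / 2 * \<gamma>"
  have b: "b > 0" using \<gamma> by (simp add: b_def)
  have "0 < 1 + b * K" using b K by (simp add: add_pos_nonneg)
  moreover have "eta_loc s \<gamma> \<mu> = b * (2 / 3 - C2 s \<gamma> \<mu>) / (1 + b * K)"
    by (simp only: eta_loc_def b_def K_def)
  ultimately have "\<eta> * (1 + b * K) < b * (2 / 3 - C2 s \<gamma> \<mu>)"
    using \<eta>(2) by (simp only: pos_less_divide_eq)
  then have "\<eta> < b * (2 / 3 - C2 s \<gamma> \<mu> - K * \<eta>)" by (simp add: algebra_simps)
  then have lt: "\<eta> < b * c_eta s \<gamma> \<mu> \<eta>" by (simp only: c_eta_def K_def)
  then have "0 < b * c_eta s \<gamma> \<mu> \<eta>" using \<eta>(1) by linarith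
  then show "0 < c_eta s \<gamma> \<mu> \<eta>" using b by (simp add: zero_less_mult_iff)
  have "2 * \<kappa> / sqrt 3 * \<eta> < 2 * \<kappa> / sqrt 3 * (b * c_eta s \<gamma> \<mu> \<eta>)"
    using lt \<kappa> by (intro mult_strict_left_mono) auto
  also have "\<dots> = \<kappa>\<^sup>2 * c_eta s \<gamma> \<mu> \<eta> * (\<gamma> / \<kappa>)"
    using \<kappa> by (simp add: b_def power2_eq_square)
  finally show "2 * (\<eta> * (\<kappa> / sqrt 3)) < \<kappa>\<^sup>2 * c_eta s \<gamma> \<mu> \<eta> * (\<gamma> / \<kappa>)"
    by (simp add: mult_ac)
qed

section \<open>Bottleneck matching\<close>

lemma d_match_candidates:
  assumes "finite A" "finite B"
  shows "finite {Max ((\<lambda>x. dist x (\<pi> x)) ` A) |\<pi>. \<pi> \<in> A \<rightarrow>\<^sub>E B \<and> bij_betw \<pi> A B}"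
proof -
  have "{Max ((\<lambda>x. dist x (\<pi> x)) ` A) |\<pi>. \<pi> \<in> A \<rightarrow>\<^sub>E B \<and> bij_betw \<pi> A B}
      \<subseteq> (\<lambda>\<pi>. Max ((\<lambda>x. dist x (\<pi> x)) ` A)) ` (A \<rightarrow>\<^sub>E B)" by auto
  then show ?thesis by (rule finite_subset) (simp add: assms finite_PiE)
qed

lemma d_match_le:
  assumes fin: "finite A" "finite B" and ne: "A \<noteq> {}" and bij: "bij_betw f A B"
    and le: "\<And>a. a \<in> A \<Longrightarrow> dist a (f a) \<le> R"
  shows "d_match A B \<le> R"
proof -
  have "bij_betw (restrict f A) A B" using bij by (simp cong: bij_betw_cong)
  moreover have "restrict f A \<in> A \<rightarrow>\<^sub>E B" using bij by (auto simp: bij_betw_def)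
  ultimately have "d_match A B \<le> Max ((\<lambda>x. dist x (restrict f A x)) ` A)"
    unfolding d_match_def by (intro Min_le d_match_candidates fin) blast
  also have "\<dots> \<le> R" using fin ne le by simp
  finally show ?thesis .
qed

lemma d_match_attained:
  assumes fin: "finite A" "finite B" and card: "card A = card B"
  obtains f where "bij_betw f A B" "\<And>a. a \<in> A \<Longrightarrow> dist a (f a) \<le> d_match A B"
proof -
  obtain f where "bij_betw f A B" using finite_same_card_bij[OF fin card] by blast
  then have "bij_betw (restrict f A) A B" "restrict f A \<in> A \<rightarrow>\<^sub>E B"
    by (auto simp: bij_betw_def cong: bij_betw_cong)
  then have "{Max ((\<lambda>x. dist x (\<pi> x)) ` A) |\<pi>. \<pi> \<in> A \<rightarrow>\<^sub>E B \<and> bij_betw \<pi> A B} \<noteq> {}" by blast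
  from Min_in[OF d_match_candidates[OF fin] this] obtain \<pi>
    where \<pi>: "bij_betw \<pi> A B" and eq: "d_match A B = Max ((\<lambda>x. dist x (\<pi> x)) ` A)"
    unfolding d_match_def by blast
  show thesis by (rule that[OF \<pi>]) (simp add: eq fin)
qed

text \<open>The point of \<open>Y\<close> matched with \<open>x\<close> has a partner in
  \<open>X1\<close>, and that partner is at least \<open>t\<close> away from
  \<open>x\<close>.\<close>

lemma d_match_sum_ge:
  assumes fin: "finite Y" "finite X0" "finite X1" and card: "card Y = card X0" "card Y = card X1"
    and x: "x \<in> X0" and far: "\<And>y. y \<in> X1 \<Longrightarrow> t \<le> dist x y"
  shows "t \<le> d_match Y X0 + d_match Y X1"
proof -
  obtain f where f: "bij_betw f Y X0" "\<And>a. a \<in> Y \<Longrightarrow> dist a (f a) \<le> d_match Y X0"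
    by (rule d_match_attained[OF fin(1,2) card(1)]) blast
  obtain g where g: "bij_betw g Y X1" "\<And>a. a \<in> Y \<Longrightarrow> dist a (g a) \<le> d_match Y X1"
    by (rule d_match_attained[OF fin(1,3) card(2)]) blast
  obtain a where a: "a \<in> Y" "f a = x" using f(1) x by (auto simp: bij_betw_def)
  have "t \<le> dist x (g a)" using far g(1) a(1) by (auto simp: bij_betw_def)
  also have "\<dots> \<le> dist a (f a) + dist a (g a)" using dist_triangle3[of x "g a" a] a by simp
  finally show ?thesis using f(2)[OF a(1)] g(2)[OF a(1)] by linarith
qed

definition loc_set :: "real \<Rightarrow> real \<Rightarrow> sphere_L2 set \<Rightarrow> (real^3) set" where
  "loc_set \<kappa> \<eta> V =
     {z \<in> ball 0 1. residual \<kappa> V z \<le> \<eta>\<^sup>2 \<and> (\<forall>v. norm v = 1 \<longrightarrow> residual_d1 \<kappa> V z v = 0)}"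

section \<open>Matching the critical points of the perturbed residual with the nodes\<close>

context uniform_config
begin

context
  fixes V :: "sphere_L2 set" and \<eta> :: real
  assumes C2: "C2 s \<gamma> \<mu> < 2 / 3" and A: "0 < A_star s \<gamma> \<mu>"
    and V: "V \<in> Gr s" and \<eta>: "0 \<le> \<eta>" "\<eta> < eta_star s \<gamma> \<mu>"
    and near: "proj_dist V (signal_space \<kappa> X) \<le> \<eta>"
begin

interpretation V: projectable V by (rule projectable_Gr[OF V])
interpretation U: projectable "signal_space \<kappa> X" by (rule projectable_signal)

lemma norm_proj_diff_le_eta: "norm (orth_proj V f - orth_proj (signal_space \<kappa> X) f) \<le> \<eta> * norm f"
  using norm_proj_diff_le[OF projectable_Gr[OF V] projectable_signal, of f]
    mult_right_mono[OF near norm_ge_zero[of f]] by linarith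

text \<open>Exchanging the projectors costs \<open>\<eta>\<close> times the norms of the waves
  involved, \<open>\<kappa>^2 / sqrt 5\<close> and \<open>\<kappa>^2 / 3\<close>, doubled; this is
  the last term of \<open>c_eta\<close>.\<close>

lemma residual_d2_ge:
  assumes x: "x \<in> X" and z: "z \<in> cball x (\<gamma> / \<kappa>)" and v: "norm v = 1"
  shows "\<kappa>\<^sup>2 * c_eta s \<gamma> \<mu> \<eta> \<le> residual_d2 \<kappa> V z v"
proof -
  let ?D = "\<lambda>f. orth_proj V f - orth_proj (signal_space \<kappa> X) f"
  have le: "inner (?D f) g \<le> \<eta> * norm f * norm g" for f g
    using norm_cauchy_schwarz[of "?D f" g] mult_right_mono[OF norm_proj_diff_le_eta norm_ge_zero[of g], of f]
    by linarith
  have "residual_d2 \<kappa> V z v = residual_d2 \<kappa> (signal_space \<kappa> X) z v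
      - 2 * (inner (?D (wave 2 \<kappa> v z)) (wave 0 \<kappa> v z) + inner (?D (wave 1 \<kappa> v z)) (wave 1 \<kappa> v z))"
    by (simp add: residual_d2_def inner_diff_left)
  also have "\<dots> \<ge> \<kappa>\<^sup>2 * (2 / 3 - C2 s \<gamma> \<mu>) - 2 * (\<eta> * \<kappa>\<^sup>2 / sqrt 5 + \<eta> * \<kappa>\<^sup>2 / 3)"
  proof (intro diff_mono mult_left_mono add_mono residual_d2_signal_ge[OF C2 x z v])
    show "inner (?D (wave 2 \<kappa> v z)) (wave 0 \<kappa> v z) \<le> \<eta> * \<kappa>\<^sup>2 / sqrt 5"
      using le[of "wave 2 \<kappa> v z" "wave 0 \<kappa> v z"] by (simp add: norm_wave(1) norm_wave(3)[OF \<kappa> v])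
    show "inner (?D (wave 1 \<kappa> v z)) (wave 1 \<kappa> v z) \<le> \<eta> * \<kappa>\<^sup>2 / 3"
      using le[of "wave 1 \<kappa> v z" "wave 1 \<kappa> v z"]
      by (simp only: norm_wave(2)[OF \<kappa> v]) (simp add: power2_eq_square)
  qed simp
  also have "\<kappa>\<^sup>2 * (2 / 3 - C2 s \<gamma> \<mu>) - 2 * (\<eta> * \<kappa>\<^sup>2 / sqrt 5 + \<eta> * \<kappa>\<^sup>2 / 3) = \<kappa>\<^sup>2 * c_eta s \<gamma> \<mu> \<eta>"
    by (simp add: c_eta_def algebra_simps)
  finally show ?thesis .
qed

lemma residual_at_node_le:
  assumes x: "x \<in> X"
  shows "norm (plane_wave \<kappa> x - orth_proj V (plane_wave \<kappa> x)) \<le> \<eta>"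
proof -
  have "plane_wave \<kappa> x \<in> signal_space \<kappa> X"
    unfolding signal_space_def using x by (intro cL2.span_base) auto
  then show ?thesis
    using norm_proj_diff_le_eta[of "plane_wave \<kappa> x"] by (simp add: U.proj_of_mem norm_minus_commute)
qed

text \<open>The real inner product of a wave with its derivative is 0, so the projector may be
  replaced by minus the projector onto the complement. The gradient thus pairs the derivative with
  the residual vector, which has norm at most \<open>\<eta>\<close> at a node.\<close>

lemma residual_d1_at_node_le:
  assumes x: "x \<in> X" and v: "norm v = 1"
  shows "\<bar>residual_d1 \<kappa> V x v\<bar> \<le> 2 * (\<eta> * (\<kappa> / sqrt 3))"
proof -
  let ?r = "plane_wave \<kappa> x - orth_proj V (plane_wave \<kappa> x)"
  have "inner (wave 1 \<kappa> v x) (plane_wave \<kappa> x) = 0"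
    unfolding inner_eq_Re_cinner cinner_wave by (simp add: kern1_def)
  then have "residual_d1 \<kappa> V x v = 2 * inner (wave 1 \<kappa> v x) ?r"
    unfolding residual_d1_def plane_wave_eq_wave[of \<kappa> x v, symmetric] V.inner_proj_self_adjoint
    by (simp add: inner_diff_right)
  also have "\<bar>\<dots>\<bar> \<le> 2 * (norm (wave 1 \<kappa> v x) * norm ?r)"
    using Cauchy_Schwarz_ineq2[of "wave 1 \<kappa> v x" ?r] by (simp add: abs_mult)
  also have "\<dots> \<le> 2 * (\<kappa> / sqrt 3 * \<eta>)"
    unfolding norm_wave(2)[OF \<kappa> v] using residual_at_node_le[OF x] \<kappa>
    by (intro mult_left_mono) auto
  finally show ?thesis by (simp add: mult_ac)
qed

text \<open>Each ball about a node contains exactly one point of the set by strong convexity, none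
  lies outside by \<open>residual_gt\<close>, and the open balls are disjoint because their radius
  is at most half the separation. The displacement is at most gradient bound over convexity
  constant, \<open>G / m\<close>, which is the claimed radius.\<close>

lemma loc_set_matches:
  "loc_set \<kappa> \<eta> V \<in> point_sets s"
  "d_match (loc_set \<kappa> \<eta> V) X \<le> 2 / (sqrt 3 * c_eta s \<gamma> \<mu> \<eta>) * (\<eta> / \<kappa>)"
proof -
  let ?Z = "loc_set \<kappa> \<eta> V" and ?\<rho> = "\<gamma> / \<kappa>"
  define R where "R = 2 / (sqrt 3 * c_eta s \<gamma> \<mu> \<eta>) * (\<eta> / \<kappa>)"
  have \<eta>': "\<eta> < eta_loc s \<gamma> \<mu>" "\<eta> < eta_gap s \<gamma> \<mu>" using \<eta>(2) by (simp_all add: eta_star_def)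
  note cb = c_eta_bounds[OF \<kappa> \<gamma> \<eta>(1) \<eta>'(1)]
  interpret F: line_smooth "residual \<kappa> V" "residual_d1 \<kappa> V" "residual_d2 \<kappa> V"
    by (rule line_smooth_residual[OF projectable_Gr[OF V] \<kappa>])
  define m G where "m = \<kappa>\<^sup>2 * c_eta s \<gamma> \<mu> \<eta>" and "G = 2 * (\<eta> * (\<kappa> / sqrt 3))"
  have m: "0 < m" using \<kappa> cb by (simp add: m_def)
  have G: "0 \<le> G" "G < m * ?\<rho>" using \<kappa> \<eta> cb by (simp_all add: G_def m_def)
  have GR: "G / m = R" using \<kappa> cb by (simp add: G_def m_def R_def power2_eq_square field_simps)
  have d2: "m \<le> residual_d2 \<kappa> V z v" if "x \<in> X" "z \<in> cball x ?\<rho>" "norm v = 1" for x z v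
    unfolding m_def by (rule residual_d2_ge[OF that])
  have d1: "\<bar>residual_d1 \<kappa> V x v\<bar> \<le> G" if "x \<in> X" "norm v = 1" for x v
    unfolding G_def by (rule residual_d1_at_node_le[OF that])
  have Z_iff: "z \<in> ?Z \<longleftrightarrow> z \<in> ball 0 1 \<and> residual \<kappa> V z \<le> \<eta>\<^sup>2 \<and> F.critical z" for z
    by (auto simp: loc_set_def F.critical_def)
  have ex: "\<exists>z. z \<in> ?Z \<and> dist z x < ?\<rho>" if x: "x \<in> X" for x
  proof -
    obtain z where z: "z \<in> ball x ?\<rho>" "residual \<kappa> V z \<le> residual \<kappa> V x" "F.critical z"
      using F.critical_exists[OF m d2[OF x] d1[OF x] G] by blast
    have "residual \<kappa> V x \<le> \<eta>\<^sup>2"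
      unfolding residual_def by (intro power_mono residual_at_node_le x) auto
    moreover have "z \<in> ball 0 1"
      using z(1) cball_subset[OF x] ball_subset_cball by blast
    ultimately show ?thesis using z by (auto simp: Z_iff dist_commute)
  qed
  have near_dist: "dist z x \<le> R" if "x \<in> X" "z \<in> ?Z" "dist z x < ?\<rho>" for x z
    unfolding GR[symmetric]
  proof (rule F.critical_dist_le[OF m d2[OF that(1)] d1[OF that(1)] G])
    show "z \<in> cball x ?\<rho>" using that by (simp add: dist_commute)
    show "residual_d1 \<kappa> V z u \<le> 0" if "z \<noteq> x" "u = (z - x) /\<^sub>R norm (z - x)" for u
      using \<open>z \<in> ?Z\<close> that by (simp add: loc_set_def)
  qed
  have unique: "y = z" if "x \<in> X" "y \<in> ?Z" "z \<in> ?Z" "dist y x < ?\<rho>" "dist z x < ?\<rho>" for x y z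
    by (rule F.critical_unique[OF m d2[OF that(1)] d1[OF that(1)] G])
       (use that in \<open>auto simp: Z_iff dist_commute\<close>)
  have covered: "\<exists>x\<in>X. dist z x < ?\<rho>" if "z \<in> ?Z" for z
    using residual_gt[OF A V \<eta>(1) \<eta>'(2) near, of z] that unfolding Z_iff by (meson not_le)
  obtain f where f: "\<And>x. x \<in> X \<Longrightarrow> f x \<in> ?Z \<and> dist (f x) x < ?\<rho>"
    using ex by metis
  have inj: "inj_on f X"
  proof (rule inj_onI, rule ccontr)
    fix x y assume xy: "x \<in> X" "y \<in> X" "f x = f y" "x \<noteq> y"
    have "dist x y < 2 * ?\<rho>"
      using f[OF xy(1)] f[OF xy(2)] dist_triangle3[of x y "f x"] xy(3) by simp
    then show False using sep_le[OF xy(1,2,4)] rho_le by linarith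
  qed
  have im: "f ` X = ?Z"
  proof
    show "f ` X \<subseteq> ?Z" using f by auto
    show "?Z \<subseteq> f ` X"
    proof
      fix z assume z: "z \<in> ?Z"
      then obtain x where x: "x \<in> X" "dist z x < ?\<rho>" using covered by blast
      then show "z \<in> f ` X" using unique[OF x(1) z] f[OF x(1)] by blast
    qed
  qed
  have bij: "bij_betw f X ?Z" using inj im by (simp add: bij_betw_def)
  have finZ: "finite ?Z" unfolding im[symmetric] using finite_X by simp
  have "card ?Z = s" using bij_betw_same_card[OF bij] card_X by simp
  then show "?Z \<in> point_sets s" using finZ by (auto simp: point_sets_def loc_set_def)
  have "d_match ?Z X \<le> R"
  proof (rule d_match_le[OF finZ finite_X])
    show "?Z \<noteq> {}" unfolding im[symmetric] using X_nonempty by simp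
    show "bij_betw (inv_into X f) ?Z X" by (rule bij_betw_inv_into[OF bij])
    fix z assume z: "z \<in> ?Z"
    define x where "x = inv_into X f z"
    have x: "x \<in> X" "f x = z" using z im unfolding x_def by (auto intro: inv_into_into f_inv_into_f)
    show "dist z (inv_into X f z) \<le> R"
      unfolding x_def[symmetric] using near_dist[OF x(1) z] f[OF x(1)] x(2) by simp
  qed
  then show "d_match ?Z X \<le> 2 / (sqrt 3 * c_eta s \<gamma> \<mu> \<eta>) * (\<eta> / \<kappa>)" by (simp add: R_def)
qed

end

section \<open>Rotation of the signal space under displacement of one node\<close>

lemma signal_in_Gr: "signal_space \<kappa> X \<in> Gr s"
  using frame.span_in_Gr by (simp add: signal_space_eq card_X)

text \<open>Exchanging one wave in the expansion of \<open>u\<close> leaves an error of one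
  coefficient times a difference of two waves. The coefficient is at most
  \<open>norm u / sqrt (1 - \<mu>)\<close>, and the difference is Lipschitz with constant
  \<open>\<kappa> / sqrt 3\<close>.\<close>

lemma displaced_residual_le:
  assumes Y: "projectable (signal_space \<kappa> Y)" and XW: "X = insert x W" "x \<notin> W"
    and WY: "insert y W \<subseteq> Y" and u: "u \<in> signal_space \<kappa> X"
  shows "norm (u - orth_proj (signal_space \<kappa> Y) u) \<le> \<kappa> * dist x y / sqrt (3 * (1 - \<mu>)) * norm u"
proof -
  interpret Y: projectable "signal_space \<kappa> Y" by (rule Y)
  obtain c where c: "u = frame.synth c"
    using u unfolding signal_space_eq[symmetric] frame.span_eq_range_synth by auto
  have finW: "finite W" using finite_X XW by simp
  \<comment> \<open>The same expansion with the wave at \<open>x\<close> replaced by that at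
    \<open>y\<close>: a competitor to the projection of \<open>u\<close>.\<close>
  define w where "w = (\<Sum>a\<in>W. scaleC (c a) (plane_wave \<kappa> a)) + scaleC (c x) (plane_wave \<kappa> y)"
  have "w \<in> signal_space \<kappa> Y"
    unfolding w_def signal_space_def
    by (intro cL2.span_add cL2.span_sum cL2.span_scale cL2.span_base) (use WY in auto)
  then have "norm (u - orth_proj (signal_space \<kappa> Y) u) \<le> norm (u - w)"
    by (rule Y.norm_diff_proj_le)
  also have "u - w = scaleC (c x) (plane_wave \<kappa> x - plane_wave \<kappa> y)"
    unfolding c frame.synth_def w_def using XW finW by (simp add: cL2.scale_right_diff_distrib)
  also have "norm \<dots> \<le> cmod (c x) * (\<kappa> * dist x y / sqrt 3)"
    unfolding norm_scaleC by (intro mult_left_mono norm_plane_wave_diff_le \<kappa>) auto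
  also have "\<dots> \<le> norm u / sqrt (1 - \<mu>) * (\<kappa> * dist x y / sqrt 3)"
  proof (intro mult_right_mono)
    have "(1 - \<mu>) * (cmod (c x))\<^sup>2 \<le> (1 - \<mu>) * (\<Sum>a\<in>X. (cmod (c a))\<^sup>2)"
      using finite_X XW(1) \<mu> by (intro mult_left_mono member_le_sum) auto
    also have "\<dots> \<le> (norm u)\<^sup>2" unfolding c by (rule frame.synth_coeff_le)
    finally have "sqrt (1 - \<mu>) * cmod (c x) \<le> norm u"
      using real_sqrt_le_mono[of "(1 - \<mu>) * (cmod (c x))\<^sup>2" "(norm u)\<^sup>2"] by (simp add: real_sqrt_mult)
    then show "cmod (c x) \<le> norm u / sqrt (1 - \<mu>)"
      using \<mu> by (simp add: field_simps)
  qed (use \<kappa> in auto)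
  also have "\<dots> = \<kappa> * dist x y / sqrt (3 * (1 - \<mu>)) * norm u"
    unfolding real_sqrt_mult by (simp add: mult_ac)
  finally show ?thesis .
qed

end

lemma proj_dist_displaced_le:
  assumes "uniform_config s \<kappa> \<gamma> \<mu> (insert x W)" "uniform_config s \<kappa> \<gamma> \<mu> (insert y W)"
    and "x \<notin> W" "y \<notin> W"
  shows "proj_dist (signal_space \<kappa> (insert x W)) (signal_space \<kappa> (insert y W)) \<le> \<kappa> * dist x y / sqrt (3 * (1 - \<mu>))"
proof -
  interpret X: uniform_config s \<kappa> \<gamma> \<mu> "insert x W" by (rule assms)
  interpret Y: uniform_config s \<kappa> \<gamma> \<mu> "insert y W" by (rule assms)
  show ?thesis
  proof (rule proj_dist_leI[OF X.projectable_signal Y.projectable_signal])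
    show "0 \<le> \<kappa> * dist x y / sqrt (3 * (1 - \<mu>))" using X.\<kappa> X.\<mu> by simp
    show "norm (u - orth_proj (signal_space \<kappa> (insert y W)) u) \<le> \<kappa> * dist x y / sqrt (3 * (1 - \<mu>)) * norm u"
      if "u \<in> signal_space \<kappa> (insert x W)" for u
      by (rule X.displaced_residual_le[OF Y.projectable_signal refl assms(3) subset_refl that])
    show "norm (u - orth_proj (signal_space \<kappa> (insert x W)) u) \<le> \<kappa> * dist x y / sqrt (3 * (1 - \<mu>)) * norm u"
      if "u \<in> signal_space \<kappa> (insert y W)" for u
      using Y.displaced_residual_le[OF X.projectable_signal refl assms(4) subset_refl that] by (simp add: dist_commute)
  qed
qed

lemma proj_dist_self: "proj_dist V V = 0"
  by (simp add: proj_dist_def onorm_zero)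

section \<open>Bounds for the localization modulus\<close>

lemma loc_modulus_upper:
  assumes s: "2 \<le> s" and \<gamma>: "0 < \<gamma>" and \<mu>: "0 \<le> \<mu>" "\<mu> < 1" and C2: "C2 s \<gamma> \<mu> < 2 / 3"
    and A: "0 < A_star s \<gamma> \<mu>" and \<kappa>: "0 < \<kappa>" and ne: "\<XX> \<noteq> {}" and sub: "\<XX> \<subseteq> uniform_class s \<kappa> \<gamma> \<mu>"
    and \<eta>: "0 \<le> \<eta>" "\<eta> < eta_star s \<gamma> \<mu>"
  shows "loc_modulus s \<kappa> \<XX> \<eta> \<le> ereal (2 / (sqrt 3 * c_eta s \<gamma> \<mu> \<eta>) * (\<eta> / \<kappa>))"
proof -
  obtain X0 where "X0 \<in> \<XX>" using ne by auto
  then have X0: "X0 \<in> point_sets s" using sub by (auto simp: uniform_class_def)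
  \<comment> \<open>The infimum ranges over total maps into \<open>point_sets s\<close>, while far
    from every signal space the critical set may have any size; there a fixed configuration serves
    as default value.\<close>
  define Xhat where "Xhat V = (if loc_set \<kappa> \<eta> V \<in> point_sets s then loc_set \<kappa> \<eta> V else X0)" for V
  have mem: "Xhat \<in> Gr s \<rightarrow> point_sets s" using X0 by (simp add: Xhat_def)
  show ?thesis
    unfolding loc_modulus_def
  proof (rule INF_lower2[OF mem], intro SUP_least)
    fix X V assume "X \<in> \<XX>" and V: "V \<in> {U \<in> Gr s. proj_dist U (signal_space \<kappa> X) \<le> \<eta>}"
    then interpret uniform_config s \<kappa> \<gamma> \<mu> X
      using s \<gamma> \<mu> \<kappa> sub by unfold_locales auto
    show "ereal (d_match (Xhat V) X) \<le> ereal (2 / (sqrt 3 * c_eta s \<gamma> \<mu> \<eta>) * (\<eta> / \<kappa>))"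
      using loc_set_matches[OF C2 A _ \<eta>, of V] V by (simp add: Xhat_def)
  qed
qed

text \<open>Two-point argument: the signal space of \<open>X0\<close> is admissible data both for
  \<open>X0\<close> and for the displaced configuration, and no estimate can be closer than
  \<open>t / 2\<close> to both.\<close>

lemma loc_modulus_lower:
  assumes s: "2 \<le> s" and \<gamma>: "0 < \<gamma>" and \<mu>: "0 \<le> \<mu>" "\<mu> < 1" and \<kappa>: "0 < \<kappa>"
    and sub: "\<XX> \<subseteq> uniform_class s \<kappa> \<gamma> \<mu>" and path: "displacement_path \<XX> t0"
    and \<eta>: "0 < \<eta>" "\<eta> \<le> \<kappa> * t0 / sqrt (3 * (1 - \<mu>))"
  shows "ereal (sqrt (3 * (1 - \<mu>)) / 2 * (\<eta> / \<kappa>)) \<le> loc_modulus s \<kappa> \<XX> \<eta>"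
proof -
  have config: "uniform_config s \<kappa> \<gamma> \<mu> X" if "X \<in> \<XX>" for X
    using s \<gamma> \<mu> \<kappa> sub that by unfold_locales auto
  obtain X0 x v where X0: "X0 \<in> \<XX>" and x: "x \<in> X0" and v: "norm v = 1" and t0: "t0 \<le> min_sep X0 / 4"
    and path': "\<And>t. 0 \<le> t \<Longrightarrow> t \<le> t0 \<Longrightarrow> insert (x + t *\<^sub>R v) (X0 - {x}) \<in> \<XX>"
    using path unfolding displacement_path_def by auto
  define q where "q = sqrt (3 * (1 - \<mu>))"
  have q: "q > 0" using \<mu> by (simp add: q_def)
  \<comment> \<open>The displacement whose bound on the projector distance,
    \<open>\<kappa> * t / q\<close>, is exactly \<open>\<eta>\<close>; the condition on
    \<open>\<eta>\<close> keeps it within the path.\<close>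
  define t where "t = q * \<eta> / \<kappa>"
  have t: "0 < t" "t \<le> t0" and tq: "\<kappa> * t / q = \<eta>"
    using \<eta>[folded q_def] q \<kappa> by (simp_all add: t_def field_simps)
  define W y where "W = X0 - {x}" and "y = x + t *\<^sub>R v"
  have X0W: "X0 = insert x W" using x by (auto simp: W_def)
  have X1: "insert y W \<in> \<XX>" unfolding y_def W_def using path' t by simp
  interpret X: uniform_config s \<kappa> \<gamma> \<mu> X0 by (rule config[OF X0])
  interpret Y: uniform_config s \<kappa> \<gamma> \<mu> "insert y W" by (rule config[OF X1])
  have dxy: "dist x y = t" using v t by (simp add: y_def dist_norm)
  \<comment> \<open>Since \<open>t\<close> is at most a quarter of the separation, the remaining
    nodes are farther from \<open>x\<close> than \<open>y\<close> is, so \<open>x\<close> is missed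
    by \<open>t\<close> whatever it is matched with.\<close>
  have far: "t \<le> dist x a" if "a \<in> insert y W" for a
  proof (cases "a = y")
    case False
    then have "a \<in> X0" "x \<noteq> a" using that by (auto simp: W_def)
    then show ?thesis using X.sep_le[OF x, of a] t t0 X.sep_pos by linarith
  qed (simp add: dxy)
  have yW: "y \<notin> W"
  proof
    assume "y \<in> W"
    then have "min_sep X0 \<le> dist x y" by (intro X.sep_le x) (auto simp: W_def)
    then show False using t t0 X.sep_pos unfolding dxy by linarith
  qed
  let ?U = "signal_space \<kappa> X0"
  have U: "?U \<in> Gr s" by (rule X.signal_in_Gr)
  have U0: "proj_dist ?U ?U \<le> \<eta>" using \<eta> by (simp add: proj_dist_self)
  have U1: "proj_dist ?U (signal_space \<kappa> (insert y W)) \<le> \<eta>"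
    using proj_dist_displaced_le[OF config[OF X0, unfolded X0W] config[OF X1] _ yW]
    unfolding X0W[symmetric] dxy q_def[symmetric] tq by (simp add: W_def)
  show ?thesis
    unfolding loc_modulus_def
  proof (rule INF_greatest)
    fix Xhat assume "Xhat \<in> Gr s \<rightarrow> point_sets s"
    then have "Xhat ?U \<in> point_sets s" using U by auto
    then have Xhat: "finite (Xhat ?U)" "card (Xhat ?U) = s" by (simp_all add: point_sets_def)
    let ?S = "SUP X\<in>\<XX>. SUP U\<in>{U \<in> Gr s. proj_dist U (signal_space \<kappa> X) \<le> \<eta>}. ereal (d_match (Xhat U) X)"
    have ub: "ereal (d_match (Xhat ?U) X) \<le> ?S" if "X \<in> \<XX>" "proj_dist ?U (signal_space \<kappa> X) \<le> \<eta>" for X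
      by (rule SUP_upper2[OF that(1)], rule SUP_upper2[of ?U]) (use U that in auto)
    have "t \<le> d_match (Xhat ?U) X0 + d_match (Xhat ?U) (insert y W)"
      by (rule d_match_sum_ge[OF Xhat(1) X.finite_X Y.finite_X _ _ x far])
         (simp_all only: Xhat(2) X.card_X Y.card_X)
    then have "t / 2 \<le> d_match (Xhat ?U) X0 \<or> t / 2 \<le> d_match (Xhat ?U) (insert y W)" by linarith
    then have "ereal (t / 2) \<le> ?S"
      using ub[OF X0 U0] ub[OF X1 U1] by (meson ereal_less_eq(3) order_trans)
    then show "ereal (sqrt (3 * (1 - \<mu>)) / 2 * (\<eta> / \<kappa>)) \<le> ?S"
      unfolding q_def[symmetric] t_def by (simp add: mult.commute)
  qed
qed

lemma eta_star_pos:
  assumes "0 < \<gamma>" "0 \<le> \<mu>" "\<mu> < 1" "C2 s \<gamma> \<mu> < 2 / 3" "0 < A_star s \<gamma> \<mu>"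
  shows "0 < eta_star s \<gamma> \<mu>"
proof -
  have "0 < eta_loc s \<gamma> \<mu>"
    unfolding eta_loc_def using assms by (intro divide_pos_pos mult_pos_pos add_pos_pos) auto
  moreover have "0 < eta_gap s \<gamma> \<mu>"
  proof -
    have A: "0 < sqrt (A_star s \<gamma> \<mu>)" "sqrt (A_star s \<gamma> \<mu>) \<le> 1"
      using assms A_star_le_1[of \<gamma> \<mu> s] by simp_all
    have "arcsin 0 < arcsin (sqrt (A_star s \<gamma> \<mu>))"
      by (rule arcsin_less_arcsin) (use A in linarith)+
    moreover have "arcsin (sqrt (A_star s \<gamma> \<mu>)) \<le> pi / 2"
      by (rule arcsin_ubound) (use A in linarith)+
    ultimately show ?thesis
      unfolding eta_gap_def arcsin_0 by (intro sin_gt_zero) (use pi_gt_zero in linarith)+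
  qed
  ultimately show ?thesis by (simp add: eta_star_def)
qed

theorem theorem2p5:
  fixes s :: nat and \<gamma> \<mu> :: real
  assumes "s \<ge> 2" and "\<gamma> > 0" and "0 \<le> \<mu>" and "\<mu> < 1"
    and "C2 s \<gamma> \<mu> < 2 / 3" and "A_star s \<gamma> \<mu> > 0"
  shows
    "(\<forall>\<kappa>>0. \<forall>\<XX>. \<XX> \<noteq> {} \<and> \<XX> \<subseteq> uniform_class s \<kappa> \<gamma> \<mu> \<longrightarrow>
        (\<forall>\<eta>. 0 \<le> \<eta> \<and> \<eta> < eta_star s \<gamma> \<mu> \<longrightarrow>
           loc_modulus s \<kappa> \<XX> \<eta> \<le> ereal (2 / (sqrt 3 * c_eta s \<gamma> \<mu> \<eta>) * (\<eta> / \<kappa>)))) \<and>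
     (\<forall>\<kappa>>0. \<forall>\<XX> t0. \<XX> \<subseteq> uniform_class s \<kappa> \<gamma> \<mu> \<and> displacement_path \<XX> t0 \<longrightarrow>
        (\<forall>\<eta>. 0 < \<eta> \<and> \<eta> < eta_star s \<gamma> \<mu> \<and> \<eta> \<le> \<kappa> * t0 / sqrt (3 * (1 - \<mu>)) \<longrightarrow>
           ereal (sqrt (3 * (1 - \<mu>)) / 2 * (\<eta> / \<kappa>)) \<le> loc_modulus s \<kappa> \<XX> \<eta> \<and>
           loc_modulus s \<kappa> \<XX> \<eta> \<le> ereal (2 / (sqrt 3 * c_eta s \<gamma> \<mu> \<eta>) * (\<eta> / \<kappa>)))) \<and>
     (\<exists>c>0. \<exists>C>0. \<forall>\<kappa>>0. \<forall>\<XX>. \<XX> \<subseteq> uniform_class s \<kappa> \<gamma> \<mu> \<and> (\<exists>t0. displacement_path \<XX> t0) \<longrightarrow>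
        (\<forall>\<^sub>F \<eta> in at_right 0.
           ereal (c * (\<eta> / \<kappa>)) \<le> loc_modulus s \<kappa> \<XX> \<eta> \<and>
           loc_modulus s \<kappa> \<XX> \<eta> \<le> ereal (C * (\<eta> / \<kappa>))))"
proof -
  note upper = loc_modulus_upper[OF assms]
  note lower = loc_modulus_lower[OF assms(1-4)]
  have path_ne: "\<XX> \<noteq> {}" if "displacement_path \<XX> t0" for \<XX> t0
    using that by (auto simp: displacement_path_def)
  \<comment> \<open>Half the value of \<open>c_eta\<close> at \<open>\<eta> = 0\<close>. As
    \<open>c_eta\<close> decreases with slope \<open>K\<close>, it stays above \<open>h\<close> for
    \<open>\<eta> \<le> h / K\<close>, which makes the upper constant independent of
    \<open>\<eta>\<close>.\<close>
  define h where "h = (2 / 3 - C2 s \<gamma> \<mu>) / 2"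
  have h: "h > 0" using assms(5) by (simp add: h_def)
  define K where "K = 2 / sqrt 5 + 2 / (3::real)"
  have K: "K > 0" by (simp add: K_def add_pos_pos)
  have third: "\<forall>\<^sub>F \<eta> in at_right 0.
      ereal (sqrt (3 * (1 - \<mu>)) / 2 * (\<eta> / \<kappa>)) \<le> loc_modulus s \<kappa> \<XX> \<eta> \<and>
      loc_modulus s \<kappa> \<XX> \<eta> \<le> ereal (2 / (sqrt 3 * h) * (\<eta> / \<kappa>))"
    if \<kappa>: "\<kappa> > 0" and sub: "\<XX> \<subseteq> uniform_class s \<kappa> \<gamma> \<mu>" and path: "displacement_path \<XX> t0" for \<kappa> \<XX> t0
  proof -
    \<comment> \<open>Only this threshold depends on \<open>\<kappa>\<close> and \<open>t0\<close>;
      the two constants depend on \<open>s\<close>, \<open>\<gamma>\<close> and \<open>\<mu>\<close>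
      alone and can therefore be chosen before the class.\<close>
    define b where "b = min (eta_star s \<gamma> \<mu>) (min (\<kappa> * t0 / sqrt (3 * (1 - \<mu>))) (h / K))"
    have "t0 > 0" using path by (simp add: displacement_path_def)
    then have b: "b > 0"
      unfolding b_def using eta_star_pos[OF assms(2-6)] \<kappa> assms(4) h K by simp
    show ?thesis
      unfolding eventually_at_right_field
    proof (intro exI[of _ b] conjI b allI impI)
      fix \<eta> :: real assume \<eta>: "0 < \<eta>" "\<eta> < b"
      have "\<eta> \<le> \<kappa> * t0 / sqrt (3 * (1 - \<mu>))" using \<eta> by (simp add: b_def)
      from lower[OF \<kappa> sub path \<eta>(1) this]
      show "ereal (sqrt (3 * (1 - \<mu>)) / 2 * (\<eta> / \<kappa>)) \<le> loc_modulus s \<kappa> \<XX> \<eta>" .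
      have "\<eta> < h / K" using \<eta> by (simp add: b_def)
      then have "K * \<eta> \<le> h" using K by (simp add: field_simps)
      then have c: "h \<le> c_eta s \<gamma> \<mu> \<eta>" by (simp add: c_eta_def h_def flip: K_def)
      have "loc_modulus s \<kappa> \<XX> \<eta> \<le> ereal (2 / (sqrt 3 * c_eta s \<gamma> \<mu> \<eta>) * (\<eta> / \<kappa>))"
        by (rule upper[OF \<kappa> path_ne[OF path] sub]) (use \<eta> in \<open>simp_all add: b_def\<close>)
      also have "\<dots> \<le> ereal (2 / (sqrt 3 * h) * (\<eta> / \<kappa>))"
      proof -
        have "2 / (sqrt 3 * c_eta s \<gamma> \<mu> \<eta>) \<le> 2 / (sqrt 3 * h)"
          using c h by (intro divide_left_mono) auto
        then show ?thesis using \<eta> \<kappa> by (simp only: ereal_less_eq) (intro mult_right_mono, auto)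
      qed
      finally show "loc_modulus s \<kappa> \<XX> \<eta> \<le> ereal (2 / (sqrt 3 * h) * (\<eta> / \<kappa>))" .
    qed
  qed
  have pos: "sqrt (3 * (1 - \<mu>)) / 2 > 0" "2 / (sqrt 3 * h) > 0" using assms(4) h by simp_all
  show ?thesis
  proof (intro conjI)
    show "\<forall>\<kappa>>0. \<forall>\<XX>. \<XX> \<noteq> {} \<and> \<XX> \<subseteq> uniform_class s \<kappa> \<gamma> \<mu> \<longrightarrow>
        (\<forall>\<eta>. 0 \<le> \<eta> \<and> \<eta> < eta_star s \<gamma> \<mu> \<longrightarrow>
           loc_modulus s \<kappa> \<XX> \<eta> \<le> ereal (2 / (sqrt 3 * c_eta s \<gamma> \<mu> \<eta>) * (\<eta> / \<kappa>)))"
      by (intro allI impI, elim conjE, rule upper)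
    show "\<forall>\<kappa>>0. \<forall>\<XX> t0. \<XX> \<subseteq> uniform_class s \<kappa> \<gamma> \<mu> \<and> displacement_path \<XX> t0 \<longrightarrow>
        (\<forall>\<eta>. 0 < \<eta> \<and> \<eta> < eta_star s \<gamma> \<mu> \<and> \<eta> \<le> \<kappa> * t0 / sqrt (3 * (1 - \<mu>)) \<longrightarrow>
           ereal (sqrt (3 * (1 - \<mu>)) / 2 * (\<eta> / \<kappa>)) \<le> loc_modulus s \<kappa> \<XX> \<eta> \<and>
           loc_modulus s \<kappa> \<XX> \<eta> \<le> ereal (2 / (sqrt 3 * c_eta s \<gamma> \<mu> \<eta>) * (\<eta> / \<kappa>)))"
    proof (intro allI impI, elim conjE, rule conjI)
      fix \<kappa> \<XX> t0 \<eta>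
      assume a: "0 < \<kappa>" "\<XX> \<subseteq> uniform_class s \<kappa> \<gamma> \<mu>" "displacement_path \<XX> t0"
        "0 < \<eta>" "\<eta> < eta_star s \<gamma> \<mu>" "\<eta> \<le> \<kappa> * t0 / sqrt (3 * (1 - \<mu>))"
      show "ereal (sqrt (3 * (1 - \<mu>)) / 2 * (\<eta> / \<kappa>)) \<le> loc_modulus s \<kappa> \<XX> \<eta>"
        by (rule lower[OF a(1-4,6)])
      show "loc_modulus s \<kappa> \<XX> \<eta> \<le> ereal (2 / (sqrt 3 * c_eta s \<gamma> \<mu> \<eta>) * (\<eta> / \<kappa>))"
        by (rule upper[OF a(1) path_ne[OF a(3)] a(2) less_imp_le[OF a(4)] a(5)])
    qed
    show "\<exists>c>0. \<exists>C>0. \<forall>\<kappa>>0. \<forall>\<XX>. \<XX> \<subseteq> uniform_class s \<kappa> \<gamma> \<mu> \<and> (\<exists>t0. displacement_path \<XX> t0) \<longrightarrow>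
        (\<forall>\<^sub>F \<eta> in at_right 0.
           ereal (c * (\<eta> / \<kappa>)) \<le> loc_modulus s \<kappa> \<XX> \<eta> \<and>
           loc_modulus s \<kappa> \<XX> \<eta> \<le> ereal (C * (\<eta> / \<kappa>)))"
      by (rule exI, rule conjI[OF pos(1)], rule exI, rule conjI[OF pos(2)])
         (intro allI impI, elim conjE exE, rule third)
  qed
qed

end
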